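(* Let $G$ be an $m$-uniform hypergraph on $n$ nodes, and let $G_{m,n}$ be the complete $m$-uniform hypergraph on the same $n$ nodes. Then $$j(I(G))\leq j(I(G_{m,n})).$$ In particular, if $G$ is a simple graph on $n$ nodes, then $j(I(G))\leq 2^n-2n$.
   Context: A hypergraph $G$ has a finite non-empty node set $V(G)=\{x_1,\dots,x_n\}$ and an edge set $E(G)$ consisting of subsets of $V(G)$; it is $m$-uniform ($1\le m\le n$) if every edge has exactly $m$ elements. A simple graph is a $2$-uniform hypergraph. The complete $m$-uniform hypergraph $G_{m,n}$ has all $m$-element subsets of the node set as edges. (It is known that, for $n\ge2$, $j(I(G_{m,n}))=m\sum_{k=0}^{m}(-1)^k\binom{n}{k}(m-k)^{n-1}$, i.e. $m$ times an Eulerian number.) Fix a field $\Bbbk$ and view nodes as indeterminates. The edge ideal is $I(G)=(x_{i_1}\cdots x_{i_m}:\{x_{i_1},\dots,x_{i_m}\}\in E(G))\subset R=\Bbbk[x_1,\dots,x_n]_{(x_1,\dots,x_n)}$. For an ideal $I$ in a Noetherian local ring $(R,\mathfrak m)$ of dimension $n\ge1$, the $j$-multiplicity is $j(I)=(n-1)!\lim_{t\to\infty}\lambda_R(\Gamma_{\mathfrak m}(I^t/I^{t+1}))/t^{n-1}$, where $\lambda_R$ is length and $\Gamma_{\mathfrak m}$ is the zeroth local cohomology. *)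

theory Defs
  imports
    "HOL-Algebra.Algebra"
    "HOL-Library.Poly_Mapping"
    "HOL-Library.Extended_Real"
begin

section \<open>Hypergraphs\<close>

record 'v hypergraph =
  nodes :: "'v set"
  edges :: "'v set set"

definition hypergraph :: "'v hypergraph \<Rightarrow> bool" where
  "hypergraph G \<longleftrightarrow> finite (nodes G) \<and> nodes G \<noteq> {} \<and> edges G \<subseteq> Pow (nodes G)"

definition uniform_hypergraph :: "nat \<Rightarrow> 'v hypergraph \<Rightarrow> bool" where
  "uniform_hypergraph m G \<longleftrightarrow>
     hypergraph G \<and> 1 \<le> m \<and> m \<le> card (nodes G) \<and> (\<forall>e \<in> edges G. card e = m)"

definition simple_graph :: "'v hypergraph \<Rightarrow> bool" where
  "simple_graph G \<longleftrightarrow> uniform_hypergraph 2 G"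

definition complete_hypergraph :: "nat \<Rightarrow> 'v set \<Rightarrow> 'v hypergraph" where
  "complete_hypergraph m V = \<lparr>nodes = V, edges = {e. e \<subseteq> V \<and> card e = m}\<rparr>"


section \<open>Localization of a commutative ring at a multiplicative set\<close>

definition loc_rel :: "('a, 'b) ring_scheme \<Rightarrow> 'a set \<Rightarrow> (('a \<times> 'a) \<times> ('a \<times> 'a)) set" where
  "loc_rel A S = {((a, s), (b, t)). a \<in> carrier A \<and> s \<in> S \<and> b \<in> carrier A \<and> t \<in> S \<and>
     (\<exists>u \<in> S. u \<otimes>\<^bsub>A\<^esub> (a \<otimes>\<^bsub>A\<^esub> t) = u \<otimes>\<^bsub>A\<^esub> (b \<otimes>\<^bsub>A\<^esub> s))}"

definition loc_frac :: "('a, 'b) ring_scheme \<Rightarrow> 'a set \<Rightarrow> 'a \<Rightarrow> 'a \<Rightarrow> ('a \<times> 'a) set" where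
  "loc_frac A S a s = loc_rel A S `` {(a, s)}"

text \<open>The operations are taken over all representatives; since the resulting fraction does not
  depend on them, the unions below are unions of copies of a single class.\<close>

definition localization :: "('a, 'b) ring_scheme \<Rightarrow> 'a set \<Rightarrow> (('a \<times> 'a) set) ring" where
  "localization A S =
     \<lparr>carrier = (carrier A \<times> S) // loc_rel A S,
      monoid.mult = (\<lambda>C D. \<Union>(a, s) \<in> C. \<Union>(b, t) \<in> D.
         loc_frac A S (a \<otimes>\<^bsub>A\<^esub> b) (s \<otimes>\<^bsub>A\<^esub> t)),
      one = loc_frac A S \<one>\<^bsub>A\<^esub> \<one>\<^bsub>A\<^esub>,
      ring.zero = loc_frac A S \<zero>\<^bsub>A\<^esub> \<one>\<^bsub>A\<^esub>,
      add = (\<lambda>C D. \<Union>(a, s) \<in> C. \<Union>(b, t) \<in> D.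
         loc_frac A S (a \<otimes>\<^bsub>A\<^esub> t \<oplus>\<^bsub>A\<^esub> b \<otimes>\<^bsub>A\<^esub> s) (s \<otimes>\<^bsub>A\<^esub> t))\<rparr>"

definition localization_at_prime ::
    "('a, 'b) ring_scheme \<Rightarrow> 'a set \<Rightarrow> (('a \<times> 'a) set) ring" where
  "localization_at_prime A P = localization A (carrier A - P)"


section \<open>Krull dimension, quotient modules and length\<close>

definition krull_dim :: "('a, 'b) ring_scheme \<Rightarrow> enat" where
  "krull_dim R = Sup {enat r | r. \<exists>P. (\<forall>i\<le>r. primeideal (P i) R) \<and> (\<forall>i<r. P i \<subset> P (Suc i))}"

text \<open>Only meaningful for local rings, where the maximal ideal is unique.\<close>

definition max_ideal :: "('a, 'b) ring_scheme \<Rightarrow> 'a set" where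
  "max_ideal R = (THE M. maximalideal M R)"

abbreviation ideal_power :: "('a, 'b) ring_scheme \<Rightarrow> 'a set \<Rightarrow> nat \<Rightarrow> 'a set" where
  "ideal_power R I t \<equiv> I [^]\<^bsub>ideals_set R\<^esub> t"

definition ideal_module :: "('a, 'b) ring_scheme \<Rightarrow> 'a set \<Rightarrow> ('a, 'a) module" where
  "ideal_module R I =
     \<lparr>carrier = I, monoid.mult = (\<otimes>\<^bsub>R\<^esub>), one = \<one>\<^bsub>R\<^esub>, ring.zero = \<zero>\<^bsub>R\<^esub>, add = (\<oplus>\<^bsub>R\<^esub>),
      smult = (\<otimes>\<^bsub>R\<^esub>)\<rparr>"

text \<open>The module record inherits the fields for multiplication and one from rings; they play no
  role for modules and are left unspecified.\<close>

definition quotient_module :: "('a, 'b, 'c) module_scheme \<Rightarrow> 'b set \<Rightarrow> ('a, 'b set) module" where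
  "quotient_module M N =
     \<lparr>carrier = a_rcosets\<^bsub>M\<^esub> N, monoid.mult = undefined, one = undefined, ring.zero = N,
      add = set_add M, smult = (\<lambda>a C. \<Union>x \<in> C. N +>\<^bsub>M\<^esub> (a \<odot>\<^bsub>M\<^esub> x))\<rparr>"

definition module_length :: "('a, 'd) ring_scheme \<Rightarrow> ('a, 'b, 'c) module_scheme \<Rightarrow> enat" where
  "module_length R M =
     Sup {enat r | r. \<exists>N. (\<forall>i\<le>r. submodule (N i) R M) \<and> (\<forall>i<r. N i \<subset> N (Suc i))}"

text \<open>Zeroth local cohomology with respect to an ideal: the elements killed by some power of it.\<close>

definition local_cohomology0 ::
    "('a, 'd) ring_scheme \<Rightarrow> 'a set \<Rightarrow> ('a, 'b) module \<Rightarrow> ('a, 'b) module" where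
  "local_cohomology0 R J M =
     M\<lparr>carrier := {x \<in> carrier M. \<exists>k. \<forall>a \<in> ideal_power R J k. a \<odot>\<^bsub>M\<^esub> x = \<zero>\<^bsub>M\<^esub>}\<rparr>"


section \<open>The j-multiplicity\<close>

text \<open>Defined for an ideal of a Noetherian local ring of dimension at least 1. The limit is taken in
  the extended reals because lengths are a priori extended natural numbers.\<close>

definition j_multiplicity :: "('a, 'b) ring_scheme \<Rightarrow> 'a set \<Rightarrow> ereal" where
  "j_multiplicity R I =
     (let d = the_enat (krull_dim R) in
      ereal (fact (d - 1)) *
      lim (\<lambda>t::nat.
        ereal_of_enat
          (module_length R
            (local_cohomology0 R (max_ideal R)
              (quotient_module (ideal_module R (ideal_power R I t)) (ideal_power R I (Suc t)))))
        / ereal (real t ^ (d - 1))))"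


section \<open>Edge ideals\<close>

text \<open>Polynomials are finitely supported functions from exponent vectors, themselves finitely
  supported, to coefficients. All variables are available in the type; the carrier consists of
  the polynomials in which only variables from a given set occur.\<close>

type_synonym ('v, 'k) mpol = "('v \<Rightarrow>\<^sub>0 nat) \<Rightarrow>\<^sub>0 'k"

definition mpoly_ring :: "'k::field itself \<Rightarrow> 'v set \<Rightarrow> ('v, 'k) mpol ring" where
  "mpoly_ring K V =
     \<lparr>carrier = {p. \<forall>e \<in> Poly_Mapping.keys p. Poly_Mapping.keys e \<subseteq> V},
      monoid.mult = (*), one = 1, ring.zero = 0, add = (+)\<rparr>"

definition indet :: "'v \<Rightarrow> ('v, 'k::field) mpol" where
  "indet v = Poly_Mapping.single (Poly_Mapping.single v 1) 1"

definition indet_ideal :: "'k::field itself \<Rightarrow> 'v set \<Rightarrow> ('v, 'k) mpol set" where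
  "indet_ideal K V = Idl\<^bsub>mpoly_ring K V\<^esub> (indet ` V)"

definition node_ring ::
    "'k::field itself \<Rightarrow> 'v set \<Rightarrow> ((('v, 'k) mpol \<times> ('v, 'k) mpol) set) ring" where
  "node_ring K V = localization_at_prime (mpoly_ring K V) (indet_ideal K V)"

definition edge_ideal ::
    "'k::field itself \<Rightarrow> 'v hypergraph \<Rightarrow> (('v, 'k) mpol \<times> ('v, 'k) mpol) set set" where
  "edge_ideal K G =
     Idl\<^bsub>node_ring K (nodes G)\<^esub>
       ((\<lambda>e. loc_frac (mpoly_ring K (nodes G))
               (carrier (mpoly_ring K (nodes G)) - indet_ideal K (nodes G)) (\<Prod>v\<in>e. indet v) 1)
        ` edges G)"

end

theory Submission
  imports Defs "HOL-Computational_Algebra.Polynomial"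
begin

text \<open>
  For a monomial ideal $I$ of the polynomial ring, the length of
  $\Gamma_{\mathfrak m}(I^t/I^{t+1})$ is the number of monomials $x^a \in I^t \setminus I^{t+1}$
  such that for every variable some $x^a x_i^N$ lies in $I^{t+1}$. Writing $a$ as a sum of $t$
  generators plus a slack vector, Dickson's lemma bounds the slack uniformly and shows that this
  number is eventually polynomial in $t$; as it is $O(t^{n-1})$, the limit defining $j(I)$ exists.

  To compare an $m$-uniform $G$ with the complete hypergraph it is enough to compare the sums of
  these numbers over $t \le T$ up to $O(T^{n-1})$. A monomial $a$ counted for $G$ satisfies
  $a_i \le |a|/m + O(1)$ because an edge contains every node at most once, and any $a$ with
  $m(a_i + m) \le |a|$ for all $i$ is counted for the complete hypergraph; the remaining $a$ lie
  within bounded distance of a hyperplane. For $m = 2$ the count for the complete graph is bounded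
  by the number of $a$ with $|a| \in \{2t, 2t+1\}$ and $2a_i \le |a|$, a difference of binomials.

  The Krull dimension is bounded by picking an element from each step of a chain of primes: these
  are algebraically independent, and there are too few polynomials of bounded degree for more than
  $n$ of them.
\<close>

section \<open>Exponent vectors and eventually polynomial counts\<close>

text \<open>The value \<open>lim\<close> carries information only for a convergent sequence, so
  bounds on the counts do not suffice; eventual polynomiality is what excludes oscillation.
  Summation over t \<le> T turns this into a shift of the range of summation, and an error of order
  T^(n-1) is invisible against a difference of order T^n that unequal limits would produce. For m =
  1 the hyperplane estimate breaks down, since with a single node every exponent lies on the
  hyperplane. There the complete hypergraph gives the maximal ideal, and every exponent vector is
  counted. Monomial bookkeeping survives localization because an element with nonzero constant term
  can be cancelled modulo every monomial ideal.\<close>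

abbreviation lookup :: "('a \<Rightarrow>\<^sub>0 'b::zero) \<Rightarrow> 'a \<Rightarrow> 'b" where "lookup \<equiv> Poly_Mapping.lookup"
abbreviation keys :: "('a \<Rightarrow>\<^sub>0 'b::zero) \<Rightarrow> 'a set" where "keys \<equiv> Poly_Mapping.keys"
abbreviation single :: "'a \<Rightarrow> 'b \<Rightarrow> ('a \<Rightarrow>\<^sub>0 'b::zero)" where "single \<equiv> Poly_Mapping.single"

text \<open>The index set is arbitrary because these vectors occur in two roles: as exponents in the
  variables \<open>V\<close>, and as multiplicity vectors over a set \<open>B\<close> of generators,
  whose elements are themselves exponents.\<close>

definition expo :: "'i set \<Rightarrow> ('i \<Rightarrow>\<^sub>0 nat) set" where
  "expo I = {c. keys c \<subseteq> I}"

definition tdeg :: "('i \<Rightarrow>\<^sub>0 nat) \<Rightarrow> nat" where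
  "tdeg c = (\<Sum>i\<in>keys c. lookup c i)"

definition level :: "'i set \<Rightarrow> nat \<Rightarrow> ('i \<Rightarrow>\<^sub>0 nat) set" where
  "level I t = {c \<in> expo I. tdeg c = t}"

definition upclosed :: "'i set \<Rightarrow> ('i \<Rightarrow>\<^sub>0 nat) set \<Rightarrow> bool" where
  "upclosed I U \<longleftrightarrow> U \<subseteq> expo I \<and> (\<forall>c\<in>U. \<forall>d\<in>expo I. c + d \<in> U)"

lemma lookup_outside: "c \<in> expo I \<Longrightarrow> i \<notin> I \<Longrightarrow> lookup c i = 0"
  by (auto simp: expo_def in_keys_iff)

lemma expoI: "(\<And>i. i \<notin> I \<Longrightarrow> lookup c i = 0) \<Longrightarrow> c \<in> expo I"
  by (auto simp: expo_def in_keys_iff)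

lemma tdeg_eq: assumes "finite I" "c \<in> expo I" shows "tdeg c = (\<Sum>i\<in>I. lookup c i)"
  unfolding tdeg_def using assms
  by (intro sum.mono_neutral_left) (auto simp: expo_def in_keys_iff)

lemma keys_add_nat: "keys (a + b) = keys a \<union> keys (b :: 'i \<Rightarrow>\<^sub>0 nat)"
  by (auto simp: in_keys_iff lookup_add)

lemma expo_add_iff [simp]: "a + b \<in> expo I \<longleftrightarrow> a \<in> expo I \<and> b \<in> expo I"
  by (auto simp: expo_def keys_add_nat)

lemma expo_zero [simp]: "0 \<in> expo I"
  by (simp add: expo_def)

lemma expo_single [simp]: "i \<in> I \<Longrightarrow> single i n \<in> expo I"
  by (auto simp: expo_def)

lemma expo_sum: "(\<And>x. x \<in> A \<Longrightarrow> f x \<in> expo I) \<Longrightarrow> sum f A \<in> expo I"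
  by (induction A rule: infinite_finite_induct) auto

lemma expo_mono: "I \<subseteq> J \<Longrightarrow> expo I \<subseteq> expo J"
  by (auto simp: expo_def)

lemma tdeg_add [simp]: "tdeg (a + b) = tdeg a + tdeg b"
proof -
  have "a + b \<in> expo (keys a \<union> keys b)" "a \<in> expo (keys a \<union> keys b)" "b \<in> expo (keys a \<union> keys b)"
    by (auto simp: expo_def keys_add_nat)
  then show ?thesis
    by (simp add: tdeg_eq[of "keys a \<union> keys b"] lookup_add sum.distrib)
qed

lemma tdeg_zero [simp]: "tdeg 0 = 0"
  by (simp add: tdeg_def)

lemma tdeg_single [simp]: "tdeg (single i n) = n"
  by (simp add: tdeg_def)

lemma tdeg_sum: "tdeg (sum f A) = (\<Sum>x\<in>A. tdeg (f x))"
  by (induction A rule: infinite_finite_induct) auto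

lemma lookup_le_tdeg: "lookup c i \<le> tdeg c"
proof (cases "i \<in> keys c")
  case True
  then show ?thesis unfolding tdeg_def by (intro member_le_sum) auto
qed (simp add: in_keys_iff)

lemma tdeg_eq_0_iff [simp]: "tdeg c = 0 \<longleftrightarrow> c = 0"
  by (metis bot_nat_0.extremum_uniqueI lookup_le_tdeg lookup_zero poly_mapping_eqI tdeg_zero)

lemma ex_add_iff: "(\<exists>d. c = g + d) \<longleftrightarrow> (\<forall>i. lookup g i \<le> lookup (c :: 'i \<Rightarrow>\<^sub>0 nat) i)"
proof
  assume "\<forall>i. lookup g i \<le> lookup c i"
  then have "c = g + (c - g)"
    by (intro poly_mapping_eqI) (simp add: lookup_add lookup_minus)
  then show "\<exists>d. c = g + d" ..
qed (auto simp: lookup_add)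

lemma ex_sub_exponent:
  "k \<le> tdeg a \<Longrightarrow> \<exists>b u. a = b + u \<and> tdeg b = k"
proof (induction k)
  case 0
  show ?case by (rule exI[of _ 0]) auto
next
  case (Suc k)
  then obtain b u where bu: "a = b + u" "tdeg b = k" by auto
  with Suc.prems have "tdeg u \<noteq> 0" by auto
  then obtain i where "lookup u i \<noteq> 0"
    by (metis lookup_zero poly_mapping_eqI tdeg_zero)
  then have "\<exists>d. u = single i 1 + d"
    unfolding ex_add_iff by (auto simp: lookup_single when_def)
  then obtain d where "u = single i 1 + d" ..
  with bu have "a = (b + single i 1) + d \<and> tdeg (b + single i 1) = Suc k"
    by (simp add: add.assoc)
  then show ?case by blast
qed

text \<open>Induction on the number of coordinates. Vectors whose new coordinate \<open>j\<close> is
  at least \<open>N\<close> are dominated by a finite family \<open>G0\<close> found without looking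
  at \<open>j\<close>; the others lie in the finitely many slices \<open>f j = k\<close> with
  \<open>k < N\<close>, each covered by the induction hypothesis. Plain functions allow vectors over
  a disjoint sum of index sets.\<close>

lemma dickson:
  fixes F :: "('i \<Rightarrow> nat) set"
  assumes "finite I"
  shows "\<exists>G\<subseteq>F. finite G \<and> (\<forall>f\<in>F. \<exists>g\<in>G. \<forall>i\<in>I. g i \<le> f i)"
  using assms
proof (induction I arbitrary: F rule: finite_induct)
  case empty
  show ?case
  proof (cases "F = {}")
    case False
    then obtain f where "f \<in> F" by auto
    then show ?thesis by (intro exI[of _ "{f}"]) auto
  qed auto
next
  case (insert j I)
  obtain G0 where G0: "G0 \<subseteq> F" "finite G0" "\<forall>f\<in>F. \<exists>g\<in>G0. \<forall>i\<in>I. g i \<le> f i"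
    using insert.IH by meson
  define N where "N = (\<Sum>g\<in>G0. g j)"
  have N: "g j \<le> N" if "g \<in> G0" for g
    unfolding N_def using that G0 by (intro member_le_sum) auto
  have "\<forall>k. \<exists>G\<subseteq>{f \<in> F. f j = k}. finite G \<and> (\<forall>f\<in>{f \<in> F. f j = k}. \<exists>g\<in>G. \<forall>i\<in>I. g i \<le> f i)"
    using insert.IH by blast
  from choice[OF this] obtain H where H0: "\<forall>k. H k \<subseteq> {f \<in> F. f j = k} \<and> finite (H k)
      \<and> (\<forall>f\<in>{f \<in> F. f j = k}. \<exists>g\<in>H k. \<forall>i\<in>I. g i \<le> f i)" ..
  have H: "H k \<subseteq> {f \<in> F. f j = k}" "finite (H k)" "f \<in> F \<Longrightarrow> f j = k \<Longrightarrow> \<exists>g\<in>H k. \<forall>i\<in>I. g i \<le> f i" for k f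
    using spec[OF H0, of k] by simp_all
  let ?G = "G0 \<union> (\<Union>k<N. H k)"
  have "\<exists>g\<in>?G. \<forall>i\<in>insert j I. g i \<le> f i" if f: "f \<in> F" for f
  proof (cases "f j < N")
    case True
    obtain g where g: "g \<in> H (f j)" "\<forall>i\<in>I. g i \<le> f i" using H(3)[OF f refl] by auto
    then have "g j = f j" using H(1) by auto
    with g True show ?thesis by (intro bexI[of _ g]) auto
  next
    case False
    obtain g where g: "g \<in> G0" "\<forall>i\<in>I. g i \<le> f i" using G0 f by auto
    then show ?thesis using N[OF g(1)] False by (intro bexI[of _ g]) auto
  qed
  moreover have "?G \<subseteq> F" using G0(1) H(1) by fastforce
  moreover have "finite ?G" using G0(2) H(2) by auto
  ultimately show ?case by blast
qed

lemma dickson_upclosed: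
  assumes "finite I" "upclosed I U"
  shows "\<exists>G\<subseteq>U. finite G \<and> U = {c \<in> expo I. \<exists>g\<in>G. \<exists>d. c = g + d}"
proof -
  obtain H where H: "H \<subseteq> lookup ` U" "finite H" "\<forall>f\<in>lookup ` U. \<exists>g\<in>H. \<forall>i\<in>I. g i \<le> f i"
    using dickson[OF assms(1), of "lookup ` U"] by auto
  obtain G where G: "G \<subseteq> U" "finite G" "H = lookup ` G"
    using H(1,2) by (metis finite_subset_image)
  have "\<exists>g\<in>G. \<exists>d. c = g + d" if c: "c \<in> U" for c
  proof -
    obtain g where g: "g \<in> G" "\<forall>i\<in>I. lookup g i \<le> lookup c i"
      using H(3) G(3) c by auto
    have "lookup g i \<le> lookup c i" for i
      using g G(1) assms(2) lookup_outside[of g I i] by (cases "i \<in> I") (auto simp: upclosed_def)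
    with g(1) show ?thesis using ex_add_iff by blast
  qed
  moreover have "c \<in> U" if "c \<in> expo I" "g \<in> G" "c = g + d" for c g d
    using that G(1) assms(2) by (auto simp: upclosed_def)
  ultimately show ?thesis using G assms(2)
    by (intro exI[of _ G]) (auto simp: upclosed_def)
qed

section \<open>Number of exponent vectors of a given degree\<close>

lemma level_empty: "level {} t = (if t = 0 then {0} else {})"
  by (auto simp: level_def expo_def)

lemma level_insert:
  assumes "finite I" "i \<notin> I"
  shows "level (insert i I) t = (\<Union>s\<in>{..t}. (\<lambda>c. c + single i (t - s)) ` level I s)"
proof (intro equalityI subsetI)
  fix c assume c: "c \<in> level (insert i I) t"
  have "\<exists>d. c = single i (lookup c i) + d"
    unfolding ex_add_iff by (auto simp: lookup_single when_def)
  then obtain d where d: "c = single i (lookup c i) + d" ..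
  have "lookup d i = 0"
    using arg_cong[OF d, of "\<lambda>x. lookup x i"] by (simp add: lookup_add)
  moreover have "d \<in> expo (insert i I)"
    using c by (subst (asm) d) (simp add: level_def)
  ultimately have "d \<in> expo I"
    by (auto simp: expo_def in_keys_iff)
  moreover have "lookup c i + tdeg d = t"
    using c arg_cong[OF d, of tdeg] by (simp add: level_def)
  ultimately have "d \<in> level I (tdeg d)" "tdeg d \<le> t" "c = d + single i (t - tdeg d)"
    using d by (auto simp: level_def add.commute)
  then show "c \<in> (\<Union>s\<in>{..t}. (\<lambda>c. c + single i (t - s)) ` level I s)" by blast
next
  fix c assume "c \<in> (\<Union>s\<in>{..t}. (\<lambda>c. c + single i (t - s)) ` level I s)"
  then show "c \<in> level (insert i I) t"
    using expo_mono[OF subset_insertI, of I i] by (auto simp: level_def)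
qed

lemma finite_level [simp]: "finite I \<Longrightarrow> finite (level I t)"
  by (induction I arbitrary: t rule: finite_induct) (auto simp: level_empty level_insert)

lemma card_level_insert:
  assumes "finite I" "i \<notin> I"
  shows "card (level (insert i I) t) = (\<Sum>s\<le>t. card (level I s))"
proof -
  have disj: "((\<lambda>c. c + single i (t - s)) ` level I s) \<inter> ((\<lambda>c. c + single i (t - r)) ` level I r) = {}"
    if "s \<noteq> r" "s \<le> t" "r \<le> t" for s r
  proof -
    have "t - s = t - r" if "c + single i (t - s) = d + single i (t - r)" "c \<in> level I s" "d \<in> level I r" for c d
      using arg_cong[OF that(1), of "\<lambda>x. lookup x i"] that(2,3) assms(2)
      by (auto simp: lookup_add level_def lookup_outside)
    with that show ?thesis by fastforce
  qed
  have "card (level (insert i I) t) = (\<Sum>s\<le>t. card ((\<lambda>c. c + single i (t - s)) ` level I s))"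
    unfolding level_insert[OF assms]
    by (subst card_UN_disjoint) (use assms disj in auto)
  also have "\<dots> = (\<Sum>s\<le>t. card (level I s))"
    by (intro sum.cong refl card_image) (auto simp: inj_on_def)
  finally show ?thesis .
qed

text \<open>Stars and bars, obtained by splitting off one coordinate and summing binomial
  coefficients along a diagonal.\<close>

lemma card_level:
  assumes "finite I" "card I = Suc k"
  shows "card (level I t) = (t + k) choose k"
  using assms
proof (induction k arbitrary: I t)
  case 0
  then obtain i where "I = {i}" by (auto simp: card_1_singleton_iff)
  then have "card (level I t) = (\<Sum>s\<le>t. card (level ({}::'a set) s))"
    using card_level_insert[of "{}" i t] by simp
  also have "\<dots> = (\<Sum>s\<le>t. if s = 0 then 1 else 0)"
    by (intro sum.cong) (auto simp: level_empty)
  also have "\<dots> = 1" by simp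
  finally show ?case by simp
next
  case (Suc k)
  then obtain i J where I: "I = insert i J" "i \<notin> J" "finite J" "card J = Suc k"
    by (metis card_eq_SucD finite_insert)
  have "card (level I t) = (\<Sum>s\<le>t. (s + k) choose k)"
    using card_level_insert[OF I(3,2)] Suc.IH[OF I(3,4)] I(1) by simp
  also have "\<dots> = (\<Sum>s\<le>t. (k + s) choose s)"
    by (intro sum.cong refl) (metis add.commute binomial_symmetric diff_add_inverse2 le_add2)
  also have "\<dots> = (t + Suc k) choose t"
    using sum_choose_lower[of k t] by (simp add: add.commute)
  also have "\<dots> = (t + Suc k) choose (Suc k)"
    by (metis binomial_symmetric diff_add_inverse le_add1)
  finally show ?case .
qed

lemma card_level_le:
  assumes "finite I" "card I = Suc k"
  shows "card (level I t) \<le> (t + 1) ^ k"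
  using assms
proof (induction k arbitrary: I t)
  case 0
  then show ?case by (simp add: card_level)
next
  case (Suc k)
  then obtain i J where I: "I = insert i J" "i \<notin> J" "finite J" "card J = Suc k"
    by (metis card_eq_SucD finite_insert)
  have "card (level I t) = (\<Sum>s\<le>t. card (level J s))"
    using card_level_insert[OF I(3,2)] I(1) by simp
  also have "\<dots> \<le> (\<Sum>s\<le>t. (t + 1) ^ k)"
    by (intro sum_mono order_trans[OF Suc.IH[OF I(3,4)]] power_mono) auto
  also have "\<dots> = (t + 1) ^ Suc k" by simp
  finally show ?case .
qed

lemma level_translate:
  assumes "g \<in> expo I"
  shows "{c \<in> level I t. \<exists>d. c = g + d} = (if tdeg g \<le> t then (+) g ` level I (t - tdeg g) else {})"
  using assms by (auto simp: level_def image_iff)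

lemma card_level_translate:
  assumes "g \<in> expo I"
  shows "card {c \<in> level I t. \<exists>d. c = g + d} = (if tdeg g \<le> t then card (level I (t - tdeg g)) else 0)"
  unfolding level_translate[OF assms] by (auto simp: card_image)

section \<open>Eventually polynomial counting functions\<close>

definition evpoly :: "(nat \<Rightarrow> real) \<Rightarrow> bool" where
  "evpoly f \<longleftrightarrow> (\<exists>p :: real Polynomial.poly. \<forall>\<^sub>F t in sequentially. f t = Polynomial.poly p (real t))"

lemma evpoly_cong: "(\<forall>\<^sub>F t in sequentially. f t = g t) \<Longrightarrow> evpoly g \<Longrightarrow> evpoly f"
  unfolding evpoly_def
proof (erule exE)
  fix p assume "\<forall>\<^sub>F t in sequentially. f t = g t" "\<forall>\<^sub>F t in sequentially. g t = Polynomial.poly p (real t)"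
  then have "\<forall>\<^sub>F t in sequentially. f t = Polynomial.poly p (real t)" by eventually_elim simp
  then show "\<exists>p. \<forall>\<^sub>F t in sequentially. f t = Polynomial.poly p (real t)" ..
qed

lemma evpoly_0 [simp]: "evpoly (\<lambda>_. 0)"
  unfolding evpoly_def by (rule exI[of _ 0]) simp

lemma evpoly_add: "evpoly f \<Longrightarrow> evpoly g \<Longrightarrow> evpoly (\<lambda>t. f t + g t)"
  unfolding evpoly_def
proof (elim exE)
  fix p q :: "real Polynomial.poly"
  assume "\<forall>\<^sub>F t in sequentially. f t = Polynomial.poly p (real t)" "\<forall>\<^sub>F t in sequentially. g t = Polynomial.poly q (real t)"
  then have "\<forall>\<^sub>F t in sequentially. f t + g t = Polynomial.poly (p + q) (real t)"
    by eventually_elim simp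
  then show "\<exists>p. \<forall>\<^sub>F t in sequentially. f t + g t = Polynomial.poly p (real t)" ..
qed

lemma evpoly_diff: "evpoly f \<Longrightarrow> evpoly g \<Longrightarrow> evpoly (\<lambda>t. f t - g t)"
  unfolding evpoly_def
proof (elim exE)
  fix p q :: "real Polynomial.poly"
  assume "\<forall>\<^sub>F t in sequentially. f t = Polynomial.poly p (real t)" "\<forall>\<^sub>F t in sequentially. g t = Polynomial.poly q (real t)"
  then have "\<forall>\<^sub>F t in sequentially. f t - g t = Polynomial.poly (p - q) (real t)"
    by eventually_elim simp
  then show "\<exists>p. \<forall>\<^sub>F t in sequentially. f t - g t = Polynomial.poly p (real t)" ..
qed

lemma evpoly_sum: "(\<And>x. x \<in> A \<Longrightarrow> evpoly (f x)) \<Longrightarrow> evpoly (\<lambda>t. \<Sum>x\<in>A. f x t)"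
  by (induction A rule: infinite_finite_induct) (auto intro: evpoly_add)

lemma evpoly_shift:
  assumes "evpoly f" shows "evpoly (\<lambda>t. if s \<le> t then f (t - s) else 0)"
proof -
  obtain p where p: "\<forall>\<^sub>F t in sequentially. f t = Polynomial.poly p (real t)"
    using assms by (auto simp: evpoly_def)
  then obtain N where N: "\<And>t. t \<ge> N \<Longrightarrow> f t = Polynomial.poly p (real t)"
    by (auto simp: eventually_sequentially)
  have "\<forall>\<^sub>F t in sequentially. (if s \<le> t then f (t - s) else 0) = Polynomial.poly (p \<circ>\<^sub>p [:- real s, 1:]) (real t)"
    unfolding eventually_sequentially
    by (rule exI[of _ "N + s"]) (auto simp: N poly_pcompose of_nat_diff)
  then show ?thesis unfolding evpoly_def ..
qed

lemma evpoly_choose: "evpoly (\<lambda>t. real ((t + k) choose k))"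
proof (induction k)
  case 0
  show ?case unfolding evpoly_def by (intro exI[of _ 1]) simp
next
  case (Suc k)
  then obtain p where p: "\<forall>\<^sub>F t in sequentially. real ((t + k) choose k) = Polynomial.poly p (real t)"
    by (auto simp: evpoly_def)
  have rec: "real ((t + Suc k) choose Suc k) = (real t + real (Suc k)) / real (Suc k) * real ((t + k) choose k)" for t
  proof -
    have "Suc k * ((t + Suc k) choose Suc k) = (t + Suc k) * ((t + k) choose k)"
      using Suc_times_binomial_eq[of "t + k" k] by (simp add: mult.commute)
    then have "real (Suc k) * real ((t + Suc k) choose Suc k) = (real t + real (Suc k)) * real ((t + k) choose k)"
      by (metis of_nat_add of_nat_mult)
    then show ?thesis by (simp add: field_simps)
  qed
  from p have "\<forall>\<^sub>F t in sequentially. real ((t + Suc k) choose Suc k)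
      = Polynomial.poly (Polynomial.smult (1 / real (Suc k)) ([:real (Suc k), 1:] * p)) (real t)"
    by eventually_elim (subst rec, simp add: field_simps del: of_nat_Suc)
  then show ?case unfolding evpoly_def ..
qed

lemma evpoly_card_level: "finite I \<Longrightarrow> evpoly (\<lambda>t. real (card (level I t)))"
proof (cases "card I")
  case 0
  moreover assume "finite I"
  ultimately have "I = {}" by simp
  then show ?thesis
    by (intro evpoly_cong[OF _ evpoly_0]) (auto simp: level_empty eventually_sequentially intro: exI[of _ 1])
next
  case (Suc k)
  moreover assume "finite I"
  ultimately show ?thesis by (simp add: card_level evpoly_choose)
qed

text \<open>Inclusion-exclusion, one generator at a time: the multiples of \<open>g\<close> that are
  also multiples of some \<open>h\<close> in \<open>H\<close> are the multiples of the joins of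
  \<open>g\<close> with such \<open>h\<close>. The joins are at most as many as the elements of
  \<open>H\<close>, so induction on the number of generators covers both \<open>H\<close> and the
  joins.\<close>

lemma evpoly_card_generated:
  assumes I: "finite I" and "finite G" "G \<subseteq> expo I"
  shows "evpoly (\<lambda>t. real (card {c \<in> level I t. \<exists>g\<in>G. \<exists>d. c = g + d}))"
  using assms(2,3)
proof (induction "card G" arbitrary: G rule: less_induct)
  case less
  show ?case
  proof (cases "G = {}")
    case False
    then obtain g H where G: "G = insert g H" "g \<notin> H" by (meson Set.set_insert ex_in_conv)
    have H: "finite H" "card H < card G" "H \<subseteq> expo I" "g \<in> expo I"
      using less.prems G by (auto simp: card_insert_if)
    \<comment> \<open>Subtraction is truncated, so \<open>g + (h - g)\<close> is the componentwise
      maximum, the exponent of the least common multiple.\<close>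
    define jn :: "('a \<Rightarrow>\<^sub>0 nat) \<Rightarrow> 'a \<Rightarrow>\<^sub>0 nat" where "jn h = g + (h - g)" for h
    have jn: "lookup (jn h) i = max (lookup g i) (lookup h i)" for h i
      by (auto simp: jn_def lookup_add lookup_minus)
    let ?S = "\<lambda>G t. {c \<in> level I t. \<exists>g\<in>G. \<exists>d. c = g + d}"
    have inter: "?S {g} t \<inter> ?S H t = ?S (jn ` H) t" for t
      by (auto simp: ex_add_iff jn)
    have un: "?S G t = ?S {g} t \<union> ?S H t" for t
      unfolding G(1) by blast
    have fin: "finite (?S H t)" for H t
      by (rule finite_subset[OF _ finite_level[OF I]]) auto
    have eq: "real (card (?S G t)) = real (card (?S {g} t)) + real (card (?S H t)) - real (card (?S (jn ` H) t))" for t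
      using card_Un_Int[OF fin[where H="{g}" and t=t] fin[where H=H and t=t]] unfolding un inter by linarith
    have "evpoly (\<lambda>t. real (card (?S {g} t)))"
    proof -
      have "(\<lambda>t. real (card (?S {g} t))) = (\<lambda>t. if tdeg g \<le> t then real (card (level I (t - tdeg g))) else 0)"
        using card_level_translate[OF H(4)] by (auto simp: fun_eq_iff)
      then show ?thesis using evpoly_shift[OF evpoly_card_level[OF I]] by simp
    qed
    moreover have "evpoly (\<lambda>t. real (card (?S H t)))"
      using less.hyps H by blast
    moreover have "evpoly (\<lambda>t. real (card (?S (jn ` H) t)))"
    proof (rule less.hyps)
      show "card (jn ` H) < card G" using card_image_le[OF H(1)] H(2) by (metis le_less_trans)
      show "finite (jn ` H)" using H by simp
      show "jn ` H \<subseteq> expo I"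
      proof
        fix x assume "x \<in> jn ` H"
        then obtain h where "h \<in> H" "x = jn h" by auto
        then show "x \<in> expo I" using H(3,4)
          by (intro expoI) (auto simp: jn dest: lookup_outside)
      qed
    qed
    ultimately show ?thesis
      unfolding eq by (intro evpoly_diff evpoly_add)
  qed simp
qed

lemma evpoly_card_upclosed:
  assumes "finite I" "upclosed I U"
  shows "evpoly (\<lambda>t. real (card (U \<inter> level I t)))"
proof -
  obtain G where G: "G \<subseteq> U" "finite G" "U = {c \<in> expo I. \<exists>g\<in>G. \<exists>d. c = g + d}"
    using dickson_upclosed[OF assms] by auto
  have "U \<inter> level I t = {c \<in> level I t. \<exists>g\<in>G. \<exists>d. c = g + d}" for t
    by (subst G(3)) (auto simp: level_def)
  moreover have "G \<subseteq> expo I" using G(1) assms(2) by (auto simp: upclosed_def)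
  ultimately show ?thesis using evpoly_card_generated[OF assms(1) G(2)] by simp
qed

lemma poly_over_power_tendsto:
  fixes p :: "real Polynomial.poly"
  assumes "Polynomial.degree p \<le> d"
  shows "(\<lambda>t. Polynomial.poly p (real t) / real t ^ d) \<longlonglongrightarrow> Polynomial.coeff p d"
proof -
  have lim: "(\<lambda>t. real t ^ i / real t ^ d) \<longlonglongrightarrow> (if i = d then 1 else 0)" if "i \<le> d" for i
  proof (cases "i = d")
    case True
    have "\<forall>\<^sub>F t in sequentially. real t ^ i / real t ^ d = 1"
      using True by (auto simp: eventually_sequentially intro!: exI[of _ 1])
    then show ?thesis using True by (simp add: tendsto_eventually)
  next
    case False
    have "(\<lambda>t. inverse (real t) ^ (d - i)) \<longlonglongrightarrow> 0 ^ (d - i)"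
      by (intro tendsto_power lim_inverse_n)
    moreover have "\<forall>\<^sub>F t in sequentially. inverse (real t) ^ (d - i) = real t ^ i / real t ^ d"
      unfolding eventually_sequentially
      using that by (intro exI[of _ 1]) (auto simp: power_diff field_simps)
    ultimately have "(\<lambda>t. real t ^ i / real t ^ d) \<longlonglongrightarrow> 0 ^ (d - i)"
      by (rule Lim_transform_eventually)
    then show ?thesis using False that by (simp add: zero_power)
  qed
  have "(\<lambda>t. \<Sum>i\<le>d. Polynomial.coeff p i * (real t ^ i / real t ^ d)) \<longlonglongrightarrow> (\<Sum>i\<le>d. Polynomial.coeff p i * (if i = d then 1 else 0))"
    by (intro tendsto_sum tendsto_mult tendsto_const lim) auto
  moreover have "(\<Sum>i\<le>d. Polynomial.coeff p i * (real t ^ i / real t ^ d)) = Polynomial.poly p (real t) / real t ^ d" for t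
  proof -
    have "Polynomial.poly p (real t) = (\<Sum>i\<le>d. Polynomial.coeff p i * real t ^ i)"
      unfolding poly_altdef using assms by (intro sum.mono_neutral_left) (auto simp: Polynomial.coeff_eq_0)
    then show ?thesis by (simp add: sum_divide_distrib)
  qed
  moreover have "(\<Sum>i\<le>d. Polynomial.coeff p i * (if i = d then 1 else 0)) = Polynomial.coeff p d"
    by (simp add: if_distrib cong: if_cong)
  ultimately show ?thesis by simp
qed

text \<open>For a polynomial the bound forces degree at most \<open>d\<close>: if the degree
  \<open>e\<close> were larger, the quotient by \<open>t ^ e\<close> would tend to the leading
  coefficient and, by the bound, to 0.\<close>

lemma evpoly_convergent:
  assumes "evpoly f" and bound: "\<And>t. \<bar>f t\<bar> \<le> C * real (t + 1) ^ d"
  shows "\<exists>L. (\<lambda>t. f t / real t ^ d) \<longlonglongrightarrow> L"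
proof -
  obtain p where p: "\<forall>\<^sub>F t in sequentially. f t = Polynomial.poly p (real t)"
    using assms(1) by (auto simp: evpoly_def)
  have deg: "Polynomial.degree p \<le> d"
  proof (rule ccontr)
    assume "\<not> Polynomial.degree p \<le> d"
    define e where "e = Polynomial.degree p"
    have e: "d < e" using \<open>\<not> _\<close> by (simp add: e_def)
    have "(\<lambda>t. Polynomial.poly p (real t) / real t ^ e) \<longlonglongrightarrow> Polynomial.coeff p e"
      by (rule poly_over_power_tendsto) (simp add: e_def)
    moreover have "(\<lambda>t. Polynomial.poly p (real t) / real t ^ e) \<longlonglongrightarrow> 0"
    proof (rule tendsto_rabs_zero_cancel, rule tendsto_sandwich[OF _ _ tendsto_const])
      have "(\<lambda>t. C * 2 ^ d * inverse (real t)) \<longlonglongrightarrow> C * 2 ^ d * 0"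
        by (intro tendsto_mult tendsto_const lim_inverse_n)
      then show "(\<lambda>t. C * 2 ^ d * inverse (real t)) \<longlonglongrightarrow> 0" by simp
      have C: "0 \<le> C" using order_trans[OF abs_ge_zero bound[of 0]] by simp
      show "\<forall>\<^sub>F t in sequentially. 0 \<le> \<bar>Polynomial.poly p (real t) / real t ^ e\<bar>" by simp
      show "\<forall>\<^sub>F t in sequentially. \<bar>Polynomial.poly p (real t) / real t ^ e\<bar> \<le> C * 2 ^ d * inverse (real t)"
        using p eventually_ge_at_top[of 1]
      proof eventually_elim
        case (elim t)
        have "\<bar>Polynomial.poly p (real t)\<bar> \<le> C * real (t + 1) ^ d" using bound[of t] elim by simp
        also have "\<dots> \<le> C * (2 * real t) ^ d" using C elim by (intro mult_left_mono power_mono) auto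
        finally have "\<bar>Polynomial.poly p (real t)\<bar> \<le> C * 2 ^ d * real t ^ d"
          by (simp add: power_mult_distrib)
        then have "\<bar>Polynomial.poly p (real t)\<bar> * real t \<le> C * 2 ^ d * (real t ^ d * real t)"
          by (simp add: mult_right_mono mult.assoc [symmetric])
        also have "\<dots> \<le> C * 2 ^ d * real t ^ e"
          using e elim power_increasing[of "Suc d" e "real t"] C
          by (intro mult_left_mono) (simp_all add: mult.commute)
        finally show ?case
          using elim by (simp add: abs_divide pos_divide_le_eq inverse_eq_divide le_divide_eq mult.commute)
      qed
    qed
    ultimately have "Polynomial.coeff p e = 0" by (rule LIMSEQ_unique)
    then show False using e leading_coeff_0_iff[of p] unfolding e_def by auto
  qed
  have "(\<lambda>t. Polynomial.poly p (real t) / real t ^ d) \<longlonglongrightarrow> Polynomial.coeff p d"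
    by (rule poly_over_power_tendsto[OF deg])
  moreover have "\<forall>\<^sub>F t in sequentially. Polynomial.poly p (real t) / real t ^ d = f t / real t ^ d"
    using p by eventually_elim simp
  ultimately have "(\<lambda>t. f t / real t ^ d) \<longlonglongrightarrow> Polynomial.coeff p d"
    by (rule Lim_transform_eventually)
  then show ?thesis ..
qed

section \<open>Powers of monomial ideals\<close>

definition smul :: "nat \<Rightarrow> ('i \<Rightarrow>\<^sub>0 nat) \<Rightarrow> 'i \<Rightarrow>\<^sub>0 nat" where
  "smul n a = (\<Sum>_<n. a)"

lemma lookup_smul [simp]: "lookup (smul n a) i = n * lookup a i"
  by (simp add: smul_def lookup_sum)

lemma smul_add: "smul (m + n) a = smul m a + smul n a"
  by (intro poly_mapping_eqI) (simp add: lookup_add algebra_simps)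

lemma tdeg_smul [simp]: "tdeg (smul n a) = n * tdeg a"
  by (simp add: smul_def tdeg_sum)

lemma expo_smul: "a \<in> expo I \<Longrightarrow> smul n a \<in> expo I"
  by (auto simp: expo_def in_keys_iff)

text \<open>The exponent of a product of generators in which \<open>b\<close> occurs
  \<open>lookup c b\<close> times. Different \<open>c\<close> may give the same exponent, which is
  the difficulty in counting.\<close>

definition comb :: "('v \<Rightarrow>\<^sub>0 nat) set \<Rightarrow> (('v \<Rightarrow>\<^sub>0 nat) \<Rightarrow>\<^sub>0 nat) \<Rightarrow> 'v \<Rightarrow>\<^sub>0 nat" where
  "comb B c = (\<Sum>b\<in>B. smul (lookup c b) b)"

lemma comb_add: "comb B (c + d) = comb B c + comb B d"
  by (simp add: comb_def lookup_add smul_add sum.distrib)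

lemma comb_zero [simp]: "comb B 0 = 0"
  by (simp add: comb_def smul_def)

lemma comb_single: assumes "finite B" "b \<in> B" 
  shows "comb B (single b (Suc 0)) = b"
proof -
  have "comb B (single b (Suc 0)) = (\<Sum>x\<in>B. if x = b then b else 0)"
    unfolding comb_def by (intro sum.cong refl) (auto simp: smul_def lookup_single when_def)
  then show ?thesis using assms by simp
qed

lemma expo_comb: "B \<subseteq> expo V \<Longrightarrow> comb B c \<in> expo V"
  unfolding comb_def by (intro expo_sum expo_smul) auto

lemma tdeg_comb:
  assumes "finite B" "c \<in> expo B" "\<And>b. b \<in> B \<Longrightarrow> tdeg b = m"
  shows "tdeg (comb B c) = m * tdeg c"
  using assms by (simp add: comb_def tdeg_sum tdeg_eq[of B] sum_distrib_left mult.commute)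

text \<open>If the generators of a monomial ideal $I$ have exponents \<open>B\<close>, then \<open>pw V B t\<close> is the exponent
  set of $I^t$, and \<open>jmon V B t\<close> indexes a basis of $\Gamma_{\mathfrak m}(I^t/I^{t+1})$.\<close>

primrec pw :: "'v set \<Rightarrow> ('v \<Rightarrow>\<^sub>0 nat) set \<Rightarrow> nat \<Rightarrow> ('v \<Rightarrow>\<^sub>0 nat) set" where
  "pw V B 0 = expo V"
| "pw V B (Suc t) = {b + a | b a. b \<in> B \<and> a \<in> pw V B t}"

text \<open>Expresses that the monomial is killed by a power of the maximal ideal modulo the next
  power of the ideal, tested one variable at a time.\<close>

definition satur :: "'v set \<Rightarrow> ('v \<Rightarrow>\<^sub>0 nat) set \<Rightarrow> nat \<Rightarrow> ('v \<Rightarrow>\<^sub>0 nat) \<Rightarrow> bool" where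
  "satur V B t a \<longleftrightarrow> (\<forall>i\<in>V. \<exists>N. a + single i N \<in> pw V B (Suc t))"

definition jmon :: "'v set \<Rightarrow> ('v \<Rightarrow>\<^sub>0 nat) set \<Rightarrow> nat \<Rightarrow> ('v \<Rightarrow>\<^sub>0 nat) set" where
  "jmon V B t = {a \<in> pw V B t. a \<notin> pw V B (Suc t) \<and> satur V B t a}"

lemma pw_expo: "B \<subseteq> expo V \<Longrightarrow> pw V B t \<subseteq> expo V"
  by (induction t) auto

lemma pw_add: "B \<subseteq> expo V \<Longrightarrow> a \<in> pw V B t \<Longrightarrow> d \<in> expo V \<Longrightarrow> a + d \<in> pw V B t"
proof (induction t arbitrary: a)
  case (Suc t)
  then obtain b a' where "b \<in> B" "a' \<in> pw V B t" "a = b + a'" by auto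
  with Suc show ?case by (auto simp: add.assoc)
qed auto

lemma upclosed_pw: "B \<subseteq> expo V \<Longrightarrow> upclosed V (pw V B t)"
  unfolding upclosed_def using pw_expo[of B V t] pw_add[of B V _ t] by blast

lemma pw_Suc_subset: "B \<subseteq> expo V \<Longrightarrow> pw V B (Suc t) \<subseteq> pw V B t"
proof
  fix x assume B: "B \<subseteq> expo V" and "x \<in> pw V B (Suc t)"
  then obtain b a where "b \<in> B" "a \<in> pw V B t" "x = a + b" by (auto simp: add.commute)
  then show "x \<in> pw V B t" using pw_add[OF B] B by blast
qed

lemma pw_antimono: "B \<subseteq> expo V \<Longrightarrow> s \<le> t \<Longrightarrow> pw V B t \<subseteq> pw V B s"
  by (rule lift_Suc_antimono_le[of "pw V B"]) (rule pw_Suc_subset)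

text \<open>Replaces the recursion by pairs \<open>(c, u)\<close> of a multiplicity vector and a
  slack. Such pairs are vectors over a finite index set, so Dickson's lemma applies to conditions on
  them.\<close>

lemma pw_iff:
  assumes B: "finite B" "B \<subseteq> expo V"
  shows "a \<in> pw V B t \<longleftrightarrow> (\<exists>c\<in>level B t. \<exists>u\<in>expo V. a = comb B c + u)"
proof (induction t arbitrary: a)
  case 0
  have "level B 0 = {0}" by (auto simp: level_def)
  then show ?case by simp
next
  case (Suc t)
  show ?case
  proof
    assume "a \<in> pw V B (Suc t)"
    then obtain b a' where a: "b \<in> B" "a' \<in> pw V B t" "a = b + a'" by auto
    then obtain c u where cu: "c \<in> level B t" "u \<in> expo V" "a' = comb B c + u"
      using Suc.IH by blast
    have "c + single b 1 \<in> level B (Suc t)" using cu a by (simp add: level_def)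
    moreover have "a = comb B (c + single b 1) + u"
      using a cu by (simp add: comb_add comb_single[OF B(1) a(1)] ac_simps)
    ultimately show "\<exists>c\<in>level B (Suc t). \<exists>u\<in>expo V. a = comb B c + u" using cu(2) by blast
  next
    assume "\<exists>c\<in>level B (Suc t). \<exists>u\<in>expo V. a = comb B c + u"
    then obtain c u where cu: "c \<in> level B (Suc t)" "u \<in> expo V" "a = comb B c + u" by blast
    have "c \<noteq> 0" using cu(1) by (auto simp: level_def)
    then obtain b where b: "lookup c b \<noteq> 0"
      by (metis lookup_zero poly_mapping_eqI)
    then have bB: "b \<in> B" using cu(1) by (auto simp: level_def dest: lookup_outside)
    have "\<exists>d. c = single b 1 + d"
      unfolding ex_add_iff using b by (auto simp: lookup_single when_def)
    then obtain d where d: "c = single b 1 + d" ..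
    have "d \<in> level B t" using cu(1) unfolding d by (simp add: level_def)
    then have "comb B d + u \<in> pw V B t" using Suc.IH cu(2) by blast
    moreover have "a = b + (comb B d + u)"
      using cu(3) by (simp add: d comb_add comb_single[OF B(1) bB] add.assoc)
    ultimately show "a \<in> pw V B (Suc t)" using bB by auto
  qed
qed

declare pw.simps(2) [simp del]

text \<open>Further generators raise the power by their number. Hence the condition that
  \<open>comb B c + u\<close> lies in the power \<open>Suc (tdeg c)\<close> persists when
  \<open>c\<close> grows, which makes the sets of such \<open>c\<close> up-closed.\<close>

lemma pw_comb_add:
  assumes B: "finite B" "B \<subseteq> expo V" and "x \<in> pw V B s" "c \<in> expo B"
  shows "x + comb B c \<in> pw V B (s + tdeg c)"
proof -
  obtain c0 u where "c0 \<in> level B s" "u \<in> expo V" "x = comb B c0 + u"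
    using assms pw_iff[OF B] by blast
  then have "c0 + c \<in> level B (s + tdeg c)" "x + comb B c = comb B (c0 + c) + u"
    using assms by (auto simp: level_def comb_add ac_simps)
  then show ?thesis using \<open>u \<in> expo V\<close> pw_iff[OF B] by blast
qed

lemma comb_in_pw:
  assumes "finite B" "B \<subseteq> expo V" "c \<in> expo B" "u \<in> expo V"
  shows "comb B c + u \<in> pw V B (tdeg c)"
  using pw_comb_add[OF assms(1,2), of u 0 c] assms by (simp add: add.commute)

text \<open>The pairs \<open>(c, u)\<close> for which some \<open>N\<close> works form an up-closed set, so it suffices to treat
  its finitely many minimal elements.\<close>

lemma uniform_saturation_exponent:
  assumes V: "finite V" and B: "finite B" "B \<subseteq> expo V" and i: "i \<in> V"
  shows "\<exists>K. \<forall>c\<in>expo B. \<forall>u\<in>expo V.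
    (\<exists>N. comb B c + u + single i N \<in> pw V B (Suc (tdeg c))) \<longrightarrow>
    comb B c + u + single i K \<in> pw V B (Suc (tdeg c))"
proof -
  \<comment> \<open>\<open>case_sum\<close> joins \<open>c\<close> and \<open>u\<close> into one
    function on the disjoint sum of \<open>B\<close> and \<open>V\<close>, so that a single
    application of Dickson's lemma treats both at once.\<close>
  define F where "F = {case_sum (lookup c) (lookup u) | c u. c \<in> expo B \<and> u \<in> expo V \<and>
      (\<exists>N. comb B c + u + single i N \<in> pw V B (Suc (tdeg c)))}"
  obtain G where G: "G \<subseteq> F" "finite G" "\<forall>f\<in>F. \<exists>g\<in>G. \<forall>j\<in>B <+> V. g j \<le> f j"
    using dickson[of "B <+> V" F] V B(1) by (auto intro: finite_Plus)
  have "\<forall>g\<in>G. \<exists>N. \<exists>c\<in>expo B. \<exists>u\<in>expo V. g = case_sum (lookup c) (lookup u) \<and>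
      comb B c + u + single i N \<in> pw V B (Suc (tdeg c))"
    using G(1) unfolding F_def by blast
  from bchoice[OF this] obtain N where N: "\<forall>g\<in>G. \<exists>c\<in>expo B. \<exists>u\<in>expo V.
      g = case_sum (lookup c) (lookup u) \<and> comb B c + u + single i (N g) \<in> pw V B (Suc (tdeg c))" ..
  define K where "K = (\<Sum>g\<in>G. N g)"
  have "comb B c + u + single i K \<in> pw V B (Suc (tdeg c))"
    if cu: "c \<in> expo B" "u \<in> expo V" "\<exists>N. comb B c + u + single i N \<in> pw V B (Suc (tdeg c))" for c u
  proof -
    have "case_sum (lookup c) (lookup u) \<in> F" unfolding F_def using cu by blast
    then obtain g where g: "g \<in> G" "\<forall>j\<in>B <+> V. g j \<le> case_sum (lookup c) (lookup u) j"
      using G(3) by blast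
    obtain c0 u0 where cu0: "c0 \<in> expo B" "u0 \<in> expo V" "g = case_sum (lookup c0) (lookup u0)"
        "comb B c0 + u0 + single i (N g) \<in> pw V B (Suc (tdeg c0))"
      using N g(1) by blast
    have "lookup c0 b \<le> lookup c b" for b
      using g(2) cu0(1,3) lookup_outside[OF cu0(1)] by (cases "b \<in> B") force+
    then obtain c1 where c1: "c = c0 + c1" using ex_add_iff by blast
    have "lookup u0 b \<le> lookup u b" for b
      using g(2) cu0(1,3) lookup_outside[OF cu0(2)] by (cases "b \<in> V") force+
    then obtain u1 where u1: "u = u0 + u1" using ex_add_iff by blast
    have "N g \<le> K" unfolding K_def using g(1) G(2) by (intro member_le_sum) auto
    then have "single i K = single i (N g) + single i (K - N g)"
      by (simp add: single_add[symmetric])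
    then have "comb B c + u + single i K
        = ((comb B c0 + u0 + single i (N g)) + comb B c1) + (u1 + single i (K - N g))"
      by (simp add: c1 u1 comb_add ac_simps)
    also have "\<dots> \<in> pw V B (Suc (tdeg c0) + tdeg c1)"
      using cu c1 u1 i by (intro pw_add[OF B(2)] pw_comb_add[OF B] cu0) auto
    finally show ?thesis by (simp add: c1)
  qed
  then show ?thesis by blast
qed

text \<open>If the slack in direction \<open>i\<close> reached the uniform exponent
  \<open>K i\<close>, take that much off it. The remaining vector is still carried into the next
  power by some power of the variable \<open>i\<close>, hence already by the exponent
  \<open>K i\<close>; so the original vector lies in the next power and is not counted.\<close>

lemma jmon_slack_bounded:
  assumes V: "finite V" and B: "finite B" "B \<subseteq> expo V"
  shows "\<exists>K. \<forall>t. \<forall>c\<in>level B t. \<forall>u\<in>expo V. comb B c + u \<in> jmon V B t \<longrightarrow> (\<forall>i. lookup u i < K)"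
proof -
  have "\<forall>i\<in>V. \<exists>K. \<forall>c\<in>expo B. \<forall>u\<in>expo V.
    (\<exists>N. comb B c + u + single i N \<in> pw V B (Suc (tdeg c))) \<longrightarrow>
    comb B c + u + single i K \<in> pw V B (Suc (tdeg c))"
    using uniform_saturation_exponent[OF V B] by blast
  from bchoice[OF this] obtain K where K: "\<forall>i\<in>V. \<forall>c\<in>expo B. \<forall>u\<in>expo V.
    (\<exists>N. comb B c + u + single i N \<in> pw V B (Suc (tdeg c))) \<longrightarrow>
    comb B c + u + single i (K i) \<in> pw V B (Suc (tdeg c))" ..
  \<comment> \<open>The \<open>Suc\<close> makes the bound positive, so it also holds at coordinates
    outside \<open>V\<close>, where \<open>u\<close> vanishes.\<close>
  have "lookup u i < Suc (\<Sum>i\<in>V. K i)"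
    if c: "c \<in> level B t" and u: "u \<in> expo V" and a: "comb B c + u \<in> jmon V B t" for t c u i
  proof (cases "i \<in> V")
    case i: True
    have "lookup u i < K i"
    proof (rule ccontr)
      assume "\<not> lookup u i < K i"
      then have "\<exists>u'. u = single i (K i) + u'"
        unfolding ex_add_iff by (auto simp: lookup_single when_def)
      then obtain u' where u': "u = single i (K i) + u'" ..
      obtain N where "comb B c + u + single i N \<in> pw V B (Suc t)"
        using a i unfolding jmon_def satur_def by blast
      also have "comb B c + u + single i N = comb B c + u' + single i (K i + N)"
        by (simp add: u' single_add ac_simps)
      finally have "comb B c + u' + single i (K i) \<in> pw V B (Suc t)"
        using K i c u u' by (force simp: level_def)
      then have "comb B c + u \<in> pw V B (Suc t)" by (simp add: u' ac_simps)
      then show False using a by (simp add: jmon_def)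
    qed
    moreover have "K i \<le> (\<Sum>i\<in>V. K i)" using V i by (intro member_le_sum) auto
    ultimately show ?thesis by simp
  qed (use u in \<open>simp add: lookup_outside\<close>)
  then show ?thesis by blast
qed

section \<open>Finiteness and polynomial growth of the count\<close>

lemma tdeg_le_box:
  assumes "finite V" "u \<in> expo V" "\<And>i. lookup u i < K"
  shows "tdeg u \<le> card V * K"
proof -
  have "tdeg u = (\<Sum>i\<in>V. lookup u i)" by (rule tdeg_eq[OF assms(1,2)])
  also have "\<dots> \<le> of_nat (card V) * K"
    by (intro sum_bounded_above less_imp_le assms(3))
  finally show ?thesis by simp
qed

lemma finite_box: "finite V \<Longrightarrow> finite {u \<in> expo V. \<forall>i. lookup u i < K}"
proof (rule finite_subset)
  assume V: "finite V"
  show "{u \<in> expo V. \<forall>i. lookup u i < K} \<subseteq> (\<Union>s\<le>card V * K. level V s)"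
    using tdeg_le_box[OF V] by (auto simp: level_def)
  show "finite (\<Union>s\<le>card V * K. level V s)" using V by simp
qed

text \<open>Supplies a translation-invariant total order for vectors over an index type that has no
  order: the indices are renumbered by natural numbers, and the order of vectors over
  \<open>nat\<close> is compatible with addition. It selects least representations and least
  exponents.\<close>

lemma additive_order_embedding:
  assumes "finite I"
  shows "\<exists>\<phi> :: ('i \<Rightarrow>\<^sub>0 nat) \<Rightarrow> (nat \<Rightarrow>\<^sub>0 nat). (\<forall>a b. \<phi> (a + b) = \<phi> a + \<phi> b) \<and> inj_on \<phi> (expo I)"
proof -
  obtain f :: "'i \<Rightarrow> nat" where f: "inj_on f I"
    using assms finite_imp_inj_to_nat_seg by blast
  define \<phi> :: "('i \<Rightarrow>\<^sub>0 nat) \<Rightarrow> (nat \<Rightarrow>\<^sub>0 nat)" where "\<phi> c = (\<Sum>i\<in>I. single (f i) (lookup c i))" for c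
  have "\<phi> (a + b) = \<phi> a + \<phi> b" for a b
    by (simp add: \<phi>_def lookup_add single_add sum.distrib)
  moreover have "inj_on \<phi> (expo I)"
  proof (rule inj_onI)
    fix a b assume ab: "a \<in> expo I" "b \<in> expo I" "\<phi> a = \<phi> b"
    have val: "lookup (\<phi> c) (f i) = lookup c i" if "i \<in> I" for c i
    proof -
      have "lookup (\<phi> c) (f i) = (\<Sum>j\<in>I. if j = i then lookup c j else 0)"
        unfolding \<phi>_def lookup_sum using f that
        by (intro sum.cong refl) (auto simp: lookup_single when_def inj_on_def)
      then show ?thesis using assms that by simp
    qed
    have "lookup a i = lookup b i" for i
      using val[of i a] val[of i b] ab lookup_outside[of _ I i] by (cases "i \<in> I") auto
    then show "a = b" by (rule poly_mapping_eqI)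
  qed
  ultimately show ?thesis by blast
qed

text \<open>A representation \<open>a = comb B c + u\<close> is made unique by taking \<open>c\<close> least for a translation
  invariant order; both the saturated and the non-canonical \<open>c\<close> are then up-closed for fixed \<open>u\<close>.\<close>

lemma evpoly_card_jmon:
  assumes V: "finite V" and B: "finite B" "B \<subseteq> expo V"
  shows "evpoly (\<lambda>t. real (card (jmon V B t)))"
proof -
  obtain K where K: "\<And>t c u i. c \<in> level B t \<Longrightarrow> u \<in> expo V \<Longrightarrow> comb B c + u \<in> jmon V B t \<Longrightarrow> lookup u i < K"
    using jmon_slack_bounded[OF V B] by blast
  define box where "box = {u \<in> expo V. \<forall>i. lookup u i < K}"
  have box: "finite box" unfolding box_def by (rule finite_box[OF V])
  obtain \<phi> :: "(('a \<Rightarrow>\<^sub>0 nat) \<Rightarrow>\<^sub>0 nat) \<Rightarrow> (nat \<Rightarrow>\<^sub>0 nat)"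
    where \<phi>: "\<And>a b. \<phi> (a + b) = \<phi> a + \<phi> b" "inj_on \<phi> (expo B)"
    using additive_order_embedding[OF B(1)] by blast
  define noncan where "noncan u c \<longleftrightarrow> (\<exists>c'\<in>level B (tdeg c). \<exists>u'\<in>expo V.
      comb B c + u = comb B c' + u' \<and> \<phi> c' < \<phi> c)" for u c
  define Sat where "Sat u = {c \<in> expo B. \<forall>i\<in>V. \<exists>N. comb B c + u + single i N \<in> pw V B (Suc (tdeg c))}" for u
  define Bad where "Bad u = {c \<in> Sat u. comb B c + u \<in> pw V B (Suc (tdeg c)) \<or> noncan u c}" for u
  have Sat: "upclosed B (Sat u)" for u
    unfolding upclosed_def
  proof (intro conjI ballI)
    fix c d assume c: "c \<in> Sat u" and d: "d \<in> expo B"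
    have "\<exists>N. comb B (c + d) + u + single i N \<in> pw V B (Suc (tdeg (c + d)))" if i: "i \<in> V" for i
    proof -
      obtain N where "comb B c + u + single i N \<in> pw V B (Suc (tdeg c))"
        using c i by (auto simp: Sat_def)
      from pw_comb_add[OF B this d] show ?thesis by (intro exI[of _ N]) (simp add: comb_add ac_simps)
    qed
    then show "c + d \<in> Sat u" using c d by (auto simp: Sat_def)
  qed (auto simp: Sat_def)
  have Bad: "upclosed B (Bad u)" for u
    unfolding upclosed_def
  proof (intro conjI ballI)
    show "Bad u \<subseteq> expo B" by (auto simp: Bad_def Sat_def)
    fix c d assume c: "c \<in> Bad u" and d: "d \<in> expo B"
    have "comb B (c + d) + u \<in> pw V B (Suc (tdeg (c + d)))" if "comb B c + u \<in> pw V B (Suc (tdeg c))"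
      using pw_comb_add[OF B that d] by (simp add: comb_add ac_simps)
    moreover have "noncan u (c + d)" if nc: "noncan u c"
    proof -
      obtain c' u' where c': "c' \<in> level B (tdeg c)" "u' \<in> expo V" "comb B c + u = comb B c' + u'" "\<phi> c' < \<phi> c"
        using nc by (auto simp: noncan_def)
      have "c' + d \<in> level B (tdeg (c + d))" using c'(1) d by (simp add: level_def)
      moreover have "comb B (c + d) + u = (comb B c + u) + comb B d" by (simp add: comb_add ac_simps)
      then have "comb B (c + d) + u = comb B (c' + d) + u'" unfolding c'(3) by (simp add: comb_add ac_simps)
      moreover have "\<phi> (c' + d) < \<phi> (c + d)" using c'(4) by (simp add: \<phi>(1))
      ultimately show ?thesis using c'(2) by (auto simp: noncan_def)
    qed
    moreover have "c + d \<in> Sat u" using c d Sat[of u] by (auto simp: Bad_def upclosed_def)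
    ultimately show "c + d \<in> Bad u" using c by (auto simp: Bad_def)
  qed
  have in_jmon: "comb B c + u \<in> jmon V B (tdeg c)" if "u \<in> expo V" "c \<in> Sat u - Bad u" for u c
    using that comb_in_pw[OF B, of c u] by (auto simp: jmon_def satur_def Sat_def Bad_def)
  \<comment> \<open>Each counted exponent is described by a slack from the finite box and its least
    multiplicity vector. \<open>Sat u - Bad u\<close> consists of the canonical vectors whose
    monomial is saturated but not in the next power.\<close>
  have eq: "jmon V B t = (\<lambda>(u, c). comb B c + u) ` (SIGMA u:box. (Sat u - Bad u) \<inter> level B t)" for t
  proof (intro equalityI subsetI)
    fix a assume a: "a \<in> jmon V B t"
    define P where "P = {c \<in> level B t. \<exists>u\<in>expo V. a = comb B c + u}"
    have "P \<noteq> {}" using a pw_iff[OF B, of a t] by (auto simp: jmon_def P_def)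
    have "finite P" unfolding P_def by (rule finite_subset[OF _ finite_level[OF B(1), of t]]) auto
    then have "Min (\<phi> ` P) \<in> \<phi> ` P" using \<open>P \<noteq> {}\<close> by (intro Min_in) auto
    then obtain c where c: "c \<in> P" "Min (\<phi> ` P) = \<phi> c" by auto
    have least: "\<not> \<phi> c' < \<phi> c" if "c' \<in> P" for c'
      using Min_le[of "\<phi> ` P" "\<phi> c'"] that \<open>finite P\<close> c(2) by auto
    obtain u where u: "u \<in> expo V" "a = comb B c + u" using c(1) by (auto simp: P_def)
    have cl: "c \<in> level B t" "tdeg c = t" "c \<in> expo B" using c(1) by (auto simp: P_def level_def)
    have "c \<in> Sat u" using a cl by (auto simp: Sat_def jmon_def satur_def u(2))
    moreover have "\<not> noncan u c" using least cl by (auto simp: noncan_def P_def u(2))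
    moreover have "comb B c + u \<notin> pw V B (Suc (tdeg c))" using a cl by (simp add: jmon_def u(2))
    ultimately have "c \<in> (Sat u - Bad u) \<inter> level B t" using cl by (simp add: Bad_def)
    moreover have "u \<in> box" using K[OF cl(1) u(1)] a u by (auto simp: box_def)
    ultimately show "a \<in> (\<lambda>(u, c). comb B c + u) ` (SIGMA u:box. (Sat u - Bad u) \<inter> level B t)"
      using u(2) by (intro image_eqI[of _ _ "(u, c)"]) auto
  next
    fix a assume "a \<in> (\<lambda>(u, c). comb B c + u) ` (SIGMA u:box. (Sat u - Bad u) \<inter> level B t)"
    then show "a \<in> jmon V B t" using in_jmon by (auto simp: box_def level_def)
  qed
  \<comment> \<open>If two canonical pairs give the same exponent, neither multiplicity vector
    precedes the other. The order is total on values of \<open>\<phi>\<close>, which is injective,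
    so the vectors agree, and the slacks agree by cancellation.\<close>
  have inj: "inj_on (\<lambda>(u, c). comb B c + u) (SIGMA u:box. (Sat u - Bad u) \<inter> level B t)" for t
  proof (rule inj_onI, clarsimp)
    fix u c u' c'
    assume *: "u \<in> box" "u' \<in> box" "c \<in> Sat u" "c \<notin> Bad u" "c \<in> level B t"
      "c' \<in> Sat u'" "c' \<notin> Bad u'" "c' \<in> level B t" and e: "comb B c + u = comb B c' + u'"
    have "\<not> noncan u c" "\<not> noncan u' c'" using * by (auto simp: Bad_def)
    then have "\<not> \<phi> c' < \<phi> c" "\<not> \<phi> c < \<phi> c'"
      using * e unfolding noncan_def by (force simp: level_def box_def)+
    then have "\<phi> c = \<phi> c'" by auto
    then have "c = c'" using \<phi>(2) * by (auto simp: level_def inj_on_def)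
    with e show "u = u' \<and> c = c'" by simp
  qed
  have "real (card (jmon V B t)) = (\<Sum>u\<in>box. real (card (Sat u \<inter> level B t)) - real (card (Bad u \<inter> level B t)))" for t
  proof -
    have "card (jmon V B t) = (\<Sum>u\<in>box. card ((Sat u - Bad u) \<inter> level B t))"
      unfolding eq card_image[OF inj] using box B(1) by (subst card_SigmaI) auto
    moreover have "real (card ((Sat u - Bad u) \<inter> level B t)) = real (card (Sat u \<inter> level B t)) - real (card (Bad u \<inter> level B t))" for u
    proof -
      have "(Sat u - Bad u) \<inter> level B t = (Sat u \<inter> level B t) - (Bad u \<inter> level B t)" by auto
      moreover have "Bad u \<inter> level B t \<subseteq> Sat u \<inter> level B t" by (auto simp: Bad_def)
      ultimately show ?thesis using B(1) by (simp add: card_Diff_subset of_nat_diff card_mono)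
    qed
    ultimately show ?thesis by simp
  qed
  then show ?thesis
    by (simp only:) (intro evpoly_sum evpoly_diff evpoly_card_upclosed B(1) Sat Bad)
qed

lemma jmon_decompose:
  assumes V: "finite V" and B: "finite B" "B \<subseteq> expo V"
  shows "\<exists>K. \<forall>t. \<forall>a\<in>jmon V B t. \<exists>c\<in>level B t. \<exists>u\<in>expo V. a = comb B c + u \<and> tdeg u \<le> K"
proof -
  obtain K where K: "\<And>t c u i. c \<in> level B t \<Longrightarrow> u \<in> expo V \<Longrightarrow> comb B c + u \<in> jmon V B t \<Longrightarrow> lookup u i < K"
    using jmon_slack_bounded[OF V B] by blast
  have "\<exists>c\<in>level B t. \<exists>u\<in>expo V. a = comb B c + u \<and> tdeg u \<le> card V * K" if a: "a \<in> jmon V B t" for t a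
  proof -
    obtain c u where cu: "c \<in> level B t" "u \<in> expo V" "a = comb B c + u"
      using a pw_iff[OF B, of a t] by (auto simp: jmon_def)
    then have "tdeg u \<le> card V * K" using a K by (intro tdeg_le_box[OF V]) auto
    with cu show ?thesis by blast
  qed
  then show ?thesis by blast
qed

lemma finite_jmon:
  assumes V: "finite V" and B: "finite B" "B \<subseteq> expo V"
  shows "finite (jmon V B t)"
proof -
  obtain K where K: "\<forall>t. \<forall>a\<in>jmon V B t. \<exists>c\<in>level B t. \<exists>u\<in>expo V. a = comb B c + u \<and> tdeg u \<le> K"
    using jmon_decompose[OF V B] by blast
  have "jmon V B t \<subseteq> (\<lambda>(c, u). comb B c + u) ` (level B t \<times> (\<Union>s\<le>K. level V s))"
  proof
    fix a assume "a \<in> jmon V B t"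
    then obtain c u where "c \<in> level B t" "u \<in> expo V" "a = comb B c + u" "tdeg u \<le> K"
      using K by blast
    then show "a \<in> (\<lambda>(c, u). comb B c + u) ` (level B t \<times> (\<Union>s\<le>K. level V s))"
      by (intro image_eqI[of _ _ "(c, u)"]) (auto simp: level_def)
  qed
  then show ?thesis by (rule finite_subset) (use V B(1) in auto)
qed

text \<open>With generators of degree \<open>m\<close> and slack of degree at most \<open>K\<close>,
  the exponents counted at \<open>t\<close> have degrees from \<open>m * t\<close> to
  \<open>m * t + K\<close>. They lie in \<open>K + 1\<close> levels, each of size of order
  \<open>t ^ d\<close>.\<close>

lemma card_jmon_bound:
  assumes V: "finite V" "card V = Suc d" and B: "finite B" "B \<subseteq> expo V" "\<And>b. b \<in> B \<Longrightarrow> tdeg b = m"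
  shows "\<exists>C. \<forall>t. real (card (jmon V B t)) \<le> C * real (t + 1) ^ d"
proof -
  obtain K where K: "\<forall>t. \<forall>a\<in>jmon V B t. \<exists>c\<in>level B t. \<exists>u\<in>expo V. a = comb B c + u \<and> tdeg u \<le> K"
    using jmon_decompose[OF V(1) B(1,2)] by blast
  have "card (jmon V B t) \<le> (K + 1) * (m + K + 1) ^ d * (t + 1) ^ d" for t
  proof -
    have sub: "jmon V B t \<subseteq> (\<Union>s\<in>{..K}. level V (m * t + s))"
    proof
      fix a assume "a \<in> jmon V B t"
      then obtain c u where cu: "c \<in> level B t" "u \<in> expo V" "a = comb B c + u" "tdeg u \<le> K"
        using K by blast
      then have "tdeg a = m * t + tdeg u" using B tdeg_comb[of B c m] by (simp add: level_def)
      then show "a \<in> (\<Union>s\<in>{..K}. level V (m * t + s))"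
        using cu expo_comb[OF B(2), of c] by (intro UN_I[of "tdeg u"]) (auto simp: level_def)
    qed
    have "card (jmon V B t) \<le> card (\<Union>s\<in>{..K}. level V (m * t + s))"
      using V by (intro card_mono sub) auto
    also have "\<dots> \<le> (\<Sum>s\<in>{..K}. card (level V (m * t + s)))" by (intro card_UN_le) auto
    also have "\<dots> \<le> (\<Sum>s\<in>{..K}. ((m + K + 1) * (t + 1)) ^ d)"
      by (intro sum_mono order_trans[OF card_level_le[OF V]] power_mono) (auto simp: algebra_simps)
    also have "\<dots> = (K + 1) * ((m + K + 1) * (t + 1)) ^ d" by simp
    also have "\<dots> = (K + 1) * (m + K + 1) ^ d * (t + 1) ^ d"
      unfolding power_mult_distrib by (simp only: mult.assoc)
    finally show ?thesis .
  qed
  then have "real (card (jmon V B t)) \<le> real ((K + 1) * (m + K + 1) ^ d) * real (t + 1) ^ d" for t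
    by (metis of_nat_le_iff of_nat_mult of_nat_power)
  then show ?thesis by blast
qed

lemma card_jmon_limit:
  assumes "finite V" "card V = Suc d" "finite B" "B \<subseteq> expo V" "\<And>b. b \<in> B \<Longrightarrow> tdeg b = m"
  shows "\<exists>L. (\<lambda>t. real (card (jmon V B t)) / real t ^ d) \<longlonglongrightarrow> L"
proof -
  obtain C where "\<forall>t. real (card (jmon V B t)) \<le> C * real (t + 1) ^ d"
    using card_jmon_bound[OF assms] by blast
  then show ?thesis
    by (intro evpoly_convergent[where C = C] evpoly_card_jmon assms) auto
qed

section \<open>Localization of the polynomial ring at the origin\<close>

definition polys :: "('v \<Rightarrow>\<^sub>0 nat) set \<Rightarrow> ('v, 'k::field) mpol set" where
  "polys U = {p. keys p \<subseteq> U}"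

lemma poly_mapping_expand: "(p :: 'a \<Rightarrow>\<^sub>0 'b::comm_monoid_add) = (\<Sum>a\<in>keys p. single a (lookup p a))"
proof (rule poly_mapping_eqI)
  fix k
  have "(\<Sum>a\<in>keys p. lookup (single a (lookup p a)) k) = (\<Sum>a\<in>keys p. if a = k then lookup p k else 0)"
    by (intro sum.cong refl) (auto simp: lookup_single when_def)
  then show "lookup p k = lookup (\<Sum>a\<in>keys p. single a (lookup p a)) k"
    by (simp add: lookup_sum in_keys_iff)
qed

lemma lookup_times:
  fixes p q :: "('v, 'k::field) mpol"
  shows "lookup (p * q) a = (\<Sum>b\<in>keys p. \<Sum>c\<in>keys q. if b + c = a then lookup p b * lookup q c else 0)"
proof -
  have "p * q = (\<Sum>b\<in>keys p. \<Sum>c\<in>keys q. single (b + c) (lookup p b * lookup q c))"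
    by (subst (1) poly_mapping_expand[of p], subst (1) poly_mapping_expand[of q])
      (simp add: sum_product mult_single)
  then show ?thesis
    by (auto simp: lookup_sum lookup_single when_def intro!: sum.cong)
qed

lemma zero_in_polys [simp]: "0 \<in> polys U"
  by (simp add: polys_def)

lemma polys_add: "p \<in> polys U \<Longrightarrow> q \<in> polys U \<Longrightarrow> p + q \<in> polys U"
  unfolding polys_def using Poly_Mapping.keys_add[of p q] by blast

lemma polys_uminus: "p \<in> polys U \<Longrightarrow> - p \<in> polys U"
  unfolding polys_def by (auto simp: in_keys_iff)

lemma polys_mono: "U \<subseteq> U' \<Longrightarrow> polys U \<subseteq> polys U'"
  by (auto simp: polys_def)

lemma polys_mult:
  assumes "p \<in> polys U" "q \<in> polys U'" "\<And>a b. a \<in> U \<Longrightarrow> b \<in> U' \<Longrightarrow> a + b \<in> U''"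
  shows "p * q \<in> polys U''"
  using assms Poly_Mapping.keys_mult[of p q] unfolding polys_def by blast

lemma upclosed_add: "upclosed V U \<Longrightarrow> a \<in> expo V \<Longrightarrow> b \<in> U \<Longrightarrow> a + b \<in> U"
  by (metis add.commute upclosed_def)

lemma polys_upclosed_mult:
  assumes "upclosed V U" "p \<in> polys (expo V)" "q \<in> polys U"
  shows "p * q \<in> polys U"
  using upclosed_add[OF assms(1)] by (rule polys_mult[OF assms(2,3)])

lemma upclosed_expo [simp]: "upclosed V (expo V)"
  by (auto simp: upclosed_def)

lemma single_in_polys: "a \<in> U \<Longrightarrow> single a c \<in> polys U"
  by (auto simp: polys_def)

lemma one_in_polys [simp]: "1 \<in> polys (expo V)"
  by (simp add: polys_def)

lemma lookup_times_0:
  fixes p q :: "('v, 'k::field) mpol"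
  shows "lookup (p * q) 0 = lookup p 0 * lookup q 0"
proof -
  have z: "b + c = 0 \<longleftrightarrow> b = 0 \<and> c = 0" for b c :: "'v \<Rightarrow>\<^sub>0 nat"
    by (metis add.right_neutral add_eq_0_iff_both_eq_0 tdeg_add tdeg_eq_0_iff)
  have "lookup (p * q) 0 = (\<Sum>b\<in>keys p. if b = 0 then (\<Sum>c\<in>keys q. if c = 0 then lookup p 0 * lookup q 0 else 0) else 0)"
    unfolding lookup_times z by (intro sum.cong refl) (auto intro!: sum.cong)
  then show ?thesis by (auto simp: in_keys_iff)
qed

text \<open>Take an exponent \<open>a\<close> of \<open>p\<close> outside \<open>U\<close> of least
  degree. A nonconstant term of \<open>s\<close> could contribute to the coefficient of
  \<open>a\<close> in \<open>s * p\<close> only together with an exponent of \<open>p\<close> of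
  smaller degree; that exponent lies in \<open>U\<close> and would force \<open>a\<close> into
  \<open>U\<close>. So only the constant term of \<open>s\<close> contributes, and the coefficient
  is nonzero. This is what allows membership in a localized monomial ideal to be read off the
  numerator.\<close>

lemma polys_cancel_unit:
  fixes p s :: "('v, 'k::field) mpol"
  assumes U: "upclosed V U" and s: "s \<in> polys (expo V)" "lookup s 0 \<noteq> 0"
    and p: "p \<in> polys (expo V)" and sp: "s * p \<in> polys U"
  shows "p \<in> polys U"
proof (rule ccontr)
  assume "p \<notin> polys U"
  then have ne: "keys p - U \<noteq> {}" by (auto simp: polys_def)
  define a where "a = arg_min_on tdeg (keys p - U)"
  have a: "a \<in> keys p - U" unfolding a_def using ne by (intro arg_min_if_finite) auto
  have least: "tdeg a \<le> tdeg b" if "b \<in> keys p - U" for b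
    unfolding a_def using ne that by (intro arg_min_least) auto
  have "(if b + c = a then lookup s b * lookup p c else 0) =
      (if b = 0 then (if c = a then lookup s 0 * lookup p a else 0) else 0)"
    if "b \<in> keys s" "c \<in> keys p" for b c
  proof (cases "b = 0")
    case False
    have "b + c \<noteq> a"
    proof
      assume "b + c = a"
      then have "tdeg c < tdeg a" using False by (metis tdeg_add tdeg_eq_0_iff add_cancel_left_left le_add2 le_neq_implies_less)
      then have "c \<in> U" using least[of c] that(2) by auto
      then have "a \<in> U" using upclosed_add[OF U] that(1) s(1) \<open>b + c = a\<close> by (auto simp: polys_def)
      then show False using a by blast
    qed
    then show ?thesis using False by simp
  qed simp
  then have "lookup (s * p) a = (\<Sum>b\<in>keys s. \<Sum>c\<in>keys p. if b = 0 then (if c = a then lookup s 0 * lookup p a else 0) else 0)"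
    unfolding lookup_times by (intro sum.cong refl) blast
  also have "\<dots> = (\<Sum>b\<in>keys s. if b = 0 then (\<Sum>c\<in>keys p. if c = a then lookup s 0 * lookup p a else 0) else 0)"
    by (intro sum.cong refl) auto
  also have "\<dots> = lookup s 0 * lookup p a"
    using a s(2) by (simp add: in_keys_iff)
  finally have "lookup (s * p) a \<noteq> 0" using s(2) a by (simp add: in_keys_iff)
  then have "a \<in> U" using sp by (auto simp: polys_def in_keys_iff)
  then show False using a by blast
qed

text \<open>The case of the zero ideal. Denominators are not zero divisors, so equality of fractions
  reduces to cross multiplication.\<close>

lemma polys_regular:
  fixes p s :: "('v, 'k::field) mpol"
  assumes "s \<in> polys (expo V)" "lookup s 0 \<noteq> 0" "p \<in> polys (expo V)" "s * p = 0"
  shows "p = 0"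
proof -
  have "p \<in> polys {}" by (rule polys_cancel_unit[of V "{}" s]) (use assms in \<open>auto simp: upclosed_def\<close>)
  then show ?thesis by (simp add: polys_def)
qed

lemma single_nat_eq_0: "single v (n :: nat) = 0 \<longleftrightarrow> n = 0"
  by (metis tdeg_single tdeg_eq_0_iff)

lemma carrier_mpoly_ring: "carrier (mpoly_ring K V) = polys (expo V)"
  by (auto simp: mpoly_ring_def polys_def expo_def)

lemma mpoly_ring_simps [simp]:
  "(\<otimes>\<^bsub>mpoly_ring K V\<^esub>) = (*)" "\<one>\<^bsub>mpoly_ring K V\<^esub> = 1"
  "(\<oplus>\<^bsub>mpoly_ring K V\<^esub>) = (+)" "\<zero>\<^bsub>mpoly_ring K V\<^esub> = 0"
  by (simp_all add: mpoly_ring_def)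

lemma polys_expo_mult: "p \<in> polys (expo V) \<Longrightarrow> q \<in> polys (expo V) \<Longrightarrow> p * q \<in> polys (expo V)"
  by (rule polys_upclosed_mult) simp_all

lemma cring_mpoly_ring: "cring (mpoly_ring K V)"
proof (intro cringI abelian_groupI comm_monoidI)
  fix x assume "x \<in> carrier (mpoly_ring K V)"
  then show "\<exists>y\<in>carrier (mpoly_ring K V). y \<oplus>\<^bsub>mpoly_ring K V\<^esub> x = \<zero>\<^bsub>mpoly_ring K V\<^esub>"
    by (intro bexI[of _ "- x"]) (auto simp: carrier_mpoly_ring polys_uminus)
qed (auto simp: carrier_mpoly_ring polys_add polys_expo_mult algebra_simps)

text \<open>Every monomial other than 1 is a multiple of a variable, so the vanishing of the
  constant term is the only condition.\<close>

lemma indet_ideal_eq: "indet_ideal K V = {p \<in> polys (expo V). lookup p 0 = 0}"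
proof -
  interpret A: cring "mpoly_ring K V" by (rule cring_mpoly_ring)
  let ?M = "{p \<in> polys (expo V). lookup p (0::'a \<Rightarrow>\<^sub>0 nat) = (0::'b)}"
  have inv: "\<ominus>\<^bsub>mpoly_ring K V\<^esub> p = - p" if "p \<in> polys (expo V)" for p
    using that A.minus_equality[of "- p" p] by (simp add: carrier_mpoly_ring polys_uminus)
  have "ideal ?M (mpoly_ring K V)"
  proof (rule idealI[OF A.ring_axioms], rule A.add.subgroupI)
    show "?M \<noteq> {}" by (auto intro: exI[of _ 0])
    show "\<ominus>\<^bsub>mpoly_ring K V\<^esub> p \<in> ?M" if "p \<in> ?M" for p
      using that by (simp add: inv polys_uminus)
  qed (auto simp: carrier_mpoly_ring polys_add polys_expo_mult lookup_add lookup_times_0)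
  moreover have "indet ` V \<subseteq> ?M"
    by (auto simp: indet_def lookup_single when_def single_nat_eq_0 intro!: single_in_polys)
  moreover have "?M \<subseteq> J" if J: "ideal J (mpoly_ring K V)" "indet ` V \<subseteq> J" for J
  proof
    interpret J: ideal J "mpoly_ring K V" by fact
    fix p assume p: "p \<in> ?M"
    have mon: "single a (lookup p a) \<in> J" if a: "a \<in> keys p" for a
    proof -
      have "a \<in> expo V" "a \<noteq> 0" using p a by (auto simp: polys_def in_keys_iff)
      then obtain v where v: "lookup a v \<noteq> 0" by (metis lookup_zero poly_mapping_eqI)
      then have vV: "v \<in> V" using \<open>a \<in> expo V\<close> by (auto dest: lookup_outside)
      have "\<exists>d. a = single v 1 + d" unfolding ex_add_iff using v by (auto simp: lookup_single when_def)
      then obtain d where d: "a = single v 1 + d" ..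
      have "single d (lookup p a) * indet v \<in> J"
        using J.I_l_closed[of "indet v" "single d (lookup p a)"] J(2) vV \<open>a \<in> expo V\<close> d
        by (auto simp: carrier_mpoly_ring intro!: single_in_polys)
      also have "single d (lookup p a) * indet v = single a (lookup p a)"
        by (simp add: indet_def mult_single d add.commute)
      finally show ?thesis .
    qed
    have sum_closed: "(\<And>x. x \<in> F \<Longrightarrow> f x \<in> J) \<Longrightarrow> sum f F \<in> J" for F and f :: "('a \<Rightarrow>\<^sub>0 nat) \<Rightarrow> ('a, 'b) mpol"
      by (induction F rule: infinite_finite_induct) (use J.zero_closed J.a_closed in auto)
    have "(\<Sum>a\<in>keys p. single a (lookup p a)) \<in> J" by (intro sum_closed mon)
    then show "p \<in> J" by (simp flip: poly_mapping_expand)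
  qed
  ultimately show ?thesis unfolding indet_ideal_def genideal_def by blast
qed

text \<open>Describes the powers of the maximal ideal; it also settles the complete hypergraph for
  \<open>m = 1\<close>, whose edges are single nodes.\<close>

lemma pw_singles: "pw V ((\<lambda>v. single v 1) ` V) k = {a \<in> expo V. k \<le> tdeg a}" (is "pw V ?B k = _")
proof (induction k)
  case (Suc k)
  show ?case
  proof (intro equalityI subsetI)
    fix a assume "a \<in> pw V ?B (Suc k)"
    then obtain b c where "a = b + c" "b \<in> ?B" "c \<in> pw V ?B k" unfolding pw.simps by blast
    then show "a \<in> {a \<in> expo V. Suc k \<le> tdeg a}" using Suc by auto
  next
    fix a assume a: "a \<in> {a \<in> expo V. Suc k \<le> tdeg a}"
    then have "a \<noteq> 0" by auto
    then obtain v where v: "lookup a v \<noteq> 0" by (metis lookup_zero poly_mapping_eqI)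
    then have vV: "v \<in> V" using a by (auto dest: lookup_outside)
    have "\<exists>d. a = single v 1 + d" unfolding ex_add_iff using v by (auto simp: lookup_single when_def)
    then obtain d where d: "a = single v 1 + d" ..
    then have "d \<in> pw V ?B k" using a Suc by auto
    moreover have "single v 1 \<in> ?B" using vV by simp
    ultimately show "a \<in> pw V ?B (Suc k)" using d unfolding pw.simps by blast
  qed
qed auto

section \<open>The local ring at the origin and its monomial ideals\<close>

locale node_localization =
  fixes V :: "'v set" and K :: "'k::field itself"
  assumes finite_V: "finite V"
begin

abbreviation A :: "('v, 'k) mpol ring" where "A \<equiv> mpoly_ring K V"

definition S :: "('v, 'k) mpol set" where "S = carrier A - indet_ideal K V"

abbreviation R where "R \<equiv> node_ring K V"

abbreviation frac where "frac p s \<equiv> loc_frac A S p s"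

abbreviation P :: "('v, 'k) mpol set" where "P \<equiv> polys (expo V)"

lemma S_iff: "s \<in> S \<longleftrightarrow> s \<in> P \<and> lookup s 0 \<noteq> 0"
  by (auto simp: S_def indet_ideal_eq carrier_mpoly_ring)

lemma S_P: "s \<in> S \<Longrightarrow> s \<in> P" by (simp add: S_iff)

lemma S_mult [simp]: "s \<in> S \<Longrightarrow> t \<in> S \<Longrightarrow> s * t \<in> S"
  by (simp add: S_iff polys_expo_mult lookup_times_0)

lemma S_one [simp]: "1 \<in> S" by (simp add: S_iff)

lemma S_cancel:
  assumes "u \<in> S" "p \<in> P" "q \<in> P" "u * p = u * q"
  shows "p = q"
proof -
  have "p - q \<in> P" using polys_add[OF assms(2) polys_uminus[OF assms(3)]] by simp
  moreover have "u * (p - q) = 0" using assms(4) by (simp add: algebra_simps)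
  ultimately have "p - q = 0" using assms(1) polys_regular[of u V "p - q"] by (simp add: S_iff)
  then show ?thesis by simp
qed

lemma loc_rel_iff:
  "((p, s), (q, t)) \<in> loc_rel A S \<longleftrightarrow> p \<in> P \<and> s \<in> S \<and> q \<in> P \<and> t \<in> S \<and> p * t = q * s"
proof -
  have "p * t = q * s" if "p \<in> P" "s \<in> S" "q \<in> P" "t \<in> S" "u \<in> S" "u * (p * t) = u * (q * s)" for u
    using that S_cancel[of u "p * t" "q * s"] by (simp add: polys_expo_mult S_P)
  then show ?thesis by (auto simp: loc_rel_def carrier_mpoly_ring intro: bexI[of _ 1])
qed

lemma frac_mem_iff: "(q, t) \<in> frac p s \<longleftrightarrow> p \<in> P \<and> s \<in> S \<and> q \<in> P \<and> t \<in> S \<and> p * t = q * s"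
  by (simp add: loc_frac_def loc_rel_iff)

lemma frac_eq_iff:
  assumes "p \<in> P" "s \<in> S" "q \<in> P" "t \<in> S"
  shows "frac p s = frac q t \<longleftrightarrow> p * t = q * s"
proof
  assume "frac p s = frac q t"
  moreover have "(q, t) \<in> frac q t" using assms by (simp add: frac_mem_iff)
  ultimately show "p * t = q * s" by (metis frac_mem_iff)
next
  assume e: "p * t = q * s"
  have "p * r = x * s \<longleftrightarrow> q * r = x * t" if "x \<in> P" "r \<in> S" for x r
  proof
    assume "p * r = x * s"
    then have "(p * r) * t = (x * s) * t" by simp
    moreover have "(p * r) * t = s * (q * r)" using arg_cong[OF e, of "\<lambda>y. y * r"] by (simp add: ac_simps)
    ultimately have "s * (q * r) = s * (x * t)" by (simp add: ac_simps)
    then show "q * r = x * t" using S_cancel[OF assms(2), of "q * r" "x * t"] assms that by (simp add: S_P polys_expo_mult)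
  next
    assume "q * r = x * t"
    then have "(q * r) * s = (x * t) * s" by simp
    moreover have "(q * r) * s = t * (p * r)" using arg_cong[OF e, of "\<lambda>y. y * r"] by (simp add: ac_simps)
    ultimately have "t * (p * r) = t * (x * s)" by (simp add: ac_simps)
    then show "p * r = x * s" using S_cancel[OF assms(4), of "p * r" "x * s"] assms that by (simp add: S_P polys_expo_mult)
  qed
  then show "frac p s = frac q t" using assms by (auto simp: frac_mem_iff)
qed

lemma node_ring_eq: "R = localization A S"
  by (simp add: node_ring_def localization_at_prime_def S_def)

lemma carrier_R: "carrier R = {frac p s | p s. p \<in> P \<and> s \<in> S}"
  by (auto simp: node_ring_eq localization_def quotient_def loc_frac_def carrier_mpoly_ring)

lemma frac_closed [simp]: "p \<in> P \<Longrightarrow> s \<in> S \<Longrightarrow> frac p s \<in> carrier R"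
  by (auto simp: carrier_R)

lemma carrierE:
  assumes "x \<in> carrier R" obtains p s where "p \<in> P" "s \<in> S" "x = frac p s"
  using assms by (auto simp: carrier_R)

text \<open>The operations of the localization are unions over all pairs of representatives. Once
  the value is independent of the representatives, these are unions of a constant family over
  nonempty classes.\<close>

lemma UN_frac:
  assumes "p \<in> P" "s \<in> S" "q \<in> P" "t \<in> S"
    and "\<And>a s' b t'. (a, s') \<in> frac p s \<Longrightarrow> (b, t') \<in> frac q t \<Longrightarrow> F a s' b t' = F p s q t"
  shows "(\<Union>(a, s')\<in>frac p s. \<Union>(b, t')\<in>frac q t. F a s' b t') = F p s q t"
proof -
  have "(p, s) \<in> frac p s" "(q, t) \<in> frac q t" using assms by (auto simp: frac_mem_iff)
  note ne = this
  have "(\<Union>(b, t')\<in>frac q t. F a s' b t') = F p s q t" if m: "(a, s') \<in> frac p s" for a s'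
    by (rule SUP_eq_const) (use ne assms(5)[OF m] in auto)
  note inner = this
  show ?thesis
    by (rule SUP_eq_const) (use ne inner in auto)
qed

lemma frac_mult:
  assumes "p \<in> P" "s \<in> S" "q \<in> P" "t \<in> S"
  shows "frac p s \<otimes>\<^bsub>R\<^esub> frac q t = frac (p * q) (s * t)"
proof -
  have "frac (a * b) (s' * t') = frac (p * q) (s * t)"
    if "(a, s') \<in> frac p s" "(b, t') \<in> frac q t" for a s' b t'
  proof -
    have e: "p * s' = a * s" "q * t' = b * t" using that by (auto simp: frac_mem_iff)
    have "(a * b) * (s * t) = (a * s) * (b * t)" by (simp add: ac_simps)
    also have "\<dots> = (p * q) * (s' * t')" unfolding e[symmetric] by (simp add: ac_simps)
    finally have "(a * b) * (s * t) = (p * q) * (s' * t')" .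
    then show ?thesis using that assms by (subst frac_eq_iff) (auto simp: frac_mem_iff polys_expo_mult)
  qed
  then show ?thesis
    using UN_frac[OF assms, of "\<lambda>a s' b t'. frac (a * b) (s' * t')"]
    by (simp add: node_ring_eq localization_def)
qed

lemma frac_add:
  assumes "p \<in> P" "s \<in> S" "q \<in> P" "t \<in> S"
  shows "frac p s \<oplus>\<^bsub>R\<^esub> frac q t = frac (p * t + q * s) (s * t)"
proof -
  have "frac (a * t' + b * s') (s' * t') = frac (p * t + q * s) (s * t)"
    if "(a, s') \<in> frac p s" "(b, t') \<in> frac q t" for a s' b t'
  proof -
    have e: "p * s' = a * s" "q * t' = b * t" using that by (auto simp: frac_mem_iff)
    have "(a * t' + b * s') * (s * t) = (a * s) * (t * t') + (b * t) * (s * s')"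
      by (simp add: algebra_simps)
    also have "\<dots> = (p * t + q * s) * (s' * t')"
      unfolding e[symmetric] by (simp add: algebra_simps)
    finally have "(a * t' + b * s') * (s * t) = (p * t + q * s) * (s' * t')" .
    then show ?thesis using that assms
      by (subst frac_eq_iff) (auto simp: frac_mem_iff polys_expo_mult polys_add S_P)
  qed
  then show ?thesis
    using UN_frac[OF assms, of "\<lambda>a s' b t'. frac (a * t' + b * s') (s' * t')"]
    by (simp add: node_ring_eq localization_def)
qed

lemma frac_zero: "\<zero>\<^bsub>R\<^esub> = frac 0 1" and frac_one: "\<one>\<^bsub>R\<^esub> = frac 1 1"
  by (simp_all add: node_ring_eq localization_def)

lemma frac_zero_eq: "s \<in> S \<Longrightarrow> frac 0 s = \<zero>\<^bsub>R\<^esub>"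
  unfolding frac_zero by (subst frac_eq_iff) simp_all

lemma frac_add_same: "p \<in> P \<Longrightarrow> q \<in> P \<Longrightarrow> s \<in> S \<Longrightarrow> frac p s \<oplus>\<^bsub>R\<^esub> frac q s = frac (p + q) s"
  by (simp add: frac_add, subst frac_eq_iff) (auto simp: polys_add polys_expo_mult S_P algebra_simps)

lemma cring_R: "cring R"
proof (intro cringI abelian_groupI comm_monoidI)
  fix x assume "x \<in> carrier R"
  then obtain p s where x: "p \<in> P" "s \<in> S" "x = frac p s" by (rule carrierE)
  show "\<exists>y\<in>carrier R. y \<oplus>\<^bsub>R\<^esub> x = \<zero>\<^bsub>R\<^esub>"
    by (rule bexI[of _ "frac (- p) s"]) (use x in \<open>simp_all add: polys_uminus frac_add_same frac_zero_eq\<close>)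
next
  fix x y z assume "x \<in> carrier R" "y \<in> carrier R" "z \<in> carrier R"
  then obtain p s q t r u where x: "p \<in> P" "s \<in> S" "x = frac p s" "q \<in> P" "t \<in> S" "y = frac q t"
      "r \<in> P" "u \<in> S" "z = frac r u" by (metis carrierE)
  then show "(x \<oplus>\<^bsub>R\<^esub> y) \<otimes>\<^bsub>R\<^esub> z = x \<otimes>\<^bsub>R\<^esub> z \<oplus>\<^bsub>R\<^esub> y \<otimes>\<^bsub>R\<^esub> z"
    by (simp add: frac_add frac_mult polys_add polys_expo_mult S_P, subst frac_eq_iff)
      (simp_all add: polys_add polys_expo_mult S_P algebra_simps)
qed (auto elim!: carrierE simp: frac_add frac_mult frac_zero frac_one polys_add polys_expo_mult S_P algebra_simps)

sublocale R: cring R by (rule cring_R)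

lemma frac_uminus: "p \<in> P \<Longrightarrow> s \<in> S \<Longrightarrow> \<ominus>\<^bsub>R\<^esub> frac p s = frac (- p) s"
  by (rule R.minus_equality) (simp_all add: polys_uminus frac_add_same frac_zero_eq)

text \<open>The extension to the local ring of the monomial ideal with exponent set
  \<open>U\<close>.\<close>

definition loc :: "('v \<Rightarrow>\<^sub>0 nat) set \<Rightarrow> (('v, 'k) mpol \<times> ('v, 'k) mpol) set set" where
  "loc U = {frac p s | p s. p \<in> polys U \<and> s \<in> S}"

lemma frac_in_locI: "p \<in> polys U \<Longrightarrow> s \<in> S \<Longrightarrow> frac p s \<in> loc U"
  unfolding loc_def by blast

lemma upclosed_polys_P: "upclosed V U \<Longrightarrow> p \<in> polys U \<Longrightarrow> p \<in> P"
  by (auto simp: upclosed_def polys_def)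

text \<open>Equality with a fraction whose numerator lies in the ideal leaves only a denominator to
  cancel, which \<open>polys_cancel_unit\<close> permits. So extension loses nothing, and strict
  inclusions of up-closed exponent sets stay strict.\<close>

lemma frac_in_loc_iff:
  assumes U: "upclosed V U" and "p \<in> P" "s \<in> S"
  shows "frac p s \<in> loc U \<longleftrightarrow> p \<in> polys U"
proof
  assume "frac p s \<in> loc U"
  then obtain q t where q: "q \<in> polys U" "t \<in> S" "frac p s = frac q t" by (auto simp: loc_def)
  have qP: "q \<in> P" using upclosed_polys_P[OF U q(1)] .
  have "t * p = s * q" using q(3) frac_eq_iff[OF assms(2,3) qP q(2)] by (simp add: mult.commute)
  moreover have "s * q \<in> polys U" using polys_upclosed_mult[OF U _ q(1)] S_P assms(3) by blast
  ultimately show "p \<in> polys U"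
    using polys_cancel_unit[OF U, of t p] q(2) assms(2) by (simp add: S_iff)
qed (use assms in \<open>simp add: frac_in_locI\<close>)

lemma loc_mono: "U \<subseteq> U' \<Longrightarrow> loc U \<subseteq> loc U'"
  unfolding loc_def using polys_mono by blast

lemma loc_expo: "loc (expo V) = carrier R"
  by (simp add: loc_def carrier_R)

lemma loc_ideal:
  assumes U: "upclosed V U" shows "ideal (loc U) R"
proof (rule idealI[OF R.ring_axioms], rule R.add.subgroupI)
  show "loc U \<subseteq> carrier R" using upclosed_polys_P[OF U] by (auto simp: loc_def)
  have "frac 0 1 \<in> loc U" unfolding loc_def using zero_in_polys S_one by blast
  then show "loc U \<noteq> {}" by blast
next
  fix x assume "x \<in> loc U"
  then obtain p s where x: "x = frac p s" "p \<in> polys U" "s \<in> S" by (auto simp: loc_def)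
  then have "\<ominus>\<^bsub>R\<^esub> x = frac (- p) s" using upclosed_polys_P[OF U] by (simp add: frac_uminus)
  then show "\<ominus>\<^bsub>R\<^esub> x \<in> loc U"
    using polys_uminus[OF x(2)] x(3) by (simp add: frac_in_locI)
next
  fix x y assume "x \<in> loc U" "y \<in> loc U"
  then obtain p s q t where x: "x = frac p s" "p \<in> polys U" "s \<in> S" "y = frac q t" "q \<in> polys U" "t \<in> S"
    unfolding loc_def by blast
  have "x \<oplus>\<^bsub>R\<^esub> y = frac (p * t + q * s) (s * t)"
    using x upclosed_polys_P[OF U] by (simp add: frac_add)
  moreover have "p * t + q * s \<in> polys U"
    using polys_upclosed_mult[OF U S_P[OF x(6)] x(2)] polys_upclosed_mult[OF U S_P[OF x(3)] x(5)]
    by (simp add: polys_add mult.commute)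
  ultimately show "x \<oplus>\<^bsub>R\<^esub> y \<in> loc U" using x by (simp add: frac_in_locI)
next
  fix x r assume "x \<in> loc U" "r \<in> carrier R"
  then obtain p s q t where x: "x = frac p s" "p \<in> polys U" "s \<in> S" "r = frac q t" "q \<in> P" "t \<in> S"
    unfolding loc_def carrier_R by blast
  have pP: "p \<in> P" using upclosed_polys_P[OF U x(2)] .
  have "q * p \<in> polys U" using polys_upclosed_mult[OF U x(5,2)] .
  then show "r \<otimes>\<^bsub>R\<^esub> x \<in> loc U" "x \<otimes>\<^bsub>R\<^esub> r \<in> loc U"
    using x pP by (simp_all add: frac_in_locI frac_mult mult.commute)
qed

text \<open>Scalars and denominators are built into the monomial fractions, so closure under
  addition is all that is asked of \<open>J\<close>. In this form the criterion applies to a product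
  of ideals as well as to an ideal.\<close>

lemma loc_subsetI:
  assumes U: "upclosed V U" and zero: "\<zero>\<^bsub>R\<^esub> \<in> J"
    and add: "\<And>x y. x \<in> J \<Longrightarrow> y \<in> J \<Longrightarrow> x \<oplus>\<^bsub>R\<^esub> y \<in> J"
    and mono: "\<And>a c s. a \<in> U \<Longrightarrow> s \<in> S \<Longrightarrow> frac (single a c) s \<in> J"
  shows "loc U \<subseteq> J"
proof
  fix x assume "x \<in> loc U"
  then obtain p s where x: "x = frac p s" "p \<in> polys U" "s \<in> S" by (auto simp: loc_def)
  have "frac (\<Sum>a\<in>F. single a (lookup p a)) s \<in> J" if "finite F" "F \<subseteq> U" for F
    using that
  proof (induction F rule: finite_induct)
    case empty
    then show ?case using zero x(3) by (simp add: frac_zero_eq)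
  next
    case (insert a F)
    have sP: "single a (lookup p a) \<in> P" "(\<Sum>a\<in>F. single a (lookup p a)) \<in> P" if "F \<subseteq> U" "a \<in> U" for F
    proof -
      show "single a (lookup p a) \<in> P" using that U by (intro single_in_polys) (auto simp: upclosed_def)
      have "(\<Sum>a\<in>F. single a (lookup p a)) \<in> P"
        using that(1) by (induction F rule: infinite_finite_induct) (use U in \<open>auto intro!: polys_add single_in_polys simp: upclosed_def\<close>)
      then show "(\<Sum>a\<in>F. single a (lookup p a)) \<in> P" .
    qed
    have "frac (single a (lookup p a)) s \<oplus>\<^bsub>R\<^esub> frac (\<Sum>a\<in>F. single a (lookup p a)) s \<in> J"
      using insert x(3) by (intro add mono) auto
    then show ?case using insert x(3) sP[of F] by (simp add: frac_add_same)
  qed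
  from this[of "keys p"] x show "x \<in> J"
    by (simp add: polys_def flip: poly_mapping_expand)
qed

lemma generator_in_pw:
  assumes "b \<in> B" shows "b \<in> pw V B 1"
proof -
  have "b = b + 0" by simp
  then show ?thesis using assms expo_zero unfolding One_nat_def pw.simps by blast
qed

lemma genideal_loc:
  assumes B: "B \<subseteq> expo V"
  shows "Idl\<^bsub>R\<^esub> ((\<lambda>b. frac (single b 1) 1) ` B) = loc (pw V B 1)"
proof -
  have up: "upclosed V (pw V B 1)" by (rule upclosed_pw[OF B])
  have pw1: "pw V B 1 = {b + a | b a. b \<in> B \<and> a \<in> expo V}" by (simp add: pw.simps)
  have "frac (single b 1) 1 \<in> loc (pw V B 1)" if "b \<in> B" for b
  proof -
    have "b \<in> pw V B 1" by (rule generator_in_pw[OF that])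
    then show ?thesis using B that by (subst frac_in_loc_iff[OF up]) (auto intro: single_in_polys)
  qed
  moreover have "loc (pw V B 1) \<subseteq> J" if J: "ideal J R" "(\<lambda>b. frac (single b 1) 1) ` B \<subseteq> J" for J
  proof (rule loc_subsetI[OF up])
    interpret J: ideal J R by fact
    show "\<zero>\<^bsub>R\<^esub> \<in> J" by simp
    show "x \<oplus>\<^bsub>R\<^esub> y \<in> J" if "x \<in> J" "y \<in> J" for x y using that by simp
    fix a c s assume "a \<in> pw V B 1" and s: "s \<in> S"
    then obtain b d where b: "a = b + d" "b \<in> B" "d \<in> expo V" unfolding pw1 by auto
    have m: "frac (single b 1) 1 \<in> J" using J(2) b(2) by blast
    have "single d c \<in> P" "single b 1 \<in> P" using b B by (auto intro: single_in_polys)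
    then have "frac (single d c) s \<otimes>\<^bsub>R\<^esub> frac (single b 1) 1 = frac (single a c) s"
      using s by (simp add: frac_mult mult_single b(1) add.commute)
    moreover have "frac (single d c) s \<otimes>\<^bsub>R\<^esub> frac (single b 1) 1 \<in> J"
      using J.I_l_closed[OF m] \<open>single d c \<in> P\<close> s by simp
    ultimately show "frac (single a c) s \<in> J" by simp
  qed
  ultimately show ?thesis
    unfolding genideal_def using loc_ideal[OF up] by blast
qed

lemma ideal_power_loc:
  assumes B: "B \<subseteq> expo V"
  shows "ideal_power R (loc (pw V B 1)) t = loc (pw V B t)"
proof (induction t)
  case 0
  show ?case by (simp add: ideals_set_def loc_expo)
next
  case (Suc t)
  have up: "upclosed V (pw V B t)" for t by (rule upclosed_pw[OF B])
  have add_pw: "a + b \<in> pw V B (Suc t)" if "a \<in> pw V B t" "b \<in> pw V B 1" for a b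
  proof -
    obtain c d where "b = c + d" "c \<in> B" "d \<in> expo V" using \<open>b \<in> pw V B 1\<close> by (auto simp: pw.simps)
    moreover have "a + d \<in> pw V B t" using pw_add[OF B that(1) \<open>d \<in> expo V\<close>] .
    ultimately have "a + b = c + (a + d)" "a + d \<in> pw V B t" by (simp_all add: ac_simps)
    then show ?thesis using \<open>c \<in> B\<close> by (auto simp: pw.simps)
  qed
  have "ideal_prod R (loc (pw V B t)) (loc (pw V B 1)) = loc (pw V B (Suc t))"
  proof
    interpret J: ideal "loc (pw V B (Suc t))" R by (rule loc_ideal[OF up])
    show "ideal_prod R (loc (pw V B t)) (loc (pw V B 1)) \<subseteq> loc (pw V B (Suc t))"
    proof
      fix x assume "x \<in> ideal_prod R (loc (pw V B t)) (loc (pw V B 1))"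
      then show "x \<in> loc (pw V B (Suc t))"
      proof (induction x rule: ideal_prod.induct)
        case (prod i j)
        then obtain p s q r where x: "i = frac p s" "p \<in> polys (pw V B t)" "s \<in> S"
            "j = frac q r" "q \<in> polys (pw V B 1)" "r \<in> S" unfolding loc_def by blast
        have "p * q \<in> polys (pw V B (Suc t))" using x add_pw by (intro polys_mult[OF x(2,5)])
        moreover have "i \<otimes>\<^bsub>R\<^esub> j = frac (p * q) (s * r)"
          using x upclosed_polys_P[OF up] by (simp add: frac_mult)
        ultimately show ?case using x by (simp add: frac_in_locI)
      next
        case (sum s1 s2)
        then show ?case by simp
      qed
    qed
    show "loc (pw V B (Suc t)) \<subseteq> ideal_prod R (loc (pw V B t)) (loc (pw V B 1))"
    proof (rule loc_subsetI[OF up])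
      interpret J1: ideal "loc (pw V B t)" R by (rule loc_ideal[OF up])
      interpret J2: ideal "loc (pw V B 1)" R by (rule loc_ideal[OF up])
      show "\<zero>\<^bsub>R\<^esub> \<in> ideal_prod R (loc (pw V B t)) (loc (pw V B 1))"
        using ideal_prod.prod[OF J1.zero_closed J2.zero_closed, where R = R] by simp
      show "x \<oplus>\<^bsub>R\<^esub> y \<in> ideal_prod R (loc (pw V B t)) (loc (pw V B 1))"
        if "x \<in> ideal_prod R (loc (pw V B t)) (loc (pw V B 1))" "y \<in> ideal_prod R (loc (pw V B t)) (loc (pw V B 1))" for x y
        using that by (rule ideal_prod.sum)
      fix a c s assume "a \<in> pw V B (Suc t)" and s: "s \<in> S"
      then obtain b d where b: "a = b + d" "b \<in> B" "d \<in> pw V B t" by (auto simp: pw.simps)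
      have "b \<in> pw V B 1" by (rule generator_in_pw[OF b(2)])
      then have m: "frac (single b 1) 1 \<in> loc (pw V B 1)" "frac (single d c) s \<in> loc (pw V B t)"
        using b(3) s by (auto intro!: frac_in_locI single_in_polys)
      have "single d c \<in> P" "single b 1 \<in> P" using b B pw_expo[OF B] by (auto intro: single_in_polys)
      then have "frac (single d c) s \<otimes>\<^bsub>R\<^esub> frac (single b 1) 1 = frac (single a c) s"
        using s by (simp add: frac_mult mult_single b(1) add.commute)
      then show "frac (single a c) s \<in> ideal_prod R (loc (pw V B t)) (loc (pw V B 1))"
        using ideal_prod.prod[OF m(2,1), where R = R] by simp
    qed
  qed
  then show ?case using Suc.IH by (simp add: ideals_set_def nat_pow_def)
qed

definition vars :: "('v \<Rightarrow>\<^sub>0 nat) set" where "vars = (\<lambda>v. single v 1) ` V"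

lemma vars_expo: "vars \<subseteq> expo V" by (auto simp: vars_def)

lemma pw_vars: "pw V vars k = {a \<in> expo V. k \<le> tdeg a}"
  unfolding vars_def by (rule pw_singles)

lemma frac_unit:
  assumes "p \<in> S" "s \<in> S" shows "frac p s \<otimes>\<^bsub>R\<^esub> frac s p = \<one>\<^bsub>R\<^esub>"
  using assms by (simp add: frac_mult S_P frac_one frac_eq_iff polys_expo_mult mult.commute)

text \<open>A fraction whose numerator has a nonzero constant term is a unit, so every proper ideal
  lies in this one. The uniqueness that follows gives the definite description
  \<open>max_ideal\<close> its value.\<close>

lemma max_ideal_eq: "max_ideal R = loc (pw V vars 1)"
proof -
  have up: "upclosed V (pw V vars 1)" by (rule upclosed_pw[OF vars_expo])
  have mem: "p \<in> polys (pw V vars 1) \<longleftrightarrow> p \<notin> S" if "p \<in> P" for p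
    using that tdeg_eq_0_iff by (auto simp: pw_vars polys_def S_iff in_keys_iff Suc_le_eq neq0_conv[symmetric] simp del: neq0_conv)
  have sub: "J \<subseteq> loc (pw V vars 1)" if J: "ideal J R" "J \<noteq> carrier R" for J
  proof
    interpret J: ideal J R by fact
    fix x assume x: "x \<in> J"
    then obtain p s where ps: "p \<in> P" "s \<in> S" "x = frac p s" using J.Icarr carrierE by metis
    show "x \<in> loc (pw V vars 1)"
    proof (rule ccontr)
      assume "x \<notin> loc (pw V vars 1)"
      then have "p \<in> S" using frac_in_loc_iff[OF up ps(1,2)] mem ps by blast
      then have "\<one>\<^bsub>R\<^esub> \<in> J"
        using J.I_r_closed[of x "frac s p"] x ps frac_unit[of p s] S_P by auto
      then show False using J.one_imp_carrier J(2) by blast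
    qed
  qed
  have "\<one>\<^bsub>R\<^esub> \<notin> loc (pw V vars 1)" unfolding frac_one using mem[of 1] by (subst frac_in_loc_iff[OF up]) auto
  then have proper: "carrier R \<noteq> loc (pw V vars 1)" by auto
  have "maximalideal (loc (pw V vars 1)) R"
  proof (rule maximalidealI[OF loc_ideal[OF up] proper])
    fix J assume "ideal J R" "loc (pw V vars 1) \<subseteq> J"
    then show "J = loc (pw V vars 1) \<or> J = carrier R" using sub by blast
  qed
  moreover have "N = loc (pw V vars 1)" if N: "maximalideal N R" for N
  proof -
    interpret N: maximalideal N R by fact
    have "N \<subseteq> loc (pw V vars 1)" using sub[OF N.ideal_axioms] N.I_notcarr by blast
    then show ?thesis using N.I_maximal[OF loc_ideal[OF up]] proper ideal.Icarr[OF loc_ideal[OF up]] by blast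
  qed
  ultimately show ?thesis unfolding max_ideal_def by (rule the_equality)
qed

end

section \<open>Length of the zeroth local cohomology\<close>

text \<open>The submodule $T/I$ of $J/I$.\<close>

definition quot :: "('a, 'b) ring_scheme \<Rightarrow> 'a set \<Rightarrow> 'a set \<Rightarrow> 'a set \<Rightarrow> ('a, 'a set) module" where
  "quot R I J T = (quotient_module (ideal_module R J) I)\<lparr>carrier := (\<lambda>y. I +>\<^bsub>R\<^esub> y) ` T\<rparr>"

lemma ideal_module_coset: "I +>\<^bsub>ideal_module R J\<^esub> y = I +>\<^bsub>R\<^esub> y"
  by (simp add: a_r_coset_def r_coset_def ideal_module_def)

lemma ideal_module_set_add: "set_add (ideal_module R J) = set_add R"
  by (intro ext) (simp add: set_add_def set_mult_def ideal_module_def)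

section \<open>Quotients of ideals as modules\<close>

context cring
begin

context
  fixes I J :: "'a set"
  assumes I: "ideal I R"
begin

interpretation I: ideal I R by (rule I)

lemma coset_eq_iff: "x \<in> carrier R \<Longrightarrow> y \<in> carrier R \<Longrightarrow> I +> x = I +> y \<longleftrightarrow> x \<ominus> y \<in> I"
  using quotient_eq_iff_same_a_r_cos[OF I] by blast

lemma coset_self: "x \<in> carrier R \<Longrightarrow> x \<in> I +> x"
  by (rule I.a_rcos_self)

lemma coset_subset: "x \<in> carrier R \<Longrightarrow> I +> x \<subseteq> carrier R"
  by (rule a_r_coset_subset_G) auto

lemma coset_zero_iff: "x \<in> carrier R \<Longrightarrow> I +> x = I \<longleftrightarrow> x \<in> I"
  using coset_eq_iff[of x \<zero>] I.a_rcos_const[OF I.zero_closed] by (simp add: minus_eq)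

lemma quot_add:
  "x \<in> carrier R \<Longrightarrow> y \<in> carrier R \<Longrightarrow> (I +> x) \<oplus>\<^bsub>quot R I J T\<^esub> (I +> y) = I +> (x \<oplus> y)"
  by (simp add: quot_def quotient_module_def ideal_module_set_add I.a_rcos_sum)

lemma quot_zero: "\<zero>\<^bsub>quot R I J T\<^esub> = I"
  by (simp add: quot_def quotient_module_def)

lemma quot_smult:
  assumes "a \<in> carrier R" "x \<in> carrier R"
  shows "a \<odot>\<^bsub>quot R I J T\<^esub> (I +> x) = I +> (a \<otimes> x)"
proof -
  have "I +> (a \<otimes> y) = I +> (a \<otimes> x)" if y: "y \<in> I +> x" for y
  proof -
    have yc: "y \<in> carrier R" using coset_subset[OF assms(2)] y by blast
    obtain h where h: "h \<in> I" "y = h \<oplus> x" using y by (auto simp: a_r_coset_def')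
    then have "y \<ominus> x = h" using assms(2) by (simp add: minus_eq a_assoc r_neg)
    then have "y \<ominus> x \<in> I" using h(1) by simp
    then have "a \<otimes> (y \<ominus> x) \<in> I" using I.I_l_closed assms(1) by blast
    then have "a \<otimes> y \<ominus> a \<otimes> x \<in> I" using assms yc by (simp add: minus_eq r_distr r_minus)
    then show ?thesis using assms yc by (subst coset_eq_iff) auto
  qed
  moreover have "a \<odot>\<^bsub>quot R I J T\<^esub> (I +> x) = (\<Union>y\<in>I +> x. I +> (a \<otimes> y))"
    by (simp add: quot_def quotient_module_def ideal_module_coset) (simp add: ideal_module_def)
  moreover have "I +> x \<noteq> {}" using coset_self[OF assms(2)] by blast
  ultimately show ?thesis by (simp only:) (rule SUP_eq_const, simp_all)
qed

lemma quot_carrier: "carrier (quot R I J T) = (\<lambda>y. I +> y) ` T"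
  by (simp add: quot_def)

context
  fixes T :: "'a set"
  assumes T: "ideal T R" "I \<subseteq> T"
begin

interpretation T: ideal T R by (rule T)

lemma quot_module: "module R (quot R I J T)"
proof (intro moduleI abelian_groupI)
  show "cring R" by (rule cring_axioms)
next
  fix x assume "x \<in> carrier (quot R I J T)"
  then obtain y where y: "y \<in> T" "x = I +> y" by (auto simp: quot_carrier)
  then have "y \<in> carrier R" by simp
  then show "\<exists>z\<in>carrier (quot R I J T). z \<oplus>\<^bsub>quot R I J T\<^esub> x = \<zero>\<^bsub>quot R I J T\<^esub>"
    using y I.a_rcos_const[OF I.zero_closed]
    by (intro bexI[of _ "I +> (\<ominus> y)"]) (auto simp: quot_add quot_zero quot_carrier l_neg)
next
  show "\<zero>\<^bsub>quot R I J T\<^esub> \<in> carrier (quot R I J T)"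
    using I.a_rcos_const[OF I.zero_closed] T.zero_closed by (auto simp: quot_zero quot_carrier)
next
  fix x assume "x \<in> carrier (quot R I J T)"
  then obtain y where y: "y \<in> T" "x = I +> y" by (auto simp: quot_carrier)
  then have "y \<in> carrier R" by simp
  then show "\<zero>\<^bsub>quot R I J T\<^esub> \<oplus>\<^bsub>quot R I J T\<^esub> x = x"
    using y quot_add[of \<zero> y] I.a_rcos_const[OF I.zero_closed] by (simp add: quot_zero)
qed (auto simp: quot_carrier quot_add quot_smult T.I_l_closed T.a_closed T.Icarr l_distr r_distr a_ac m_assoc)

lemma quot_submodule:
  assumes L: "ideal L R" "I \<subseteq> L" "L \<subseteq> T"
  shows "submodule ((\<lambda>y. I +> y) ` L) R (quot R I J T)"
proof -
  interpret L: ideal L R by fact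
  interpret M: module R "quot R I J T" by (rule quot_module)
  show ?thesis
  proof (rule M.submoduleI)
    show "(\<lambda>y. I +> y) ` L \<subseteq> carrier (quot R I J T)" using L(3) by (auto simp: quot_carrier)
    show "\<zero>\<^bsub>quot R I J T\<^esub> \<in> (\<lambda>y. I +> y) ` L"
      using I.a_rcos_const[OF I.zero_closed] L.zero_closed by (force simp: quot_zero)
  next
    fix a assume "a \<in> (\<lambda>y. I +> y) ` L"
    then obtain y where y: "y \<in> L" "a = I +> y" by auto
    have mem: "I +> (\<ominus> y) \<in> carrier (quot R I J T)" "I +> y \<in> carrier (quot R I J T)"
      using y L(3) by (auto simp: quot_carrier intro!: imageI)
    have "(I +> (\<ominus> y)) \<oplus>\<^bsub>quot R I J T\<^esub> (I +> y) = \<zero>\<^bsub>quot R I J T\<^esub>"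
      using L.Icarr[OF y(1)] I.a_rcos_const[OF I.zero_closed] by (simp add: quot_add quot_zero l_neg)
    then have "\<ominus>\<^bsub>quot R I J T\<^esub> a = I +> (\<ominus> y)"
      unfolding y(2) using mem by (intro M.minus_equality)
    then show "\<ominus>\<^bsub>quot R I J T\<^esub> a \<in> (\<lambda>y. I +> y) ` L" using y(1) by auto
  qed (auto simp: quot_add quot_smult L.Icarr L.I_l_closed intro!: imageI)
qed

lemma submodule_preimage:
  assumes N: "submodule N R (quot R I J T)"
  defines "L \<equiv> {y \<in> T. I +> y \<in> N}"
  shows "ideal L R" "I \<subseteq> L" "L \<subseteq> T" "N = (\<lambda>y. I +> y) ` L"
proof -
  interpret M: module R "quot R I J T" by (rule quot_module)
  note N' = M.submoduleE[OF N]
  have zero: "I \<in> N" using submodule.axioms(1)[OF N, THEN subgroup.one_closed] by (simp add: quot_zero)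
  show "I \<subseteq> L" using T(2) zero by (auto simp: L_def I.a_rcos_const)
  show "L \<subseteq> T" by (auto simp: L_def)
  show "N = (\<lambda>y. I +> y) ` L" using N'(1) by (auto simp: L_def quot_carrier)
  show "ideal L R"
  proof (rule idealI[OF ring_axioms], rule add.subgroupI)
    show "L \<subseteq> carrier R" using \<open>L \<subseteq> T\<close> by auto
    show "L \<noteq> {}" using \<open>I \<subseteq> L\<close> I.zero_closed by blast
    have smult: "a \<otimes> y \<in> L" if "y \<in> L" "a \<in> carrier R" for a y
      using that N'(4)[of a "I +> y"] by (auto simp: L_def quot_smult T.Icarr T.I_l_closed)
    show "x \<otimes> a \<in> L" "a \<otimes> x \<in> L" if "a \<in> L" "x \<in> carrier R" for a x
      using smult[OF that] that \<open>L \<subseteq> carrier R\<close> by (auto simp: m_comm subset_iff)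
    show "\<ominus> a \<in> L" if "a \<in> L" for a
      using smult[OF that, of "\<ominus> \<one>"] that \<open>L \<subseteq> carrier R\<close> by (auto simp: l_minus subset_iff)
    show "a \<oplus> b \<in> L" if "a \<in> L" "b \<in> L" for a b
      using that N'(5)[of "I +> a" "I +> b"] by (auto simp: L_def quot_add T.Icarr)
  qed
qed

lemma coset_image_strict_mono:
  assumes "ideal L R" "I \<subseteq> L" "L \<subset> L'" "L' \<subseteq> T"
  shows "(\<lambda>y. I +> y) ` L \<subset> (\<lambda>y. I +> y) ` L'"
proof -
  interpret L: ideal L R by fact
  obtain y where y: "y \<in> L'" "y \<notin> L" using assms(3) by blast
  have yc: "y \<in> carrier R" using y assms(4) by auto
  have "I +> y \<noteq> I +> z" if z: "z \<in> L" for z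
  proof
    assume "I +> y = I +> z"
    then have "y \<in> I +> z" using coset_self[OF yc] by simp
    then obtain h where "h \<in> I" "y = h \<oplus> z" by (auto simp: a_r_coset_def')
    then show False using y(2) z assms(2) by auto
  qed
  then have "I +> y \<notin> (\<lambda>y. I +> y) ` L" by auto
  then show ?thesis using y(1) assms(3) by blast
qed

text \<open>The correspondence theorem: preimages of submodules and images of ideals translate
  strict chains into each other. From here on only ideals between \<open>I\<close> and
  \<open>T\<close> matter.\<close>

lemma module_length_quot:
  "module_length R (quot R I J T) = Sup {enat r | r. \<exists>L. (\<forall>i\<le>r. ideal (L i) R \<and> I \<subseteq> L i \<and> L i \<subseteq> T) \<and> (\<forall>i<r. L i \<subset> L (Suc i))}"
proof -
  have "(\<exists>N. (\<forall>i\<le>r. submodule (N i) R (quot R I J T)) \<and> (\<forall>i<r. N i \<subset> N (Suc i)))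
    \<longleftrightarrow> (\<exists>L. (\<forall>i\<le>r. ideal (L i) R \<and> I \<subseteq> L i \<and> L i \<subseteq> T) \<and> (\<forall>i<r. L i \<subset> L (Suc i)))" (is "?l \<longleftrightarrow> ?r") for r
  proof
    assume ?l
    then obtain N where N: "\<And>i. i \<le> r \<Longrightarrow> submodule (N i) R (quot R I J T)" "\<And>i. i < r \<Longrightarrow> N i \<subset> N (Suc i)" by blast
    define L where "L i = {y \<in> T. I +> y \<in> N i}" for i
    have L: "ideal (L i) R" "I \<subseteq> L i" "L i \<subseteq> T" "N i = (\<lambda>y. I +> y) ` L i" if "i \<le> r" for i
      unfolding L_def using submodule_preimage[OF N(1)[OF that]] by blast+
    have "L i \<subset> L (Suc i)" if "i < r" for i
    proof -
      have "L i \<subseteq> L (Suc i)" using N(2)[OF that] by (auto simp: L_def)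
      moreover have "L i \<noteq> L (Suc i)" using N(2)[OF that] L(4)[of i] L(4)[of "Suc i"] that by auto
      ultimately show ?thesis by blast
    qed
    then show ?r using L by (intro exI[of _ L]) auto
  next
    assume ?r
    then obtain L where L: "\<And>i. i \<le> r \<Longrightarrow> ideal (L i) R \<and> I \<subseteq> L i \<and> L i \<subseteq> T" "\<And>i. i < r \<Longrightarrow> L i \<subset> L (Suc i)" by blast
    have "submodule ((\<lambda>y. I +> y) ` L i) R (quot R I J T)" if "i \<le> r" for i
      using L(1)[OF that] by (intro quot_submodule) auto
    moreover have "(\<lambda>y. I +> y) ` L i \<subset> (\<lambda>y. I +> y) ` L (Suc i)" if "i < r" for i
      using L(1)[of i] L(1)[of "Suc i"] L(2)[OF that] that by (intro coset_image_strict_mono) auto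
    ultimately show ?l by (intro exI[of _ "\<lambda>i. (\<lambda>y. I +> y) ` L i"]) auto
  qed
  then show ?thesis by (simp add: module_length_def)
qed

end
end
end

section \<open>Chains of ideals between two monomial ideals\<close>

lemma ex_enumeration_by_degree:
  fixes deg :: "'a \<Rightarrow> nat"
  assumes "finite W"
  shows "\<exists>g. bij_betw g W {..<card W} \<and> (\<forall>a\<in>W. \<forall>b\<in>W. deg a < deg b \<longrightarrow> g b < g a)"
  using assms
proof (induction "card W" arbitrary: W)
  case 0
  then show ?case by (auto simp: bij_betw_def)
next
  case (Suc n)
  then have "W \<noteq> {}" by auto
  \<comment> \<open>An element of least degree receives the last number, so numbers decrease as
    degrees grow. In the application this makes every initial segment of \<open>T - U\<close>,
    together with \<open>U\<close>, closed under multiples.\<close>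
  define a where "a = arg_min_on deg W"
  have a: "a \<in> W" unfolding a_def using Suc \<open>W \<noteq> {}\<close> by (intro arg_min_if_finite) auto
  have least: "deg a \<le> deg b" if "b \<in> W" for b
    unfolding a_def using Suc \<open>W \<noteq> {}\<close> that by (intro arg_min_least) auto
  have n: "card (W - {a}) = n" "finite (W - {a})" using Suc a by (auto simp: card_Diff_singleton)
  obtain g where g: "bij_betw g (W - {a}) {..<n}" "\<forall>x\<in>W - {a}. \<forall>b\<in>W - {a}. deg x < deg b \<longrightarrow> g b < g x"
    using Suc.hyps(1)[of "W - {a}"] n by metis
  define h where "h = g(a := n)"
  have "bij_betw h (W - {a}) {..<n}"
    using g(1) by (rule bij_betw_cong[THEN iffD1, rotated]) (auto simp: h_def)
  then have "bij_betw h ((W - {a}) \<union> {a}) ({..<n} \<union> {n})"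
    by (rule bij_betw_combine) (auto simp: h_def bij_betw_def)
  then have "bij_betw h (insert a (W - {a})) (insert n {..<n})" by simp
  moreover have "insert a (W - {a}) = W" "insert n {..<n} = {..<card W}"
    using a Suc.hyps(2)[symmetric] by auto
  moreover have "h y < h x" if "x \<in> W" "y \<in> W" "deg x < deg y" for x y
  proof (cases "y = a")
    case True
    then show ?thesis using least[of x] that by simp
  next
    case False
    then have "g y < n" using g(1) that by (auto simp: bij_betw_def)
    then show ?thesis using False that g(2) by (auto simp: h_def)
  qed
  ultimately show ?case by (intro exI[of _ h]) auto
qed

lemma strict_chain_card:
  assumes "finite W" "\<And>i. i \<le> r \<Longrightarrow> E i \<subseteq> W" "\<And>i. i < r \<Longrightarrow> E i \<subset> E (Suc i)"
  shows "r \<le> card W"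
proof -
  have "i \<le> r \<Longrightarrow> i \<le> card (E i)" for i
  proof (induction i)
    case (Suc i)
    have "card (E i) < card (E (Suc i))"
      using Suc assms by (intro psubset_card_mono finite_subset[OF assms(2)]) auto
    then show ?case using Suc by simp
  qed simp
  from this[of r] show ?thesis using card_mono[OF assms(1), of "E r"] assms(2)[of r] by simp
qed

lemma lookup_single_times:
  fixes p :: "('v, 'k::field) mpol"
  shows "lookup (single d c * p) (d + a) = c * lookup p a"
proof (cases "c = 0")
  case False
  then have k: "keys (single d c) = {d}" by simp
  have "lookup (single d c * p) (d + a) = (\<Sum>e\<in>keys p. if e = a then c * lookup p a else 0)"
    unfolding lookup_times k by (auto intro!: sum.cong)
  then show ?thesis by (simp add: in_keys_iff)
qed simp

context node_localization
begin

text \<open>An ideal \<open>N\<close> between \<open>loc U\<close> and \<open>loc T\<close> is determined by its set \<open>E N\<close> of initial exponents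
  with respect to an enumeration of \<open>T - U\<close> in which proper multiples come first.\<close>

lemma ideal_chain_bound:
  assumes U: "upclosed V U" and T: "upclosed V T" "U \<subseteq> T" and fin: "finite (T - U)"
    and L: "\<And>i. i \<le> r \<Longrightarrow> ideal (L i) R \<and> loc U \<subseteq> L i \<and> L i \<subseteq> loc T"
    and strict: "\<And>i. i < r \<Longrightarrow> L i \<subset> L (Suc i)"
  shows "r \<le> card (T - U)"
proof -
  obtain g where g: "bij_betw g (T - U) {..<card (T - U)}"
    "\<forall>a\<in>T - U. \<forall>b\<in>T - U. tdeg a < tdeg b \<longrightarrow> g b < g a"
    using ex_enumeration_by_degree[OF fin] by blast
  define Jj where "Jj j = U \<union> {a \<in> T - U. g a < j}" for j
  have JT: "Jj j \<subseteq> T" for j using T(2) by (auto simp: Jj_def)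
  have polP: "p \<in> P" if "p \<in> polys (Jj j)" for p j
    using that upclosed_polys_P[OF T(1)] polys_mono[OF JT] by blast
  define E where "E N = {a \<in> T - U. \<exists>p s. s \<in> S \<and> frac p s \<in> N \<and> p \<in> polys (Jj (Suc (g a))) \<and> a \<in> keys p}" for N
  \<comment> \<open>Elimination as in a vector space with an ordered basis: when every initial
    exponent of \<open>N'\<close> also occurs for \<open>N\<close>, the last term of a numerator can
    be removed by a multiple of an element of \<open>N\<close>. Since \<open>N\<close> is contained
    in \<open>N'\<close>, the difference stays in \<open>N'\<close>, and the induction on the
    segment applies to it.\<close>
  have sub: "N' \<subseteq> N" if N: "ideal N R" "loc U \<subseteq> N" "N \<subseteq> loc T" and N': "ideal N' R" "N' \<subseteq> loc T"
    and E: "E N' \<subseteq> E N" and NN': "N \<subseteq> N'" for N N'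
  proof -
    interpret N: ideal N R by fact
    interpret N': ideal N' R by fact
    have key: "p \<in> polys (Jj j) \<Longrightarrow> s \<in> S \<Longrightarrow> frac p s \<in> N' \<Longrightarrow> frac p s \<in> N" for j p s
    proof (induction j arbitrary: p s)
      case 0
      then show ?case using N(2) by (auto simp: Jj_def intro: frac_in_locI)
    next
      case (Suc j)
      show ?case
      proof (cases "p \<in> polys (Jj j)")
        case True
        then show ?thesis using Suc by blast
      next
        case False
        then obtain a where a: "a \<in> keys p" "a \<notin> Jj j" by (auto simp: polys_def)
        then have aT: "a \<in> T - U" "g a = j" using Suc.prems(1) by (auto simp: polys_def Jj_def less_Suc_eq)
        then have "a \<in> E N'" unfolding E_def using Suc.prems a by blast
        then have "a \<in> E N" using E by blast
        then obtain q r where q: "r \<in> S" "frac q r \<in> N" "q \<in> polys (Jj (Suc j))" "a \<in> keys q"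
          unfolding E_def aT(2) using aT(2) by auto
        have uniq: "b = a" if "b \<in> Jj (Suc j) - Jj j" for b
        proof -
          have "b \<in> T - U" "g b = j" using that by (auto simp: Jj_def less_Suc_eq)
          then show ?thesis using g(1) aT by (auto simp: bij_betw_def inj_on_def)
        qed
        define c where "c = lookup p a / lookup q a"
        have pP: "p \<in> P" and qP: "q \<in> P" using polP Suc.prems(1) q(3) by auto
        have cP: "single 0 c \<in> P" by (rule single_in_polys) simp
        have cl: "lookup (single 0 c * q) b = c * lookup q b" for b
          using lookup_single_times[of 0 c q b] by simp
        have "p - single 0 c * q \<in> polys (Jj j)"
          unfolding polys_def
        proof (clarsimp simp: in_keys_iff lookup_minus cl)
          fix b assume nz: "lookup p b \<noteq> c * lookup q b"
          have "b \<noteq> a" using nz q(4) by (auto simp: c_def in_keys_iff)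
          moreover have "b \<in> keys p \<union> keys q" using nz by (auto simp: in_keys_iff)
          then have "b \<in> Jj (Suc j)" using Suc.prems(1) q(3) by (auto simp: polys_def)
          ultimately show "b \<in> Jj j" using uniq by blast
        qed
        then have d: "p + - (single 0 c * q) \<in> polys (Jj j)" by simp
        \<comment> \<open>The factor replaces the denominator \<open>r\<close> by \<open>s\<close>
          and scales the numerator by \<open>c\<close>, so that the subtraction takes place between
          numerators over the same denominator.\<close>
        have m: "frac (single 0 c * r) s \<otimes>\<^bsub>R\<^esub> frac q r \<in> N"
          using N.I_l_closed[OF q(2)] cP q(1) Suc.prems(2) by (simp add: polys_expo_mult S_P)
        have e: "frac (single 0 c * r) s \<otimes>\<^bsub>R\<^esub> frac q r = frac (single 0 c * q) s"
          using cP qP q(1) Suc.prems(2)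
          by (simp add: frac_mult polys_expo_mult S_P, subst frac_eq_iff) (simp_all add: polys_expo_mult S_P ac_simps)
        have cq: "single 0 c * q \<in> P" using cP qP by (rule polys_expo_mult)
        have "frac p s \<oplus>\<^bsub>R\<^esub> \<ominus>\<^bsub>R\<^esub> frac (single 0 c * q) s = frac (p + - (single 0 c * q)) s"
          using pP cq Suc.prems(2) by (simp add: frac_uminus frac_add_same polys_uminus)
        moreover have "frac p s \<oplus>\<^bsub>R\<^esub> \<ominus>\<^bsub>R\<^esub> frac (single 0 c * q) s \<in> N'"
          using Suc.prems(3) m NN' unfolding e by (intro N'.a_closed N'.a_inv_closed) auto
        ultimately have "frac (p + - (single 0 c * q)) s \<in> N" using Suc.IH[OF d Suc.prems(2)] by simp
        then have "frac (p + - (single 0 c * q)) s \<oplus>\<^bsub>R\<^esub> frac (single 0 c * q) s \<in> N"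
          using m unfolding e by (rule N.a_closed)
        also have "frac (p + - (single 0 c * q)) s \<oplus>\<^bsub>R\<^esub> frac (single 0 c * q) s = frac p s"
          using pP cq Suc.prems(2) by (subst frac_add_same) (auto intro: polys_add polys_uminus simp del: add_uminus_conv_diff)
        finally show ?thesis .
      qed
    qed
    have "Jj (card (T - U)) = T"
      using T(2) g(1) by (auto simp: Jj_def bij_betw_def)
    then show ?thesis using key[of _ "card (T - U)"] N'(2) by (auto simp: loc_def)
  qed
  show ?thesis
  proof (rule strict_chain_card[OF fin, of r "\<lambda>i. E (L i)"])
    show "E (L i) \<subseteq> T - U" for i by (auto simp: E_def)
    fix i assume i: "i < r"
    have "E (L i) \<subseteq> E (L (Suc i))" using strict[OF i] by (auto simp: E_def)
    moreover have "\<not> E (L (Suc i)) \<subseteq> E (L i)"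
      using sub[of "L i" "L (Suc i)"] L[of i] L[of "Suc i"] strict[OF i] i by auto
    ultimately show "E (L i) \<subset> E (L (Suc i))" by blast
  qed
qed

text \<open>The exponents of \<open>T - U\<close> are adjoined one at a time. A proper multiple has
  larger degree and hence a smaller number, so each intermediate set is up-closed; the monomial just
  added shows strictness.\<close>

lemma ideal_chain_exists:
  assumes U: "upclosed V U" and T: "upclosed V T" "U \<subseteq> T" and fin: "finite (T - U)"
  shows "\<exists>L. (\<forall>i\<le>card (T - U). ideal (L i) R \<and> loc U \<subseteq> L i \<and> L i \<subseteq> loc T) \<and> (\<forall>i<card (T - U). L i \<subset> L (Suc i))"
proof -
  obtain g where g: "bij_betw g (T - U) {..<card (T - U)}"
    "\<forall>a\<in>T - U. \<forall>b\<in>T - U. tdeg a < tdeg b \<longrightarrow> g b < g a"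
    using ex_enumeration_by_degree[OF fin] by blast
  define Jj where "Jj j = U \<union> {a \<in> T - U. g a < j}" for j
  have up: "upclosed V (Jj j)" for j
    unfolding upclosed_def
  proof (intro conjI ballI)
    show "Jj j \<subseteq> expo V" using U T by (auto simp: Jj_def upclosed_def)
    fix a d assume a: "a \<in> Jj j" and d: "d \<in> expo V"
    show "a + d \<in> Jj j"
    proof (cases "d = 0 \<or> a + d \<in> U")
      case True
      then show ?thesis using a by (auto simp: Jj_def)
    next
      case False
      then have "a \<notin> U" using U d by (auto simp: upclosed_def)
      then have a': "a \<in> T - U" "g a < j" using a by (auto simp: Jj_def)
      then have "a + d \<in> T - U" using False T(1) d by (auto simp: upclosed_def)
      moreover have "tdeg a < tdeg (a + d)" using False by (simp add: zero_less_iff_neq_zero)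
      ultimately have "g (a + d) < g a" using g(2) a'(1) by blast
      then show ?thesis using a'(2) \<open>a + d \<in> T - U\<close> by (simp add: Jj_def)
    qed
  qed
  have "loc (Jj i) \<subset> loc (Jj (Suc i))" if i: "i < card (T - U)" for i
  proof -
    obtain a where a: "a \<in> T - U" "g a = i" using g(1) i by (metis bij_betw_iff_bijections lessThan_iff)
    have "single a 1 \<in> P" using a T(1) by (intro single_in_polys) (auto simp: upclosed_def)
    moreover have "single a 1 \<in> polys (Jj (Suc i))" using a by (intro single_in_polys) (auto simp: Jj_def)
    moreover have "single a (1::'k) \<notin> polys (Jj i)" using a by (auto simp: polys_def Jj_def)
    ultimately have "frac (single a 1) 1 \<in> loc (Jj (Suc i))" "frac (single a 1) 1 \<notin> loc (Jj i)"
      using frac_in_loc_iff[OF up] by auto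
    moreover have "loc (Jj i) \<subseteq> loc (Jj (Suc i))" by (rule loc_mono) (auto simp: Jj_def)
    ultimately show ?thesis by blast
  qed
  moreover have "loc U \<subseteq> loc (Jj i)" "loc (Jj i) \<subseteq> loc T" for i
    using T(2) by (auto intro!: loc_mono simp: Jj_def)
  ultimately show ?thesis using loc_ideal[OF up] by (intro exI[of _ "\<lambda>i. loc (Jj i)"]) auto
qed

lemma module_length_loc:
  assumes U: "upclosed V U" and T: "upclosed V T" "U \<subseteq> T" and fin: "finite (T - U)"
  shows "module_length R (quot R (loc U) J (loc T)) = enat (card (T - U))"
proof -
  have "module_length R (quot R (loc U) J (loc T)) = Sup {enat r | r.
    \<exists>L. (\<forall>i\<le>r. ideal (L i) R \<and> loc U \<subseteq> L i \<and> L i \<subseteq> loc T) \<and> (\<forall>i<r. L i \<subset> L (Suc i))}"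
    by (rule R.module_length_quot[OF loc_ideal[OF U] loc_ideal[OF T(1)] loc_mono[OF T(2)]])
  also have "\<dots> = enat (card (T - U))"
  proof (rule antisym)
    show "Sup {enat r | r. \<exists>L. (\<forall>i\<le>r. ideal (L i) R \<and> loc U \<subseteq> L i \<and> L i \<subseteq> loc T) \<and> (\<forall>i<r. L i \<subset> L (Suc i))} \<le> enat (card (T - U))"
    proof (rule Sup_least)
      fix x assume "x \<in> {enat r | r. \<exists>L. (\<forall>i\<le>r. ideal (L i) R \<and> loc U \<subseteq> L i \<and> L i \<subseteq> loc T) \<and> (\<forall>i<r. L i \<subset> L (Suc i))}"
      then obtain r L where x: "x = enat r" and L: "\<forall>i\<le>r. ideal (L i) R \<and> loc U \<subseteq> L i \<and> L i \<subseteq> loc T"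
          "\<forall>i<r. L i \<subset> L (Suc i)" by blast
      have "r \<le> card (T - U)" by (rule ideal_chain_bound[OF assms, of r L]) (use L in simp_all)
      then show "x \<le> enat (card (T - U))" using x by simp
    qed
    show "enat (card (T - U)) \<le> Sup {enat r | r. \<exists>L. (\<forall>i\<le>r. ideal (L i) R \<and> loc U \<subseteq> L i \<and> L i \<subseteq> loc T) \<and> (\<forall>i<r. L i \<subset> L (Suc i))}"
      using ideal_chain_exists[OF assms] by (intro Sup_upper) blast
  qed
  finally show ?thesis .
qed

section \<open>Monomial description of the local cohomology\<close>

lemma satur_iff:
  assumes B: "B \<subseteq> expo V" and a: "a \<in> expo V"
  shows "satur V B t a \<longleftrightarrow> (\<exists>k. \<forall>d\<in>expo V. k \<le> tdeg d \<longrightarrow> a + d \<in> pw V B (Suc t))"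
proof
  assume "satur V B t a"
  then have "\<forall>i\<in>V. \<exists>N. a + single i N \<in> pw V B (Suc t)" by (simp add: satur_def)
  from bchoice[OF this] obtain N where N: "\<forall>i\<in>V. a + single i (N i) \<in> pw V B (Suc t)" ..
  \<comment> \<open>Pigeonhole: a degree above the sum of the \<open>N i\<close> forces some
    coordinate of \<open>d\<close> above its \<open>N i\<close>.\<close>
  have "a + d \<in> pw V B (Suc t)" if d: "d \<in> expo V" "Suc (\<Sum>i\<in>V. N i) \<le> tdeg d" for d
  proof -
    have "\<exists>i\<in>V. N i < lookup d i"
    proof (rule ccontr)
      assume "\<not> ?thesis"
      then have "(\<Sum>i\<in>V. lookup d i) \<le> (\<Sum>i\<in>V. N i)" by (intro sum_mono) auto
      then show False using d tdeg_eq[OF finite_V d(1)] by simp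
    qed
    then obtain i where i: "i \<in> V" "N i < lookup d i" by blast
    then have "\<exists>e. d = single i (N i) + e" unfolding ex_add_iff by (auto simp: lookup_single when_def)
    then obtain e where e: "d = single i (N i) + e" ..
    have "e \<in> expo V" using d(1) e by simp
    then have "(a + single i (N i)) + e \<in> pw V B (Suc t)"
      using pw_add[OF B, of "a + single i (N i)" "Suc t" e] N i(1) by simp
    then show ?thesis by (simp add: e add.assoc)
  qed
  then show "\<exists>k. \<forall>d\<in>expo V. k \<le> tdeg d \<longrightarrow> a + d \<in> pw V B (Suc t)" by blast
next
  assume "\<exists>k. \<forall>d\<in>expo V. k \<le> tdeg d \<longrightarrow> a + d \<in> pw V B (Suc t)"
  then obtain k where "\<forall>d\<in>expo V. k \<le> tdeg d \<longrightarrow> a + d \<in> pw V B (Suc t)" ..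
  then show "satur V B t a" by (auto simp: satur_def intro!: exI[of _ k])
qed

text \<open>The exponents of the ideal whose quotient by the next power is the local
  cohomology.\<close>

definition satpw where "satpw B t = {a \<in> pw V B t. satur V B t a}"

lemma satpw_props:
  assumes B: "B \<subseteq> expo V"
  shows "upclosed V (satpw B t)" "pw V B (Suc t) \<subseteq> satpw B t" "satpw B t - pw V B (Suc t) = jmon V B t"
proof -
  show "upclosed V (satpw B t)"
    unfolding upclosed_def
  proof (intro conjI ballI)
    show "satpw B t \<subseteq> expo V" using pw_expo[OF B] by (auto simp: satpw_def)
    fix a d assume a: "a \<in> satpw B t" and d: "d \<in> expo V"
    have "\<exists>N. a + d + single i N \<in> pw V B (Suc t)" if i: "i \<in> V" for i
    proof -
      obtain N where "a + single i N \<in> pw V B (Suc t)" using a i by (auto simp: satpw_def satur_def)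
      from pw_add[OF B this d] show ?thesis by (auto simp: ac_simps intro: exI[of _ N])
    qed
    then show "a + d \<in> satpw B t" using a pw_add[OF B _ d] by (auto simp: satpw_def satur_def)
  qed
  show "pw V B (Suc t) \<subseteq> satpw B t"
  proof
    fix a assume a: "a \<in> pw V B (Suc t)"
    have "a + single i 0 \<in> pw V B (Suc t)" for i using a by simp
    then show "a \<in> satpw B t" using a pw_Suc_subset[OF B, of t] unfolding satpw_def satur_def by blast
  qed
  show "satpw B t - pw V B (Suc t) = jmon V B t" by (auto simp: satpw_def jmon_def)
qed

text \<open>Modulo a monomial ideal, an element is killed by a power of the maximal ideal exactly if
  each of its monomials is. The torsion elements are therefore the cosets of a monomial ideal
  again.\<close>

lemma local_cohomology_eq_quot:
  assumes B: "B \<subseteq> expo V"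
  shows "local_cohomology0 R (max_ideal R) (quotient_module (ideal_module R (loc (pw V B t))) (loc (pw V B (Suc t))))
    = quot R (loc (pw V B (Suc t))) (loc (pw V B t)) (loc (satpw B t))"
proof -
  let ?I = "loc (pw V B (Suc t))" and ?J = "loc (pw V B t)"
  let ?M = "quotient_module (ideal_module R ?J) ?I"
  have up: "upclosed V (pw V B t)" for t by (rule upclosed_pw[OF B])
  have I: "ideal ?I R" and J: "ideal ?J R" by (rule loc_ideal[OF up])+
  interpret I: ideal ?I R by (rule I)
  interpret J: ideal ?J R by (rule J)
  have M: "?M = quot R ?I ?J ?J"
  proof -
    have "a_rcosets\<^bsub>ideal_module R ?J\<^esub> ?I = (\<lambda>y. ?I +>\<^bsub>R\<^esub> y) ` ?J"
      unfolding A_RCOSETS_def' ideal_module_coset by (auto simp: ideal_module_def)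
    then show ?thesis by (simp add: quot_def quotient_module_def)
  qed
  have mp: "ideal_power R (max_ideal R) k = loc (pw V vars k)" for k
    unfolding max_ideal_eq by (rule ideal_power_loc[OF vars_expo])
  have main: "(\<exists>k. \<forall>a\<in>ideal_power R (max_ideal R) k. a \<odot>\<^bsub>quot R ?I ?J ?J\<^esub> (?I +>\<^bsub>R\<^esub> y) = \<zero>\<^bsub>quot R ?I ?J ?J\<^esub>)
      \<longleftrightarrow> y \<in> loc (satpw B t)" if y: "y \<in> ?J" for y
  proof -
    obtain p s where ps: "y = frac p s" "p \<in> polys (pw V B t)" "s \<in> S" using y by (auto simp: loc_def)
    have pP: "p \<in> P" by (rule upclosed_polys_P[OF up ps(2)])
    have yR: "y \<in> carrier R" using y by simp
    have act: "a \<odot>\<^bsub>quot R ?I ?J ?J\<^esub> (?I +>\<^bsub>R\<^esub> y) = \<zero>\<^bsub>quot R ?I ?J ?J\<^esub> \<longleftrightarrow> a \<otimes>\<^bsub>R\<^esub> y \<in> ?I" if "a \<in> carrier R" for a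
      using that yR R.quot_smult[OF I that yR] R.quot_zero[OF I] R.coset_zero_iff[OF I] by simp
    have upv: "upclosed V (pw V vars k)" for k by (rule upclosed_pw[OF vars_expo])
    have power_carrier: "a \<in> carrier R" if "a \<in> loc (pw V vars k)" for a k
      using ideal.Icarr[OF loc_ideal[OF upv] that] .
    have frac_mem: "frac q r \<otimes>\<^bsub>R\<^esub> y \<in> ?I \<longleftrightarrow> q * p \<in> polys (pw V B (Suc t))" if "q \<in> P" "r \<in> S" for q r
      using that ps(3) pP frac_in_loc_iff[OF up, of "q * p" "r * s" "Suc t"] by (simp add: ps(1) frac_mult polys_expo_mult)
    show ?thesis
    proof
      assume "\<exists>k. \<forall>a\<in>ideal_power R (max_ideal R) k. a \<odot>\<^bsub>quot R ?I ?J ?J\<^esub> (?I +>\<^bsub>R\<^esub> y) = \<zero>\<^bsub>quot R ?I ?J ?J\<^esub>"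
      then obtain k where k: "\<And>a. a \<in> loc (pw V vars k) \<Longrightarrow> a \<otimes>\<^bsub>R\<^esub> y \<in> ?I"
        unfolding mp using act power_carrier by blast
      have "a + d \<in> pw V B (Suc t)" if a: "a \<in> keys p" and d: "d \<in> expo V" "k \<le> tdeg d" for a d
      proof -
        have "frac (single d 1) 1 \<in> loc (pw V vars k)"
          using d by (intro frac_in_locI single_in_polys) (auto simp: pw_vars)
        then have "single d 1 * p \<in> polys (pw V B (Suc t))"
          using k frac_mem[of "single d 1" 1] d(1) by (simp add: single_in_polys)
        \<comment> \<open>Multiplication by a monomial shifts exponents injectively, so no
          cancellation can hide the term that comes from \<open>a\<close>.\<close>
        moreover have "lookup (single d 1 * p) (a + d) = lookup p a"
          using lookup_single_times[of d 1 p a] by (simp add: add.commute)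
        ultimately show ?thesis using a by (auto simp: polys_def in_keys_iff)
      qed
      then have "satur V B t a" if "a \<in> keys p" for a
        using that satur_iff[OF B, of a t] pP by (auto simp: polys_def)
      then show "y \<in> loc (satpw B t)"
        unfolding ps(1) using ps(2,3) by (intro frac_in_locI) (auto simp: polys_def satpw_def)
    next
      assume "y \<in> loc (satpw B t)"
      then have p: "p \<in> polys (satpw B t)"
        using frac_in_loc_iff[OF satpw_props(1)[OF B] pP ps(3)] ps(1) by simp
      have "\<forall>a\<in>keys p. \<exists>k. \<forall>d\<in>expo V. k \<le> tdeg d \<longrightarrow> a + d \<in> pw V B (Suc t)"
        using p pP satur_iff[OF B] by (auto simp: polys_def satpw_def)
      from bchoice[OF this] obtain k where k: "\<forall>a\<in>keys p. \<forall>d\<in>expo V. k a \<le> tdeg d \<longrightarrow> a + d \<in> pw V B (Suc t)" ..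
      \<comment> \<open>The numerator has finitely many terms, so one power of the maximal ideal
        serves all of them.\<close>
      define m where "m = (\<Sum>a\<in>keys p. k a)"
      have m: "k a \<le> m" if "a \<in> keys p" for a unfolding m_def using that by (intro member_le_sum) auto
      have "a \<otimes>\<^bsub>R\<^esub> y \<in> ?I" if a: "a \<in> loc (pw V vars m)" for a
      proof -
        obtain q r where q: "a = frac q r" "q \<in> polys (pw V vars m)" "r \<in> S" using a by (auto simp: loc_def)
        have "q * p \<in> polys (pw V B (Suc t))"
        proof (rule polys_mult[OF q(2), of p "keys p"])
          show "p \<in> polys (keys p)" by (simp add: polys_def)
          fix d b assume "d \<in> pw V vars m" "b \<in> keys p"
          then show "d + b \<in> pw V B (Suc t)" using k m[of b] by (auto simp: pw_vars add.commute)
        qed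
        then show ?thesis unfolding q(1) using frac_mem q upclosed_polys_P[OF upv] by simp
      qed
      then show "\<exists>k. \<forall>a\<in>ideal_power R (max_ideal R) k. a \<odot>\<^bsub>quot R ?I ?J ?J\<^esub> (?I +>\<^bsub>R\<^esub> y) = \<zero>\<^bsub>quot R ?I ?J ?J\<^esub>"
        unfolding mp using act power_carrier by blast
    qed
  qed
  have sub: "loc (satpw B t) \<subseteq> ?J" by (rule loc_mono) (auto simp: satpw_def)
  have "{x \<in> carrier (quot R ?I ?J ?J). \<exists>k. \<forall>a\<in>ideal_power R (max_ideal R) k. a \<odot>\<^bsub>quot R ?I ?J ?J\<^esub> x = \<zero>\<^bsub>quot R ?I ?J ?J\<^esub>}
      = (\<lambda>y. ?I +>\<^bsub>R\<^esub> y) ` loc (satpw B t)"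
    unfolding R.quot_carrier[OF I] using main sub by blast
  then show ?thesis unfolding local_cohomology0_def M by (simp add: quot_def)
qed

lemma length_local_cohomology:
  assumes B: "finite B" "B \<subseteq> expo V"
  shows "module_length R (local_cohomology0 R (max_ideal R)
      (quotient_module (ideal_module R (ideal_power R (loc (pw V B 1)) t)) (ideal_power R (loc (pw V B 1)) (Suc t))))
    = enat (card (jmon V B t))"
  unfolding ideal_power_loc[OF B(2)] local_cohomology_eq_quot[OF B(2)]
  using module_length_loc[OF upclosed_pw[OF B(2)] satpw_props(1,2)[OF B(2)], of t]
    finite_jmon[OF finite_V B, of t]
  by (simp add: satpw_props(3)[OF B(2)])

end

section \<open>Krull dimension\<close>

text \<open>Gaussian elimination: an unknown \<open>i0\<close> with nonzero coefficient in equation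
  \<open>j\<close> is eliminated, which leaves one unknown and one equation fewer.\<close>

lemma ex_linear_dependency:
  fixes M :: "'i \<Rightarrow> 'j \<Rightarrow> 'k::field"
  assumes "finite J" "finite I" "card J < card I"
  shows "\<exists>c. (\<exists>i\<in>I. c i \<noteq> 0) \<and> (\<forall>j\<in>J. (\<Sum>i\<in>I. c i * M i j) = 0)"
  using assms
proof (induction J arbitrary: I M rule: finite_induct)
  case empty
  then have "I \<noteq> {}" by auto
  then show ?case by (intro exI[of _ "\<lambda>_. 1"]) auto
next
  case (insert j J)
  show ?case
  proof (cases "\<forall>i\<in>I. M i j = 0")
    case True
    have "card J < card I" using insert by simp
    then obtain c where "\<exists>i\<in>I. c i \<noteq> 0" "\<forall>j\<in>J. (\<Sum>i\<in>I. c i * M i j) = 0"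
      using insert.IH[OF insert.prems(1), of M] by blast
    then show ?thesis using True by (intro exI[of _ c]) simp
  next
    case False
    then obtain i0 where i0: "i0 \<in> I" "M i0 j \<noteq> 0" by blast
    define I' where "I' = I - {i0}"
    have I': "finite I'" "i0 \<notin> I'" "I = insert i0 I'" "card J < card I'"
      using insert i0 by (auto simp: I'_def card_Diff_singleton)
    obtain c where c: "\<exists>i\<in>I'. c i \<noteq> 0"
      "\<forall>k\<in>J. (\<Sum>i\<in>I'. c i * (M i k - M i j / M i0 j * M i0 k)) = 0"
      using insert.IH[OF I'(1,4), of "\<lambda>i k. M i k - M i j / M i0 j * M i0 k"] by blast
    \<comment> \<open>The value at \<open>i0\<close> is the one that makes equation \<open>j\<close>
      hold.\<close>
    define d where "d = c(i0 := - (\<Sum>i\<in>I'. c i * M i j) / M i0 j)"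
    have dI': "(\<Sum>i\<in>I'. d i * f i) = (\<Sum>i\<in>I'. c i * f i)" for f
      using I'(2) by (intro sum.cong refl) (auto simp: d_def)
    have dI: "(\<Sum>i\<in>I. d i * f i) = - (\<Sum>i\<in>I'. c i * M i j) / M i0 j * f i0 + (\<Sum>i\<in>I'. c i * f i)" for f
      using I' dI'[of f] by (simp add: d_def)
    have "(\<Sum>i\<in>I. d i * M i k) = 0" if k: "k \<in> insert j J" for k
    proof (cases "k = j")
      case True
      then show ?thesis using i0(2) by (simp add: dI)
    next
      case False
      then have "(\<Sum>i\<in>I'. c i * M i k) - (\<Sum>i\<in>I'. c i * M i j) / M i0 j * M i0 k = 0"
        using c(2) k by (simp add: right_diff_distrib sum_subtractf sum_divide_distrib sum_distrib_right mult.assoc)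
      then show ?thesis by (simp add: dI)
    qed
    moreover have "\<exists>i\<in>I. d i \<noteq> 0" using c(1) I' by (auto simp: d_def)
    ultimately show ?thesis by blast
  qed
qed

section \<open>Monomial primes and the lower bound for the dimension\<close>

context node_localization
begin

text \<open>The exponent set of the ideal generated by the variables in \<open>U\<close>.\<close>

definition involving :: "'v set \<Rightarrow> ('v \<Rightarrow>\<^sub>0 nat) set" where
  "involving U = {a \<in> expo V. \<exists>v\<in>U. lookup a v \<noteq> 0}"

lemma upclosed_involving: "upclosed V (involving U)"
  by (auto simp: upclosed_def involving_def lookup_add)

text \<open>A leading term argument with the least exponents \<open>a\<close> of \<open>p\<close>
  and \<open>b\<close> of \<open>q\<close> outside the ideal. Any pair of exponents with sum
  \<open>a + b\<close> also avoids the ideal, so minimality for a translation-invariant order leaves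
  only the pair \<open>a\<close>, \<open>b\<close>, and the coefficient at \<open>a + b\<close> does
  not cancel.\<close>

lemma polys_involving_prime:
  fixes p q :: "('v, 'k) mpol"
  assumes p: "p \<in> P" "p \<notin> polys (involving U)" and q: "q \<in> P" "q \<notin> polys (involving U)"
  shows "p * q \<notin> polys (involving U)"
proof
  assume pq: "p * q \<in> polys (involving U)"
  obtain \<phi> :: "('v \<Rightarrow>\<^sub>0 nat) \<Rightarrow> (nat \<Rightarrow>\<^sub>0 nat)"
    where \<phi>: "\<And>a b. \<phi> (a + b) = \<phi> a + \<phi> b" "inj_on \<phi> (expo V)"
    using additive_order_embedding[OF finite_V] by blast
  have least: "\<exists>a\<in>keys p - involving U. \<forall>c\<in>keys p - involving U. \<phi> a \<le> \<phi> c"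
    if "p \<notin> polys (involving U)" for p :: "('v, 'k) mpol"
  proof -
    have ne: "keys p - involving U \<noteq> {}" using that by (auto simp: polys_def)
    then have "Min (\<phi> ` (keys p - involving U)) \<in> \<phi> ` (keys p - involving U)" by (intro Min_in) auto
    then obtain a where "a \<in> keys p - involving U" "Min (\<phi> ` (keys p - involving U)) = \<phi> a" by auto
    then show ?thesis by (metis Min_le finite_Diff finite_imageI finite_keys imageI)
  qed
  obtain a where a: "a \<in> keys p - involving U" "\<And>c. c \<in> keys p - involving U \<Longrightarrow> \<phi> a \<le> \<phi> c"
    using least[OF p(2)] by blast
  obtain b where b: "b \<in> keys q - involving U" "\<And>c. c \<in> keys q - involving U \<Longrightarrow> \<phi> b \<le> \<phi> c"
    using least[OF q(2)] by blast
  have ab: "a \<in> expo V" "b \<in> expo V" using a(1) b(1) p(1) q(1) by (auto simp: polys_def)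
  have notin: "a + b \<notin> involving U" using a(1) b(1) ab by (auto simp: involving_def lookup_add)
  have uniq: "c = a \<and> d = b" if cd: "c \<in> keys p" "d \<in> keys q" "c + d = a + b" for c d
  proof -
    have e: "c \<in> expo V" "d \<in> expo V" using cd(1,2) p(1) q(1) by (auto simp: polys_def)
    have "c \<notin> involving U" "d \<notin> involving U"
      using upclosed_involving[of U] notin e unfolding cd(3)[symmetric] upclosed_def by (metis add.commute)+
    then have le: "\<phi> a \<le> \<phi> c" "\<phi> b \<le> \<phi> d" using a(2) b(2) cd by auto
    have "\<phi> c + \<phi> d = \<phi> a + \<phi> b" using arg_cong[OF cd(3), of \<phi>] by (simp add: \<phi>(1))
    then have "\<phi> c = \<phi> a" using le by (metis add_less_le_mono nless_le)
    then have "c = a" using \<phi>(2) e(1) ab(1) by (auto simp: inj_on_def)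
    then show ?thesis using cd(3) by simp
  qed
  have "lookup (p * q) (a + b) = (\<Sum>c\<in>keys p. \<Sum>d\<in>keys q. if c = a then (if d = b then lookup p a * lookup q b else 0) else 0)"
    unfolding lookup_times using uniq by (intro sum.cong refl) auto
  also have "\<dots> = (\<Sum>c\<in>keys p. if c = a then (\<Sum>d\<in>keys q. if d = b then lookup p a * lookup q b else 0) else 0)"
    by (intro sum.cong refl) auto
  also have "\<dots> = lookup p a * lookup q b" using a(1) b(1) by simp
  finally have "a + b \<in> keys (p * q)" using a(1) b(1) by (simp add: in_keys_iff)
  then show False using pq notin by (auto simp: polys_def)
qed

lemma loc_involving_prime: "primeideal (loc (involving U)) R"
proof (rule primeidealI[OF loc_ideal[OF upclosed_involving] R.is_cring])
  have "frac 1 1 \<notin> loc (involving U)"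
    by (subst frac_in_loc_iff[OF upclosed_involving]) (auto simp: polys_def involving_def)
  then show "carrier R \<noteq> loc (involving U)" by (metis frac_closed one_in_polys S_one)
  fix x y assume "x \<in> carrier R" "y \<in> carrier R" and xy: "x \<otimes>\<^bsub>R\<^esub> y \<in> loc (involving U)"
  then obtain p s q t where x: "p \<in> P" "s \<in> S" "x = frac p s" "q \<in> P" "t \<in> S" "y = frac q t"
    by (metis carrierE)
  then have "p * q \<in> polys (involving U)"
    using xy frac_in_loc_iff[OF upclosed_involving, of "p * q" "s * t"] by (simp add: frac_mult polys_expo_mult)
  then have "p \<in> polys (involving U) \<or> q \<in> polys (involving U)"
    using polys_involving_prime x by blast
  then show "x \<in> loc (involving U) \<or> y \<in> loc (involving U)"
    using x by (auto intro: frac_in_locI)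
qed

lemma prime_chain_exists:
  "\<exists>Q. (\<forall>i\<le>card V. primeideal (Q i) R) \<and> (\<forall>i<card V. Q i \<subset> Q (Suc i))"
proof -
  obtain h where h: "bij_betw h {..<card V} V"
    using ex_bij_betw_nat_finite[OF finite_V] by (auto simp: atLeast0LessThan)
  \<comment> \<open>The chain starts at \<open>i = 0\<close> with the zero ideal and adjoins one
    variable at each step.\<close>
  define Q where "Q i = loc (involving (h ` {..<i}))" for i
  have "Q i \<subset> Q (Suc i)" if i: "i < card V" for i
  proof -
    have hi: "h i \<in> V" using h i by (auto simp: bij_betw_def)
    have "h i \<noteq> h x" if "x < i" for x
      using h i that inj_onD[of h "{..<card V}" i x] by (auto simp: bij_betw_def)
    then have hi': "h i \<notin> h ` {..<i}" by auto
    note hi = hi hi'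
    have "frac (single (single (h i) 1) 1) 1 \<in> Q (Suc i)"
      unfolding Q_def using hi by (intro frac_in_locI single_in_polys) (auto simp: involving_def intro!: bexI[of _ i])
    moreover have "single (single (h i) 1) (1::'k) \<notin> polys (involving (h ` {..<i}))"
      using hi by (auto simp: polys_def involving_def lookup_single when_def split: if_splits)
    then have "frac (single (single (h i) 1) 1) 1 \<notin> Q i"
      unfolding Q_def using hi by (subst frac_in_loc_iff[OF upclosed_involving]) (auto intro!: single_in_polys)
    moreover have "Q i \<subseteq> Q (Suc i)" unfolding Q_def by (rule loc_mono) (auto simp: involving_def)
    ultimately show ?thesis by blast
  qed
  then show ?thesis using loc_involving_prime by (intro exI[of _ Q]) (auto simp: Q_def)
qed

section \<open>Upper bound for the dimension by counting monomials of bounded degree\<close>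

definition bounded_deg :: "nat \<Rightarrow> ('v \<Rightarrow>\<^sub>0 nat) set" where
  "bounded_deg d = {a \<in> expo V. tdeg a \<le> d}"

text \<open>A crude box count; for the comparison with longer chains only the exponent
  \<open>card V\<close> matters.\<close>

lemma card_bounded_deg: "finite (bounded_deg d)" "card (bounded_deg d) \<le> (d + 1) ^ card V"
proof -
  let ?f = "\<lambda>a. restrict (lookup a) V"
  have sub: "?f ` bounded_deg d \<subseteq> PiE V (\<lambda>_. {..d})"
    using lookup_le_tdeg order_trans by (fastforce simp: bounded_deg_def)
  have inj: "inj_on ?f (bounded_deg d)"
  proof (rule inj_onI)
    fix a b assume ab: "a \<in> bounded_deg d" "b \<in> bounded_deg d" "?f a = ?f b"
    have "lookup a i = lookup b i" for i
      using ab(1,2) lookup_outside[of _ V i] fun_cong[OF ab(3), of i] by (cases "i \<in> V") (simp_all add: bounded_deg_def)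
    then show "a = b" by (rule poly_mapping_eqI)
  qed
  have fin: "finite (PiE V (\<lambda>_. {..d}))" using finite_V by (intro finite_PiE) auto
  show "finite (bounded_deg d)" using finite_imageD[OF finite_subset[OF sub fin] inj] .
  have "card (bounded_deg d) \<le> card (PiE V (\<lambda>_. {..d}))" by (rule card_inj_on_le[OF inj sub fin])
  also have "\<dots> = (d + 1) ^ card V" using finite_V by (simp add: card_PiE)
  finally show "card (bounded_deg d) \<le> (d + 1) ^ card V" .
qed

lemma bounded_deg_mult:
  "p \<in> polys (bounded_deg c) \<Longrightarrow> q \<in> polys (bounded_deg d) \<Longrightarrow> p * q \<in> polys (bounded_deg (c + d))"
  by (rule polys_mult) (auto simp: bounded_deg_def)

lemma bounded_deg_power: "p \<in> polys (bounded_deg c) \<Longrightarrow> p ^ n \<in> polys (bounded_deg (n * c))"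
proof (induction n)
  case 0
  show ?case by (simp add: polys_def bounded_deg_def)
next
  case (Suc n)
  then show ?case using bounded_deg_mult[of p c "p ^ n" "n * c"] by simp
qed

lemma bounded_deg_prod:
  fixes r :: nat
  assumes "\<And>i. i < r \<Longrightarrow> p i \<in> polys (bounded_deg c)"
  shows "(\<Prod>i<r. p i) \<in> polys (bounded_deg (r * c))"
  using assms
proof (induction r)
  case 0
  show ?case by (simp add: polys_def bounded_deg_def)
next
  case (Suc r)
  then show ?case using bounded_deg_mult[of "\<Prod>i<r. p i" "r * c" "p r" c] by (simp add: add.commute)
qed

lemma P_sum: "(\<And>x. x \<in> F \<Longrightarrow> g x \<in> P) \<Longrightarrow> sum g F \<in> P"
  by (induction F rule: infinite_finite_induct) (auto intro: polys_add)

lemma P_power: "p \<in> P \<Longrightarrow> p ^ n \<in> P"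
  by (induction n) (auto intro: polys_expo_mult)

lemma P_prod: "(\<And>x. x \<in> F \<Longrightarrow> g x \<in> P) \<Longrightarrow> prod g F \<in> P"
  by (induction F rule: infinite_finite_induct) (auto intro: polys_expo_mult)

lemma P_const: "single 0 c \<in> P"
  by (rule single_in_polys) simp

context
  fixes r :: nat and Q :: "nat \<Rightarrow> ('v, 'k) mpol set" and f :: "nat \<Rightarrow> ('v, 'k) mpol"
  assumes Q_zero: "\<And>i. i \<le> r \<Longrightarrow> 0 \<in> Q i"
    and Q_add: "\<And>i p q. i \<le> r \<Longrightarrow> p \<in> Q i \<Longrightarrow> q \<in> Q i \<Longrightarrow> p + q \<in> Q i"
    and Q_mult: "\<And>i p q. i \<le> r \<Longrightarrow> p \<in> P \<Longrightarrow> q \<in> Q i \<Longrightarrow> p * q \<in> Q i"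
    and Q_prime: "\<And>i p q. i \<le> r \<Longrightarrow> p \<in> P \<Longrightarrow> q \<in> P \<Longrightarrow> p * q \<in> Q i \<Longrightarrow> p \<in> Q i \<or> q \<in> Q i"
    and Q_proper: "\<And>i s. i \<le> r \<Longrightarrow> s \<in> S \<Longrightarrow> s \<notin> Q i"
    and Q_mono: "\<And>i. i < r \<Longrightarrow> Q i \<subseteq> Q (Suc i)"
    and f: "\<And>i. i < r \<Longrightarrow> f i \<in> P \<and> f i \<in> Q (Suc i) \<and> f i \<notin> Q i"
begin

lemma Q_sum: "i \<le> r \<Longrightarrow> (\<And>x. x \<in> F \<Longrightarrow> g x \<in> Q i) \<Longrightarrow> sum g F \<in> Q i"
  by (induction F rule: infinite_finite_induct) (auto intro: Q_add Q_zero)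

lemma Q_power: "i \<le> r \<Longrightarrow> p \<in> P \<Longrightarrow> p \<notin> Q i \<Longrightarrow> p ^ n \<notin> Q i"
proof (induction n)
  case 0
  then show ?case using Q_proper[of i 1] by simp
next
  case (Suc n)
  then show ?case using Q_prime[of i p "p ^ n"] P_power by auto
qed

text \<open>Divide a relation by the lowest power of \<open>f k\<close> that occurs; the quotient
  stays in \<open>Q k\<close>, which is prime and does not contain \<open>f k\<close>. Passing to
  \<open>Q (Suc k)\<close>, which contains \<open>f k\<close>, only the terms with that lowest power
  survive, and they form a relation among the later elements. The result is algebraic independence
  modulo \<open>Q k\<close>. Exponents are functions on all of \<open>nat\<close>, hence the
  assumption that their values on the relevant range tell them apart.\<close>

lemma chain_independent:
  assumes "k \<le> r" "finite F" "\<And>e e'. e \<in> F \<Longrightarrow> e' \<in> F \<Longrightarrow> (\<forall>i\<in>{k..<r}. e i = e' i) \<Longrightarrow> e = e'"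
    and "(\<Sum>e\<in>F. single 0 (c e) * (\<Prod>i\<in>{k..<r}. f i ^ e i)) \<in> Q k"
  shows "\<forall>e\<in>F. c e = (0::'k)"
  using assms
proof (induction k arbitrary: F c rule: inc_induct)
  case base
  show ?case
  proof
    fix e assume e: "e \<in> F"
    then have "F = {e}" using base(2) by auto
    then have "single 0 (c e) \<in> Q r" using base(3) by simp
    then have "single 0 (c e) \<notin> S" using Q_proper by blast
    then show "c e = 0" using P_const by (auto simp: S_iff)
  qed
next
  case (step k)
  define g where "g e = (\<Prod>i\<in>{Suc k..<r}. f i ^ e i)" for e :: "nat \<Rightarrow> nat"
  have gP: "g e \<in> P" for e unfolding g_def using f by (intro P_prod P_power) auto
  have split: "(\<Prod>i\<in>{k..<r}. f i ^ e i) = f k ^ e k * g e" for e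
    using step.hyps by (simp add: g_def prod.atLeast_Suc_lessThan)
  have fk: "f k \<in> P" "f k \<in> Q (Suc k)" "f k \<notin> Q k" using f[of k] step.hyps by auto
  show ?case
  proof (rule ccontr)
    assume neg: "\<not> (\<forall>e\<in>F. c e = 0)"
    \<comment> \<open>Vanishing coefficients are dropped first, so that the lowest power of
      \<open>f k\<close> is attained by a term that is really present; this term yields the
      contradiction at the end.\<close>
    define F' where "F' = {e \<in> F. c e \<noteq> 0}"
    have F': "finite F'" "F' \<noteq> {}" using neg step.prems(1) by (auto simp: F'_def)
    have "(\<Sum>e\<in>F'. single 0 (c e) * (f k ^ e k * g e)) \<in> Q k"
    proof -
      have "(\<Sum>e\<in>F'. single 0 (c e) * (f k ^ e k * g e)) = (\<Sum>e\<in>F. single 0 (c e) * (f k ^ e k * g e))"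
        using step.prems(1) by (intro sum.mono_neutral_left) (auto simp: F'_def)
      then show ?thesis using step.prems(3) by (simp add: split)
    qed
    define m where "m = Min ((\<lambda>e. e k) ` F')"
    have "m \<in> (\<lambda>e. e k) ` F'" unfolding m_def using F' by (intro Min_in) auto
    then obtain e0 where e0: "e0 \<in> F'" "e0 k = m" by auto
    have m: "m \<le> e k" if "e \<in> F'" for e unfolding m_def using that F' by (intro Min_le) auto
    let ?G = "\<Sum>e\<in>F'. single 0 (c e) * (f k ^ (e k - m) * g e)"
    have GP: "?G \<in> P" using fk gP by (intro P_sum polys_expo_mult P_const P_power)
    have "f k ^ m * ?G = (\<Sum>e\<in>F'. single 0 (c e) * (f k ^ e k * g e))"
      unfolding sum_distrib_left
    proof (rule sum.cong[OF refl])
      fix e assume "e \<in> F'"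
      then have "f k ^ e k = f k ^ m * f k ^ (e k - m)" using m by (simp flip: power_add)
      then show "f k ^ m * (single 0 (c e) * (f k ^ (e k - m) * g e)) = single 0 (c e) * (f k ^ e k * g e)"
        by (simp add: ac_simps)
    qed
    then have "f k ^ m * ?G \<in> Q k" using \<open>(\<Sum>e\<in>F'. single 0 (c e) * (f k ^ e k * g e)) \<in> Q k\<close> by simp
    moreover have "f k ^ m \<notin> Q k" using Q_power fk step.hyps by simp
    ultimately have "?G \<in> Q k" using Q_prime[of k "f k ^ m" ?G] P_power fk(1) GP step.hyps by auto
    then have G: "?G \<in> Q (Suc k)" using Q_mono[of k] step.hyps by auto
    define F0 where "F0 = {e \<in> F'. e k = m}"
    have rest: "(\<Sum>e\<in>F' - F0. - (single 0 (c e) * (f k ^ (e k - m) * g e))) \<in> Q (Suc k)"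
    proof (rule Q_sum)
      fix e assume e: "e \<in> F' - F0"
      then have "e k - m = Suc (e k - m - 1)" using m[of e] by (auto simp: F0_def)
      then have "f k ^ (e k - m) = f k ^ (e k - m - 1) * f k" by (metis power_Suc2)
      then have "- (single 0 (c e) * (f k ^ (e k - m) * g e)) = (- (single 0 (c e) * (f k ^ (e k - m - 1) * g e))) * f k"
        by (simp add: ac_simps)
      also have "\<dots> \<in> Q (Suc k)"
        using fk gP step.hyps by (intro Q_mult polys_uminus polys_expo_mult P_const P_power) auto
      finally show "- (single 0 (c e) * (f k ^ (e k - m) * g e)) \<in> Q (Suc k)" .
    qed (use step.hyps in simp)
    have "?G = (\<Sum>e\<in>F' - F0. single 0 (c e) * (f k ^ (e k - m) * g e)) + (\<Sum>e\<in>F0. single 0 (c e) * (f k ^ (e k - m) * g e))"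
      using F'(1) by (intro sum.subset_diff) (auto simp: F0_def)
    then have "(\<Sum>e\<in>F0. single 0 (c e) * (f k ^ (e k - m) * g e)) = ?G + (\<Sum>e\<in>F' - F0. - (single 0 (c e) * (f k ^ (e k - m) * g e)))"
      by (simp add: sum_negf)
    also have "\<dots> \<in> Q (Suc k)" using G rest step.hyps by (intro Q_add) auto
    also have "(\<Sum>e\<in>F0. single 0 (c e) * (f k ^ (e k - m) * g e)) = (\<Sum>e\<in>F0. single 0 (c e) * (\<Prod>i\<in>{Suc k..<r}. f i ^ e i))"
      by (intro sum.cong refl) (auto simp: F0_def g_def)
    finally have "(\<Sum>e\<in>F0. single 0 (c e) * (\<Prod>i\<in>{Suc k..<r}. f i ^ e i)) \<in> Q (Suc k)" .
    moreover have "e = e'" if "e \<in> F0" "e' \<in> F0" "\<forall>i\<in>{Suc k..<r}. e i = e' i" for e e'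
    proof (rule step.prems(2))
      show "\<forall>i\<in>{k..<r}. e i = e' i"
        using that by (auto simp: F0_def le_eq_less_or_eq Suc_le_eq)
    qed (use that in \<open>auto simp: F0_def F'_def\<close>)
    moreover have "finite F0" using F'(1) by (simp add: F0_def)
    ultimately have "\<forall>e\<in>F0. c e = 0" using step.IH by blast
    then show False using e0 by (auto simp: F0_def F'_def)
  qed
qed

text \<open>The products of the \<open>f i\<close> with exponents up to \<open>D\<close> number
  \<open>(D + 1) ^ r\<close>, while their degrees are bounded linearly in \<open>D\<close>, which
  leaves room for a number of monomials of order \<open>D ^ card V\<close> only. If \<open>r\<close>
  exceeded \<open>card V\<close>, a linear dependency would contradict independence at
  \<open>k = 0\<close>.\<close>

lemma chain_length_le: "r \<le> card V"
proof (rule ccontr)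
  assume "\<not> r \<le> card V"
  then have r: "Suc (card V) \<le> r" by simp
  define \<delta> where "\<delta> = (\<Sum>i<r. \<Sum>a\<in>keys (f i). tdeg a)"
  have f\<delta>: "f i \<in> polys (bounded_deg \<delta>)" if i: "i < r" for i
  proof -
    have "tdeg a \<le> \<delta>" if "a \<in> keys (f i)" for a
    proof -
      have "tdeg a \<le> (\<Sum>a\<in>keys (f i). tdeg a)" using that by (intro member_le_sum) auto
      also have "\<dots> \<le> \<delta>" unfolding \<delta>_def using i by (intro member_le_sum) auto
      finally show ?thesis .
    qed
    then show ?thesis using f[OF i] by (auto simp: polys_def bounded_deg_def)
  qed
  \<comment> \<open>Chosen to win the count: at most
    \<open>(\<delta> * r + 1) ^ card V * (D + 1) ^ card V\<close> monomials are available, and with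
    this choice that is \<open>D * (D + 1) ^ card V\<close>, less than
    \<open>(D + 1) ^ Suc (card V)\<close>.\<close>
  define D where "D = (\<delta> * r + 1) ^ card V"
  define F where "F = PiE {..<r} (\<lambda>_. {..D})"
  define mn where "mn e = (\<Prod>i<r. f i ^ e i)" for e :: "nat \<Rightarrow> nat"
  have F: "finite F" "card F = (D + 1) ^ r" by (auto simp: F_def card_PiE intro!: finite_PiE)
  have mn: "mn e \<in> polys (bounded_deg (r * (D * \<delta>)))" if e: "e \<in> F" for e
    unfolding mn_def
  proof (rule bounded_deg_prod)
    fix i assume i: "i < r"
    have "f i ^ e i \<in> polys (bounded_deg (e i * \<delta>))" by (rule bounded_deg_power[OF f\<delta>[OF i]])
    moreover have "e i \<le> D" using e i by (auto simp: F_def PiE_def Pi_def)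
    then have "e i * \<delta> \<le> D * \<delta>" by (rule mult_le_mono1)
    then have "bounded_deg (e i * \<delta>) \<subseteq> bounded_deg (D * \<delta>)"
      unfolding bounded_deg_def by (blast intro: order_trans)
    ultimately show "f i ^ e i \<in> polys (bounded_deg (D * \<delta>))" using polys_mono by blast
  qed
  have "card (bounded_deg (r * (D * \<delta>))) \<le> (r * (D * \<delta>) + 1) ^ card V" by (rule card_bounded_deg)
  also have "\<dots> \<le> ((\<delta> * r + 1) * (D + 1)) ^ card V" by (intro power_mono) (auto simp: algebra_simps)
  also have "\<dots> = D * (D + 1) ^ card V" unfolding power_mult_distrib D_def ..
  also have "\<dots> < (D + 1) ^ Suc (card V)" by simp
  also have "\<dots> \<le> card F" unfolding F using r by (intro power_increasing) auto
  finally have "card (bounded_deg (r * (D * \<delta>))) < card F" .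
  from ex_linear_dependency[OF card_bounded_deg(1) F(1) this, of "\<lambda>e. lookup (mn e)"]
  obtain c where c: "\<exists>e\<in>F. c e \<noteq> (0::'k)" "\<forall>a\<in>bounded_deg (r * (D * \<delta>)). (\<Sum>e\<in>F. c e * lookup (mn e) a) = 0"
    by blast
  have "(\<Sum>e\<in>F. single 0 (c e) * mn e) = 0"
  proof (rule poly_mapping_eqI)
    fix a
    have "lookup (\<Sum>e\<in>F. single 0 (c e) * mn e) a = (\<Sum>e\<in>F. c e * lookup (mn e) a)"
      unfolding lookup_sum using lookup_single_times[of 0 _ _ a] by (intro sum.cong refl) simp
    also have "\<dots> = 0"
    proof (cases "a \<in> bounded_deg (r * (D * \<delta>))")
      case False
      then have "lookup (mn e) a = 0" if "e \<in> F" for e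
        using mn[OF that] by (auto simp: polys_def in_keys_iff)
      then show ?thesis by simp
    qed (use c(2) in blast)
    finally show "lookup (\<Sum>e\<in>F. single 0 (c e) * mn e) a = lookup 0 a" by simp
  qed
  then have "(\<Sum>e\<in>F. single 0 (c e) * (\<Prod>i\<in>{0..<r}. f i ^ e i)) \<in> Q 0"
    using Q_zero[of 0] by (simp add: mn_def atLeast0LessThan)
  moreover have "e = e'" if "e \<in> F" "e' \<in> F" "\<forall>i\<in>{0..<r}. e i = e' i" for e e'
  proof -
    have "e \<in> PiE {..<r} (\<lambda>_. {..D})" "e' \<in> PiE {..<r} (\<lambda>_. {..D})" using that(1,2) by (simp_all add: F_def)
    then show ?thesis by (rule PiE_ext) (use that(3) in simp)
  qed
  ultimately have "\<forall>e\<in>F. c e = 0" by (intro chain_independent[of 0 F c] F(1)) simp_all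
  then show False using c(1) by blast
qed

end

text \<open>Denominators are units, so each strict step is witnessed by a polynomial, and the primes
  may be replaced by their contractions to the polynomial ring. These contain no element with
  nonzero constant term, which is the properness that the independence argument uses.\<close>

lemma prime_chain_bound:
  assumes prime: "\<And>i. i \<le> r \<Longrightarrow> primeideal (N i) R" and strict: "\<And>i. i < r \<Longrightarrow> N i \<subset> N (Suc i)"
  shows "r \<le> card V"
proof -
  have "\<forall>i. \<exists>p. i < r \<longrightarrow> p \<in> P \<and> frac p 1 \<in> N (Suc i) \<and> frac p 1 \<notin> N i"
  proof
    fix i
    show "\<exists>p. i < r \<longrightarrow> p \<in> P \<and> frac p 1 \<in> N (Suc i) \<and> frac p 1 \<notin> N i"
    proof (cases "i < r")
      case True
      interpret N0: primeideal "N i" R using prime True by simp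
      interpret N1: primeideal "N (Suc i)" R using prime True by simp
      obtain x where x: "x \<in> N (Suc i)" "x \<notin> N i" using strict[OF True] by blast
      obtain p s where ps: "p \<in> P" "s \<in> S" "x = frac p s" using N1.Icarr[OF x(1)] by (rule carrierE)
      have "x \<otimes>\<^bsub>R\<^esub> frac s 1 = frac p 1"
        using ps by (simp add: frac_mult S_P, subst frac_eq_iff) (simp_all add: polys_expo_mult S_P)
      then have "frac p 1 \<in> N (Suc i)" using N1.I_r_closed[OF x(1), of "frac s 1"] ps by (simp add: S_P)
      moreover have "frac p 1 \<otimes>\<^bsub>R\<^esub> frac 1 s = x" using ps by (simp add: frac_mult)
      then have "frac p 1 \<notin> N i" using N0.I_r_closed[of "frac p 1" "frac 1 s"] x(2) ps by auto
      ultimately show ?thesis using ps(1) by blast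
    qed simp
  qed
  from choice[OF this] obtain f where f: "\<forall>i. i < r \<longrightarrow> f i \<in> P \<and> frac (f i) 1 \<in> N (Suc i) \<and> frac (f i) 1 \<notin> N i" ..
  define Q where "Q i = {p \<in> P. frac p 1 \<in> N i}" for i
  have fr_mult: "frac (p * q) 1 = frac p 1 \<otimes>\<^bsub>R\<^esub> frac q 1" if "p \<in> P" "q \<in> P" for p q
    using that by (simp add: frac_mult)
  show ?thesis
  proof (rule chain_length_le[of r Q f])
    fix i assume i: "i \<le> r"
    interpret N: primeideal "N i" R using prime i by simp
    show "0 \<in> Q i" using N.zero_closed by (simp add: Q_def frac_zero)
    show "p + q \<in> Q i" if "p \<in> Q i" "q \<in> Q i" for p q
      using that N.a_closed[of "frac p 1" "frac q 1"] by (auto simp: Q_def polys_add frac_add_same)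
    show "p * q \<in> Q i" if "p \<in> P" "q \<in> Q i" for p q
      using that N.I_l_closed[of "frac q 1" "frac p 1"] by (auto simp: Q_def polys_expo_mult fr_mult)
    show "p \<in> Q i \<or> q \<in> Q i" if "p \<in> P" "q \<in> P" "p * q \<in> Q i" for p q
      using that N.I_prime[of "frac p 1" "frac q 1"] by (auto simp: Q_def fr_mult)
    show "s \<notin> Q i" if s: "s \<in> S" for s
    proof
      assume "s \<in> Q i"
      then have "\<one>\<^bsub>R\<^esub> \<in> N i"
        using N.I_r_closed[of "frac s 1" "frac 1 s"] frac_unit[of s 1] s by (simp add: Q_def)
      then show False using N.one_imp_carrier N.I_notcarr by simp
    qed
  next
    fix i assume i: "i < r"
    show "Q i \<subseteq> Q (Suc i)" using strict[OF i] by (auto simp: Q_def)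
    show "f i \<in> P \<and> f i \<in> Q (Suc i) \<and> f i \<notin> Q i" using f i by (auto simp: Q_def)
  qed
qed

lemma krull_dim_node_ring: "krull_dim R = enat (card V)"
proof (rule antisym)
  show "krull_dim R \<le> enat (card V)"
    unfolding krull_dim_def
  proof (rule Sup_least)
    fix x assume "x \<in> {enat r | r. \<exists>Q. (\<forall>i\<le>r. primeideal (Q i) R) \<and> (\<forall>i<r. Q i \<subset> Q (Suc i))}"
    then obtain r Q where x: "x = enat r" and Q: "\<forall>i\<le>r. primeideal (Q i) R" "\<forall>i<r. Q i \<subset> Q (Suc i)" by blast
    have "r \<le> card V" by (rule prime_chain_bound[of r Q]) (use Q in simp_all)
    then show "x \<le> enat (card V)" using x by simp
  qed
  show "enat (card V) \<le> krull_dim R"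
    unfolding krull_dim_def using prime_chain_exists by (intro Sup_upper) blast
qed

end

section \<open>Edge ideals of uniform hypergraphs\<close>

definition emon :: "'v set \<Rightarrow> 'v \<Rightarrow>\<^sub>0 nat" where
  "emon e = (\<Sum>v\<in>e. single v 1)"

definition complete_gens :: "nat \<Rightarrow> 'v set \<Rightarrow> ('v \<Rightarrow>\<^sub>0 nat) set" where
  "complete_gens m V = emon ` {e. e \<subseteq> V \<and> card e = m}"

lemma lookup_emon: "finite e \<Longrightarrow> lookup (emon e) i = (if i \<in> e then 1 else 0)"
  by (simp add: emon_def lookup_sum lookup_single when_def)

lemma tdeg_emon: "tdeg (emon e) = card e"
  by (simp add: emon_def tdeg_sum)

lemma emon_expo: "e \<subseteq> V \<Longrightarrow> emon e \<in> expo V"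
  unfolding emon_def by (intro expo_sum) auto

lemma complete_gens_props:
  assumes "finite V"
  shows "finite (complete_gens m V)" "complete_gens m V \<subseteq> expo V"
    "\<And>b. b \<in> complete_gens m V \<Longrightarrow> tdeg b = m" "\<And>b i. b \<in> complete_gens m V \<Longrightarrow> lookup b i \<le> 1"
  using assms by (auto simp: complete_gens_def tdeg_emon emon_expo lookup_emon finite_subset)

lemma tdeg_pw:
  assumes "\<And>b. b \<in> B \<Longrightarrow> tdeg b = m" "a \<in> pw V B t"
  shows "m * t \<le> tdeg a"
  using assms(2)
proof (induction t arbitrary: a)
  case (Suc t)
  then obtain b c where "a = b + c" "b \<in> B" "c \<in> pw V B t" unfolding pw.simps by blast
  then show ?case using Suc.IH[of c] assms(1)[of b] by simp
qed simp

text \<open>A vector of degree \<open>m * Suc t\<close> with coordinates at most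
  \<open>Suc t\<close> has at most \<open>m\<close> coordinates equal to \<open>Suc t\<close> and at
  least \<open>m\<close> nonzero ones. Some set of \<open>m\<close> nodes lies between these two
  sets; removing this edge lowers every maximal coordinate, and the induction hypothesis
  applies.\<close>

lemma complete_pw_exact:
  assumes V: "finite V"
  shows "a \<in> expo V \<Longrightarrow> (\<And>i. lookup a i \<le> t) \<Longrightarrow> tdeg a = m * t \<Longrightarrow> a \<in> pw V (complete_gens m V) t"
proof (induction t arbitrary: a)
  case 0
  then show ?case by simp
next
  case (Suc t)
  define Z where "Z = {i \<in> keys a. lookup a i = Suc t}"
  have Z: "Z \<subseteq> keys a" "finite Z" unfolding Z_def by (auto intro: finite_subset[OF _ finite_keys[of a]])
  have "card Z * Suc t = (\<Sum>i\<in>Z. lookup a i)" by (simp add: Z_def)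
  also have "\<dots> \<le> tdeg a" unfolding tdeg_def using Z by (intro sum_mono2) auto
  finally have "card Z * Suc t \<le> m * Suc t" using Suc.prems(3) by (simp only:)
  then have Zm: "card Z \<le> m" by (metis mult_le_cancel2 zero_less_Suc)
  have "m * Suc t = tdeg a" using Suc.prems(3) by simp
  also have "\<dots> \<le> (\<Sum>i\<in>keys a. Suc t)" unfolding tdeg_def by (intro sum_mono Suc.prems(2))
  also have "\<dots> = card (keys a) * Suc t" by simp
  finally have "m \<le> card (keys a)" by (metis mult_le_cancel2 zero_less_Suc)
  then have "m - card Z \<le> card (keys a - Z)" using Z by (simp add: card_Diff_subset)
  then obtain Y where Y: "Y \<subseteq> keys a - Z" "card Y = m - card Z" "finite Y"
    by (rule obtain_subset_with_card_n)
  define e where "e = Z \<union> Y"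
  have "Z \<inter> Y = {}" using Y(1) by blast
  then have "card e = m" using Y Z Zm by (simp add: e_def card_Un_disjoint)
  then have e: "finite e" "card e = m" "e \<subseteq> keys a" "Z \<subseteq> e"
    using Y Z by (auto simp: e_def)
  have "\<exists>d. a = emon e + d"
    unfolding ex_add_iff using e by (auto simp: lookup_emon in_keys_iff Suc_le_eq)
  then obtain d where d: "a = emon e + d" ..
  have "d \<in> pw V (complete_gens m V) t"
  proof (rule Suc.IH)
    show "d \<in> expo V" using Suc.prems(1) d by simp
    show "tdeg d = m * t" using Suc.prems(3) e(2) by (simp add: d tdeg_emon)
    fix i
    have "lookup a i = lookup (emon e) i + lookup d i" by (simp add: d lookup_add)
    moreover have "lookup a i \<le> Suc t" by (rule Suc.prems(2))
    moreover have "lookup a i \<noteq> Suc t" if "i \<notin> e"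
      using that e(4) unfolding Z_def by (metis (mono_tags, lifting) in_keys_iff mem_Collect_eq nat.distinct(1) subsetD)
    ultimately show "lookup d i \<le> t" using e(1) by (cases "i \<in> e") (auto simp: lookup_emon)
  qed
  moreover have "emon e \<in> complete_gens m V"
    using e Suc.prems(1) by (auto simp: complete_gens_def expo_def)
  ultimately show ?case unfolding pw.simps using d by blast
qed

text \<open>Surplus degree is first split off as slack, which can only lower the
  coordinates.\<close>

lemma complete_pw:
  assumes V: "finite V" and a: "a \<in> expo V" "\<And>i. lookup a i \<le> t" "m * t \<le> tdeg a"
  shows "a \<in> pw V (complete_gens m V) t"
proof -
  obtain b u where bu: "a = b + u" "tdeg b = m * t" using ex_sub_exponent[OF a(3)] by blast
  have "b \<in> pw V (complete_gens m V) t"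
  proof (rule complete_pw_exact[OF V _ _ bu(2)])
    show "b \<in> expo V" using a(1) bu(1) by simp
    show "lookup b i \<le> t" for i using a(2)[of i] by (simp add: bu(1) lookup_add)
  qed
  then show ?thesis using pw_add[OF complete_gens_props(2)[OF V]] a(1) by (simp add: bu(1))
qed

lemma complete_gens_1: "complete_gens 1 V = (\<lambda>v. single v 1) ` V"
proof (intro equalityI subsetI)
  fix b assume "b \<in> complete_gens 1 V"
  then obtain v where "v \<in> V" "b = emon {v}" by (auto simp: complete_gens_def card_1_singleton_iff)
  then show "b \<in> (\<lambda>v. single v 1) ` V" by (simp add: emon_def)
next
  fix b assume "b \<in> (\<lambda>v. single v (1::nat)) ` V"
  then obtain v where "v \<in> V" "b = emon {v}" by (auto simp: emon_def)
  then show "b \<in> complete_gens 1 V" by (auto simp: complete_gens_def)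
qed

text \<open>By degree, \<open>tdeg a div m\<close> is the largest power that can contain
  \<open>a\<close>. The condition bounds \<open>lookup a i + m\<close> by it, which leaves room to
  add \<open>m\<close> to one coordinate: the degree then suffices for the next power, and no
  coordinate becomes too large. For \<open>m = 1\<close> the powers are described by degree
  alone.\<close>

lemma complete_jmon:
  assumes V: "finite V" and m: "1 \<le> m" and a: "a \<in> expo V"
    and cond: "m = 1 \<or> (\<forall>i\<in>V. m * (lookup a i + m) \<le> tdeg a)"
  shows "a \<in> jmon V (complete_gens m V) (tdeg a div m)"
proof -
  let ?t = "tdeg a div m"
  have "m * ?t \<le> tdeg a" by (simp add: mult.commute)
  have notin: "a \<notin> pw V (complete_gens m V) (Suc ?t)"
  proof
    assume "a \<in> pw V (complete_gens m V) (Suc ?t)"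
    then have "m * Suc ?t \<le> tdeg a"
      using complete_gens_props(3)[OF V] by (intro tdeg_pw[of "complete_gens m V" m a V])
    then have "Suc ?t \<le> tdeg a div m" using m by (simp add: less_eq_div_iff_mult_less_eq mult.commute)
    then show False by simp
  qed
  show ?thesis
  proof (cases "m = 1")
    case True
    have "a \<in> pw V (complete_gens m V) ?t" "a + single i 1 \<in> pw V (complete_gens m V) (Suc ?t)" if "i \<in> V" for i
      using a that by (auto simp: True complete_gens_1 pw_singles simp del: One_nat_def)
    moreover have "a \<in> pw V (complete_gens m V) ?t"
      using a by (auto simp: True complete_gens_1 pw_singles simp del: One_nat_def)
    ultimately show ?thesis using notin by (auto simp: jmon_def satur_def)
  next
    case False
    have bound: "lookup a i + m \<le> ?t" if "i \<in> V" for i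
      using False cond that m by (simp add: less_eq_div_iff_mult_less_eq mult.commute)
    have le: "lookup a i \<le> ?t" for i
      using bound[of i] lookup_outside[OF a, of i] by (cases "i \<in> V") auto
    have "a \<in> pw V (complete_gens m V) ?t" by (rule complete_pw[OF V a le]) (simp add: mult.commute)
    moreover have "a + single i m \<in> pw V (complete_gens m V) (Suc ?t)" if i: "i \<in> V" for i
    proof (rule complete_pw[OF V])
      show "a + single i m \<in> expo V" using a i by simp
      show "lookup (a + single i m) j \<le> Suc ?t" for j
        using bound[OF i] le[of j] by (auto simp: lookup_add lookup_single when_def)
      show "m * Suc ?t \<le> tdeg (a + single i m)" using \<open>m * ?t \<le> tdeg a\<close> by simp
    qed
    ultimately show ?thesis using notin by (auto simp: jmon_def satur_def)
  qed
qed

section \<open>Comparison with the complete hypergraph\<close>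

lemma lookup_comb_le:
  assumes "finite B" "c \<in> expo B" "\<And>b. b \<in> B \<Longrightarrow> lookup b i \<le> 1"
  shows "lookup (comb B c) i \<le> tdeg c"
proof -
  have "lookup (comb B c) i = (\<Sum>b\<in>B. lookup c b * lookup b i)" by (simp add: comb_def lookup_sum)
  also have "\<dots> \<le> (\<Sum>b\<in>B. lookup c b * 1)" by (intro sum_mono mult_left_mono assms(3)) auto
  finally show ?thesis using assms by (simp add: tdeg_eq)
qed

text \<open>On \<open>Y\<close> the quantity \<open>m * (lookup a i + m) - tdeg a\<close> takes
  boundedly many values. Together with the coordinates other than \<open>i\<close> it determines
  \<open>(m - 1) * lookup a i\<close>, hence \<open>lookup a i\<close> because m \<ge> 2; so only
  \<open>d\<close> coordinates are free.\<close>

lemma card_near_facet: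
  fixes M N m :: nat
  assumes V: "finite V" "i \<in> V" "card V = Suc d" and m: "2 \<le> m"
  defines "Y \<equiv> {a \<in> expo V. tdeg a \<le> M \<and> tdeg a < m * (lookup a i + m) \<and> m * lookup a i \<le> tdeg a + N}"
  shows "finite Y" "card Y \<le> (M + 1) ^ d * (N + m * m + 1)"
proof -
  \<comment> \<open>On \<open>Y\<close> the subtraction does not truncate, so equality of the second
    components is an equality of integers.\<close>
  let ?f = "\<lambda>a. (restrict (lookup a) (V - {i}), m * (lookup a i + m) - tdeg a)"
  let ?Z = "PiE (V - {i}) (\<lambda>_. {..M}) \<times> {..N + m * m}"
  have sub: "?f ` Y \<subseteq> ?Z"
  proof
    fix z assume "z \<in> ?f ` Y"
    then obtain a where a: "a \<in> Y" "z = ?f a" by auto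
    have "lookup a j \<le> M" for j using a(1) lookup_le_tdeg[of a j] by (simp add: Y_def)
    moreover have "m * (lookup a i + m) - tdeg a \<le> N + m * m"
      using a(1) by (auto simp: Y_def distrib_left)
    ultimately show "z \<in> ?Z" by (auto simp: a(2))
  qed
  have inj: "inj_on ?f Y"
  proof (rule inj_onI)
    fix a b assume ab: "a \<in> Y" "b \<in> Y" "?f a = ?f b"
    have re: "restrict (lookup a) (V - {i}) = restrict (lookup b) (V - {i})" using ab(3) by simp
    have eq: "lookup a j = lookup b j" if "j \<noteq> i" for j
    proof (cases "j \<in> V")
      case True
      then show ?thesis using that fun_cong[OF re, of j] by simp
    qed (use ab in \<open>simp add: Y_def lookup_outside[of _ V]\<close>)
    have deg: "tdeg c = lookup c i + (\<Sum>j\<in>V - {i}. lookup c j)" if "c \<in> Y" for c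
      using that tdeg_eq[OF V(1), of c] sum.remove[OF V(1,2), of "lookup c"] by (simp add: Y_def)
    have rest: "(\<Sum>j\<in>V - {i}. lookup a j) = (\<Sum>j\<in>V - {i}. lookup b j)" by (intro sum.cong refl eq) auto
    obtain k where k: "m = Suc (Suc k)" using m by (metis Suc_le_D numeral_2_eq_2 Suc_le_mono)
    have "m * (lookup a i + m) - tdeg a = m * (lookup b i + m) - tdeg b" using ab(3) by simp
    moreover have "tdeg a < m * (lookup a i + m)" "tdeg b < m * (lookup b i + m)"
      using ab(1,2) by (simp_all add: Y_def)
    ultimately have "m * (lookup a i + m) + tdeg b = m * (lookup b i + m) + tdeg a" by linarith
    then have "m * lookup a i + tdeg b = m * lookup b i + tdeg a" by (simp add: distrib_left)
    then have "Suc k * lookup a i = Suc k * lookup b i"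
      using deg[OF ab(1)] deg[OF ab(2)] rest by (simp add: k)
    then have "lookup a i = lookup b i" by (simp only: mult_cancel1) simp
    then show "a = b" using eq by (metis poly_mapping_eqI)
  qed
  have fin: "finite ?Z" using V(1) by (intro finite_cartesian_product finite_PiE) auto
  show "finite Y" using finite_imageD[OF finite_subset[OF sub fin] inj] .
  have "card Y \<le> card ?Z" by (rule card_inj_on_le[OF inj sub fin])
  also have "\<dots> = (M + 1) ^ d * (N + m * m + 1)" using V by (simp add: card_PiE card_cartesian_product)
  finally show "card Y \<le> (M + 1) ^ d * (N + m * m + 1)" .
qed

lemma jmon_disjoint:
  assumes "B \<subseteq> expo V" "s \<noteq> t" shows "jmon V B s \<inter> jmon V B t = {}"
proof -
  have "jmon V B s \<inter> jmon V B t = {}" if "s < t" for s t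
    using pw_antimono[OF assms(1), of "Suc s" t] that by (auto simp: jmon_def)
  then show ?thesis using assms(2) by (metis Int_commute linorder_neqE_nat)
qed

text \<open>An exponent counted at \<open>t\<close> for \<open>B\<close> has degree
  \<open>m * t\<close> plus a slack of at most \<open>K\<close>; with enough margin in every
  coordinate it is counted for the complete hypergraph at most \<open>K\<close> later. Disjointness
  for different \<open>t\<close> turns this inclusion of sets into an inequality of sums. Without
  margin in direction \<open>i\<close> the exponent still obeys the upper bound coming from the
  edges, so it lies in a strip along a hyperplane.\<close>

lemma cumulative_comparison:
  assumes V: "finite V" "card V = Suc d" and m: "1 \<le> m" and B: "B \<subseteq> complete_gens m V"
  shows "\<exists>K C. \<forall>T. (\<Sum>t\<le>T. real (card (jmon V B t)))
    \<le> (\<Sum>t\<le>T + K. real (card (jmon V (complete_gens m V) t))) + C * real (T + 1) ^ d"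
proof -
  let ?C = "complete_gens m V"
  note C = complete_gens_props[OF V(1), where m = m]
  have Bf: "finite B" "B \<subseteq> expo V" using B C(1,2) finite_subset by blast+
  obtain K where K: "\<forall>t. \<forall>a\<in>jmon V B t. \<exists>c\<in>level B t. \<exists>u\<in>expo V. a = comb B c + u \<and> tdeg u \<le> K"
    using jmon_decompose[OF V(1) Bf] by blast
  \<comment> \<open>Of the last two conditions, one is the failure of the margin, the other the
    bound \<open>lookup a i \<le> t + K\<close> rewritten in terms of the degree, so that it no
    longer mentions \<open>t\<close>.\<close>
  define Y where "Y T i = {a \<in> expo V. tdeg a \<le> m * T + K \<and> tdeg a < m * (lookup a i + m) \<and> m * lookup a i \<le> tdeg a + m * K}" for T i
  define Exc where "Exc T = (if m = 1 then {} else (\<Union>i\<in>V. Y T i))" for T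
  \<comment> \<open>One strip for each of the \<open>Suc d\<close> nodes; the power arises from
    \<open>m * T + K + 1 \<le> (m + K + 1) * (T + 1)\<close>.\<close>
  define M where "M = Suc d * ((m + K + 1) ^ d * (m * K + m * m + 1))"
  have Y: "finite (Y T i)" "card (Y T i) \<le> (m * T + K + 1) ^ d * (m * K + m * m + 1)"
    if "i \<in> V" "m \<noteq> 1" for T i
    using card_near_facet[OF V(1) that(1) V(2), of m "m * T + K" "m * K"] that(2) m by (simp_all add: Y_def)
  have Exc: "finite (Exc T) \<and> card (Exc T) \<le> M * (T + 1) ^ d" for T
  proof (cases "m = 1")
    case False
    have "card (Exc T) \<le> (\<Sum>i\<in>V. card (Y T i))" using False V(1) by (simp add: Exc_def card_UN_le)
    also have "\<dots> \<le> (\<Sum>i\<in>V. ((m + K + 1) * (T + 1)) ^ d * (m * K + m * m + 1))"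
    proof (rule sum_mono)
      fix i assume "i \<in> V"
      then have "card (Y T i) \<le> (m * T + K + 1) ^ d * (m * K + m * m + 1)" using Y False by blast
      also have "\<dots> \<le> ((m + K + 1) * (T + 1)) ^ d * (m * K + m * m + 1)"
        by (intro mult_right_mono power_mono) (auto simp: algebra_simps)
      finally show "card (Y T i) \<le> ((m + K + 1) * (T + 1)) ^ d * (m * K + m * m + 1)" .
    qed
    also have "\<dots> = M * (T + 1) ^ d" unfolding M_def power_mult_distrib sum_constant V(2) by (simp only: ac_simps of_nat_id)
    finally have "card (Exc T) \<le> M * (T + 1) ^ d" .
    moreover have "finite (Exc T)" using False V(1) Y(1) by (auto simp: Exc_def)
    ultimately show ?thesis by simp
  qed (simp add: Exc_def)
  have sub: "(\<Union>t\<le>T. jmon V B t) \<subseteq> (\<Union>t\<le>T + K. jmon V ?C t) \<union> Exc T" for T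
  proof
    fix a assume "a \<in> (\<Union>t\<le>T. jmon V B t)"
    then obtain t where t: "t \<le> T" "a \<in> jmon V B t" by auto
    obtain c u where cu: "c \<in> level B t" "u \<in> expo V" "a = comb B c + u" "tdeg u \<le> K"
      using K t(2) by blast
    have c: "c \<in> expo B" "tdeg c = t" using cu(1) by (auto simp: level_def)
    have aV: "a \<in> expo V" using expo_comb[OF Bf(2), of c] cu by simp
    have dega: "tdeg a = m * t + tdeg u" using tdeg_comb[OF Bf(1) c(1), of m] C(3) B c(2) cu(3) by auto
    have la: "lookup a i \<le> t + K" for i
    proof -
      have "lookup (comb B c) i \<le> t"
        using lookup_comb_le[OF Bf(1) c(1), of i] C(4) B c(2) by blast
      moreover have "lookup u i \<le> K" using lookup_le_tdeg[of u i] cu(4) by simp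
      ultimately show ?thesis by (simp add: cu(3) lookup_add)
    qed
    have "m * t \<le> m * T" using t(1) by simp
    then have dT: "tdeg a \<le> m * T + K" using dega cu(4) by linarith
    show "a \<in> (\<Union>t\<le>T + K. jmon V ?C t) \<union> Exc T"
    proof (cases "m = 1 \<or> (\<forall>i\<in>V. m * (lookup a i + m) \<le> tdeg a)")
      case True
      have "K \<le> m * K" using m by simp
      then have "tdeg a \<le> m * T + m * K" using dT by linarith
      then have "tdeg a \<le> (T + K) * m" by (simp add: algebra_simps)
      then have "tdeg a div m \<le> (T + K) * m div m" by (rule div_le_mono)
      also have "\<dots> = T + K" using m by simp
      finally have "tdeg a div m \<le> T + K" .
      then show ?thesis using complete_jmon[OF V(1) m aV True] by blast
    next
      case False
      then obtain i where i: "i \<in> V" "tdeg a < m * (lookup a i + m)" "m \<noteq> 1" by auto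
      have "m * lookup a i \<le> m * (t + K)" by (intro mult_left_mono la) simp
      then have "m * lookup a i \<le> tdeg a + m * K" using dega by (simp add: distrib_left)
      then have "a \<in> Y T i" using i dT aV by (simp add: Y_def)
      then show ?thesis using i by (auto simp: Exc_def)
    qed
  qed
  have card_UN: "card (\<Union>t\<le>T. jmon V B t) = (\<Sum>t\<le>T. card (jmon V B t))" if "finite B" "B \<subseteq> expo V" for B T
    by (rule card_UN_disjoint) (simp_all add: that finite_jmon[OF V(1)] jmon_disjoint)
  have "(\<Sum>t\<le>T. card (jmon V B t)) \<le> (\<Sum>t\<le>T + K. card (jmon V ?C t)) + M * (T + 1) ^ d" for T
  proof -
    have "(\<Sum>t\<le>T. card (jmon V B t)) = card (\<Union>t\<le>T. jmon V B t)" using card_UN[OF Bf] by simp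
    also have "\<dots> \<le> card ((\<Union>t\<le>T + K. jmon V ?C t) \<union> Exc T)"
      using Exc[of T] finite_jmon[OF V(1) C(1,2)] by (intro card_mono sub) auto
    also have "\<dots> \<le> card (\<Union>t\<le>T + K. jmon V ?C t) + card (Exc T)" by (rule card_Un_le)
    also have "\<dots> \<le> (\<Sum>t\<le>T + K. card (jmon V ?C t)) + M * (T + 1) ^ d"
      unfolding card_UN[OF C(1,2)] using Exc[of T] by simp
    finally show ?thesis .
  qed
  then have "real (\<Sum>t\<le>T. card (jmon V B t)) \<le> real ((\<Sum>t\<le>T + K. card (jmon V ?C t)) + M * (T + 1) ^ d)" for T
    by (subst of_nat_le_iff)
  then have "(\<Sum>t\<le>T. real (card (jmon V B t)))
    \<le> (\<Sum>t\<le>T + K. real (card (jmon V ?C t))) + real M * real (T + 1) ^ d" for T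
    unfolding of_nat_add of_nat_sum of_nat_mult of_nat_power by simp
  then show ?thesis by blast
qed

text \<open>If \<open>L\<close> exceeded \<open>M\<close>, then \<open>f\<close> would exceed
  \<open>g\<close> by \<open>\<epsilon> * t ^ d\<close> from some \<open>t0\<close> on. Summed over
  t from N + 1 to 2N this is at least \<open>\<epsilon> * N ^ (d + 1)\<close>, whereas the
  assumption permits an excess of order \<open>N ^ d\<close> only: \<open>K\<close> further terms of
  \<open>g\<close>, the error with \<open>C\<close>, and the constant \<open>G\<close>.\<close>

lemma limit_le_of_cumulative:
  fixes f g :: "nat \<Rightarrow> real"
  assumes f: "(\<lambda>t. f t / real t ^ d) \<longlonglongrightarrow> L" and g: "(\<lambda>t. g t / real t ^ d) \<longlonglongrightarrow> M"
    and pos: "\<And>t. 0 \<le> f t" "\<And>t. 0 \<le> g t" and gb: "\<And>t. g t \<le> D * real (t + 1) ^ d"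
    and cum: "\<And>T. (\<Sum>t\<le>T. f t) \<le> (\<Sum>t\<le>T + K. g t) + C * real (T + 1) ^ d"
  shows "L \<le> M"
proof (rule ccontr)
  assume "\<not> L \<le> M"
  define \<epsilon> where "\<epsilon> = (L - M) / 2"
  have \<epsilon>: "\<epsilon> > 0" "\<epsilon> < L - M" using \<open>\<not> L \<le> M\<close> by (auto simp: \<epsilon>_def)
  have "(\<lambda>t. f t / real t ^ d - g t / real t ^ d) \<longlonglongrightarrow> L - M" by (intro tendsto_diff f g)
  then have "\<forall>\<^sub>F t in sequentially. \<epsilon> < f t / real t ^ d - g t / real t ^ d"
    using \<epsilon>(2) by (rule order_tendstoD)
  then obtain t1 where t1: "\<And>t. t \<ge> t1 \<Longrightarrow> \<epsilon> < f t / real t ^ d - g t / real t ^ d"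
    by (auto simp: eventually_sequentially)
  define t0 where "t0 = Suc t1"
  have lower: "g t + \<epsilon> * real t ^ d \<le> f t" if "t \<ge> t0" for t
  proof -
    have "0 < real t ^ d" using that by (simp add: t0_def)
    then show ?thesis using t1[of t] that by (simp add: t0_def field_simps)
  qed
  have D: "0 \<le> D" using order_trans[OF pos(2)[of 0] gb[of 0]] by simp
  define G where "G = (\<Sum>t<t0. g t)"
  \<comment> \<open>Bounds the \<open>K\<close> extra terms of \<open>g\<close> and the given error
    together; the absolute value keeps it nonnegative.\<close>
  define C' where "C' = real K * (D * real (K + 1) ^ d) + \<bar>C\<bar>"
  have C': "0 \<le> C'" using D by (simp add: C'_def)
  \<comment> \<open>The left side grows with \<open>N\<close>, the right side does not. The factor
    \<open>3 ^ d\<close> comes from 2N + 1 \<le> 3N.\<close>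
  have main: "\<epsilon> * real N \<le> G + C' * 3 ^ d" if N: "N \<ge> t0" for N
  proof -
    have N1: "1 \<le> N" using N by (simp add: t0_def)
    let ?T = "2 * N"
    have "\<epsilon> * real N * real N ^ d = (\<Sum>t\<in>{N<..?T}. \<epsilon> * real N ^ d)" by simp
    also have "\<dots> \<le> (\<Sum>t\<in>{N<..?T}. \<epsilon> * real t ^ d)"
      using \<epsilon>(1) by (intro sum_mono mult_left_mono power_mono) auto
    also have "\<dots> \<le> (\<Sum>t\<in>{t0..?T}. \<epsilon> * real t ^ d)"
      using \<epsilon>(1) N by (intro sum_mono2) auto
    also have "\<dots> \<le> (\<Sum>t\<in>{t0..?T}. f t - g t)"
      using lower by (intro sum_mono) (auto simp: le_diff_eq add.commute)
    also have "\<dots> \<le> (\<Sum>t\<le>?T. f t) - (\<Sum>t\<le>?T. g t) + G"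
    proof -
      have split: "(\<Sum>t\<le>?T. h t) = (\<Sum>t<t0. h t) + (\<Sum>t\<in>{t0..?T}. h t)" for h :: "nat \<Rightarrow> real"
      proof -
        have "{..?T} = {..<t0} \<union> {t0..?T}" using N by auto
        then show ?thesis by (simp only:) (intro sum.union_disjoint, auto)
      qed
      have "0 \<le> (\<Sum>t<t0. f t)" by (intro sum_nonneg pos)
      then show ?thesis by (simp add: split[of f] split[of g] sum_subtractf G_def)
    qed
    also have "\<dots> \<le> (\<Sum>t\<in>{?T<..?T + K}. g t) + C * real (?T + 1) ^ d + G"
    proof -
      have "(\<Sum>t\<le>?T + K. g t) = (\<Sum>t\<le>?T. g t) + (\<Sum>t\<in>{?T<..?T + K}. g t)"
      proof -
        have "{..?T + K} = {..?T} \<union> {?T<..?T + K}" by auto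
        then show ?thesis by (simp only:) (intro sum.union_disjoint, auto)
      qed
      then show ?thesis using cum[of ?T] by simp
    qed
    also have "(\<Sum>t\<in>{?T<..?T + K}. g t) \<le> (\<Sum>t\<in>{?T<..?T + K}. D * (real (K + 1) * real (?T + 1)) ^ d)"
    proof (rule sum_mono)
      fix t assume t: "t \<in> {?T<..?T + K}"
      have "g t \<le> D * real (t + 1) ^ d" by (rule gb)
      also have "\<dots> \<le> D * (real (K + 1) * real (?T + 1)) ^ d"
      proof (intro mult_left_mono power_mono D)
        have "t + 1 \<le> (K + 1) * (?T + 1)" using t by (simp add: algebra_simps)
        then show "real (t + 1) \<le> real (K + 1) * real (?T + 1)" by (metis of_nat_le_iff of_nat_mult)
      qed simp
      finally show "g t \<le> D * (real (K + 1) * real (?T + 1)) ^ d" .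
    qed
    also have "(\<Sum>t\<in>{?T<..?T + K}. D * (real (K + 1) * real (?T + 1)) ^ d) = real K * (D * real (K + 1) ^ d) * real (?T + 1) ^ d"
      unfolding power_mult_distrib sum_constant by simp
    finally have "\<epsilon> * real N * real N ^ d \<le> real K * (D * real (K + 1) ^ d) * real (?T + 1) ^ d + C * real (?T + 1) ^ d + G"
      by simp
    also have "\<dots> \<le> C' * real (?T + 1) ^ d + G"
      by (simp add: C'_def distrib_right mult_right_mono)
    also have "\<dots> \<le> C' * (3 * real N) ^ d + G * real N ^ d"
    proof (intro add_mono mult_left_mono power_mono C')
      show "real (?T + 1) \<le> 3 * real N" using N1 by simp
      have "0 \<le> G" unfolding G_def by (intro sum_nonneg pos)
      then show "G \<le> G * real N ^ d" using N1 by (simp add: mult_le_cancel_left1)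
    qed simp
    also have "\<dots> = (G + C' * 3 ^ d) * real N ^ d" by (simp add: power_mult_distrib algebra_simps)
    finally show ?thesis using N1 by (simp add: mult_le_cancel_right)
  qed
  obtain N where "real N > (G + C' * 3 ^ d) / \<epsilon>" using reals_Archimedean2 by blast
  then have "real (max N t0) > (G + C' * 3 ^ d) / \<epsilon>" by simp
  then have "\<epsilon> * real (max N t0) > G + C' * 3 ^ d" using \<epsilon>(1) by (simp add: pos_divide_less_eq mult.commute)
  then show False using main[of "max N t0"] by simp
qed

lemma jmon_limit_le_complete:
  assumes V: "finite V" "card V = Suc d" and m: "1 \<le> m" and B: "B \<subseteq> complete_gens m V"
    and "(\<lambda>t. real (card (jmon V B t)) / real t ^ d) \<longlonglongrightarrow> L"
    and "(\<lambda>t. real (card (jmon V (complete_gens m V) t)) / real t ^ d) \<longlonglongrightarrow> M"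
  shows "L \<le> M"
proof -
  obtain D where "\<forall>t. real (card (jmon V (complete_gens m V) t)) \<le> D * real (t + 1) ^ d"
    using card_jmon_bound[OF V complete_gens_props(1-3)[OF V(1)]] by blast
  moreover obtain K C where "\<forall>T. (\<Sum>t\<le>T. real (card (jmon V B t)))
    \<le> (\<Sum>t\<le>T + K. real (card (jmon V (complete_gens m V) t))) + C * real (T + 1) ^ d"
    using cumulative_comparison[OF V m B] by blast
  ultimately show ?thesis
    by (intro limit_le_of_cumulative[OF assms(5,6)]) auto
qed

section \<open>The complete graph\<close>

lemma pw_graph_bound:
  assumes V: "finite V" and i: "i \<in> V"
  shows "a \<in> pw V (complete_gens 2 V) t \<Longrightarrow> t + lookup a i \<le> tdeg a"
proof (induction t arbitrary: a)
  case 0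
  then show ?case by (simp add: lookup_le_tdeg)
next
  case (Suc t)
  then obtain b c where a: "a = b + c" "b \<in> complete_gens 2 V" "c \<in> pw V (complete_gens 2 V) t"
    unfolding pw.simps by blast
  \<comment> \<open>An edge has degree 2 and meets \<open>i\<close> at most once, so it contributes
    at least 1 to the degree off \<open>i\<close>.\<close>
  then show ?case
    using Suc.IH[of c] complete_gens_props(3)[OF V a(2)] complete_gens_props(4)[OF V a(2), of i]
    by (simp add: lookup_add)
qed

text \<open>Let \<open>r\<close> be the degree of \<open>a\<close> off \<open>i\<close>. If
  \<open>lookup a i\<close> exceeded \<open>r\<close>, cutting it down to \<open>r\<close> would
  leave a balanced vector of degree \<open>2 * r\<close>, so \<open>a\<close> would lie in the power
  \<open>r\<close>, whence r \<le> t. But adding to coordinate \<open>i\<close> does not change the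
  degree off \<open>i\<close>, so saturation and \<open>pw_graph_bound\<close> give r \<ge> t + 1.
  With all coordinates balanced, \<open>a\<close> lies in the power \<open>tdeg a div 2\<close>,
  which is therefore at most \<open>t\<close>.\<close>

lemma jmon_complete_graph:
  assumes V: "finite V" and a: "a \<in> jmon V (complete_gens 2 V) t"
  shows "tdeg a \<in> {2 * t, 2 * t + 1} \<and> (\<forall>i\<in>V. 2 * lookup a i \<le> tdeg a)"
proof -
  note C = complete_gens_props[OF V, where m = 2]
  have aV: "a \<in> expo V" and apw: "a \<in> pw V (complete_gens 2 V) t" "a \<notin> pw V (complete_gens 2 V) (Suc t)"
    using a pw_expo[OF C(2)] by (auto simp: jmon_def)
  have half: "2 * lookup a i \<le> tdeg a" if i: "i \<in> V" for i
  proof (rule ccontr)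
    assume big: "\<not> 2 * lookup a i \<le> tdeg a"
    define r where "r = tdeg a - lookup a i"
    have deg: "tdeg a = lookup a i + r" using lookup_le_tdeg[of a i] by (simp add: r_def)
    then have rlt: "r < lookup a i" using big by simp
    have "\<exists>d. a = single i (lookup a i - r) + d"
      unfolding ex_add_iff by (auto simp: lookup_single when_def)
    then obtain d where d: "a = single i (lookup a i - r) + d" ..
    have degd: "tdeg d = 2 * r" using arg_cong[OF d, of tdeg] deg rlt by simp
    have di: "lookup d i = r" using arg_cong[OF d, of "\<lambda>x. lookup x i"] rlt by (simp add: lookup_add)
    have "lookup d j \<le> r" for j
    proof (cases "j = i")
      case False
      have "lookup d i + lookup d j \<le> tdeg d"
      proof -
        have "\<exists>e. d = (single i (lookup d i) + single j (lookup d j)) + e"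
          unfolding ex_add_iff using False by (auto simp: lookup_add lookup_single when_def)
        then obtain e where "d = (single i (lookup d i) + single j (lookup d j)) + e" ..
        from arg_cong[OF this, of tdeg] show ?thesis by simp
      qed
      then show ?thesis using di degd by simp
    qed (simp add: di)
    moreover have "d \<in> expo V" using aV by (subst (asm) d) simp
    ultimately have "d \<in> pw V (complete_gens 2 V) r"
      using degd by (intro complete_pw[OF V]) auto
    then have "a \<in> pw V (complete_gens 2 V) r"
      using pw_add[OF C(2), of d r "single i (lookup a i - r)"] d i by (simp add: add.commute)
    then have "\<not> Suc t \<le> r" using apw(2) pw_antimono[OF C(2), of "Suc t" r] by blast
    moreover obtain N where "a + single i N \<in> pw V (complete_gens 2 V) (Suc t)"
      using a i by (auto simp: jmon_def satur_def)
    from pw_graph_bound[OF V i this] have "Suc t \<le> r" using deg by (simp add: lookup_add)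
    ultimately show False by simp
  qed
  have "a \<in> pw V (complete_gens 2 V) (tdeg a div 2)"
  proof (rule complete_pw[OF V aV])
    show "lookup a i \<le> tdeg a div 2" for i
      using half[of i] lookup_outside[OF aV, of i] by (cases "i \<in> V") auto
  qed simp
  then have "\<not> Suc t \<le> tdeg a div 2" using apw(2) pw_antimono[OF C(2), of "Suc t"] by blast
  moreover have "2 * t \<le> tdeg a" using C(3) apw(1) by (intro tdeg_pw[of "complete_gens 2 V" 2 a V])
  ultimately show ?thesis using half by auto
qed

text \<open>Two coordinates cannot both exceed half the degree, so the unbalanced vectors split
  disjointly according to the offending node, and each part is a translate of a smaller level. The
  sum form avoids a subtraction of natural numbers.\<close>

lemma card_balanced_level:
  assumes V: "finite V" and s: "1 \<le> s"
  shows "card {a \<in> level V s. \<forall>i\<in>V. 2 * lookup a i \<le> s} + card V * card (level V (s - s div 2 - 1)) = card (level V s)"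
proof -
  \<comment> \<open>The least integer above half of \<open>s\<close>. It is at most \<open>s\<close>
    because \<open>s\<close> is positive, so the translated level has nonnegative degree.\<close>
  define h where "h = Suc (s div 2)"
  define H where "H i = {a \<in> level V s. s < 2 * lookup a i}" for i
  have h: "h \<le> s" "s - h = s - s div 2 - 1" using s by (auto simp: h_def)
  have H: "card (H i) = card (level V (s - s div 2 - 1))" if i: "i \<in> V" for i
  proof -
    have "H i = {c \<in> level V s. \<exists>d. c = single i h + d}"
      unfolding H_def ex_add_iff by (auto simp: lookup_single when_def h_def)
    then show ?thesis using card_level_translate[of "single i h" V s] i h by simp
  qed
  have disj: "H i \<inter> H j = {}" if "i \<noteq> j" for i j
  proof -
    have False if c: "c \<in> H i" "c \<in> H j" for c
    proof -
      have "\<exists>e. c = (single i (lookup c i) + single j (lookup c j)) + e"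
        unfolding ex_add_iff using \<open>i \<noteq> j\<close> by (auto simp: lookup_add lookup_single when_def)
      then obtain e where "c = (single i (lookup c i) + single j (lookup c j)) + e" ..
      from arg_cong[OF this, of tdeg] show False using c by (simp add: H_def level_def)
    qed
    then show ?thesis by blast
  qed
  have fin: "finite (H i)" for i unfolding H_def using V by simp
  have "level V s = {a \<in> level V s. \<forall>i\<in>V. 2 * lookup a i \<le> s} \<union> (\<Union>i\<in>V. H i)"
    by (auto simp: H_def not_le)
  moreover have "{a \<in> level V s. \<forall>i\<in>V. 2 * lookup a i \<le> s} \<inter> (\<Union>i\<in>V. H i) = {}"
    by (force simp: H_def)
  ultimately have "card (level V s) = card {a \<in> level V s. \<forall>i\<in>V. 2 * lookup a i \<le> s} + card (\<Union>i\<in>V. H i)"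
    using V fin by (metis (no_types, lifting) card_Un_disjoint finite_UN finite_Un finite_level)
  also have "card (\<Union>i\<in>V. H i) = (\<Sum>i\<in>V. card (H i))"
    using V fin disj by (intro card_UN_disjoint) auto
  also have "\<dots> = card V * card (level V (s - s div 2 - 1))" using H by simp
  finally show ?thesis by simp
qed

text \<open>The binomial coefficient is a product of \<open>d\<close> factors
  \<open>(x t + k) / k\<close>, each of which, divided by \<open>t\<close>, tends to \<alpha> /
  k.\<close>

lemma choose_asymptotics:
  fixes x :: "nat \<Rightarrow> nat"
  assumes x: "(\<lambda>t. real (x t) / real t) \<longlonglongrightarrow> \<alpha>"
  shows "(\<lambda>t. real ((x t + d) choose d) / real t ^ d) \<longlonglongrightarrow> \<alpha> ^ d / fact d"
proof (induction d)
  case 0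
  show ?case by simp
next
  case (Suc d)
  have rec: "real ((x t + Suc d) choose Suc d) / real t ^ Suc d
      = (real (x t) / real t + real (Suc d) * inverse (real t)) / real (Suc d) * (real ((x t + d) choose d) / real t ^ d)" for t
  proof -
    have "Suc d * ((x t + Suc d) choose Suc d) = (x t + Suc d) * ((x t + d) choose d)"
      using Suc_times_binomial_eq[of "x t + d" d] by (simp add: mult.commute)
    then have "real (Suc d) * real ((x t + Suc d) choose Suc d) = (real (x t) + real (Suc d)) * real ((x t + d) choose d)"
      by (metis of_nat_add of_nat_mult)
    then have "real ((x t + Suc d) choose Suc d) = (real (x t) + real (Suc d)) * real ((x t + d) choose d) / real (Suc d)"
      by (simp add: field_simps)
    moreover have "real (x t) / real t + real (Suc d) * inverse (real t) = (real (x t) + real (Suc d)) / real t"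
      by (simp add: add_divide_distrib inverse_eq_divide)
    ultimately show ?thesis by (simp only: power_Suc) (simp add: mult_ac)
  qed
  have "(\<lambda>t. (real (x t) / real t + real (Suc d) * inverse (real t)) / real (Suc d) * (real ((x t + d) choose d) / real t ^ d))
      \<longlonglongrightarrow> (\<alpha> + real (Suc d) * 0) / real (Suc d) * (\<alpha> ^ d / fact d)"
    by (intro tendsto_intros x Suc lim_inverse_n) simp
  then show ?case unfolding rec by (simp add: field_simps)
qed

text \<open>The levels of degree \<open>2 * t\<close> and \<open>2 * t + 1\<close> each have leading
  coefficient \<open>2 ^ d / fact d\<close>, and removing the unbalanced vectors subtracts
  \<open>card V / fact d\<close> from each. As \<open>card V\<close> is \<open>Suc d\<close>,
  multiplication by \<open>fact d\<close> gives the stated bound.\<close>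

lemma jmon_complete_graph_limit:
  assumes V: "finite V" "card V = Suc d"
    and L: "(\<lambda>t. real (card (jmon V (complete_gens 2 V) t)) / real t ^ d) \<longlonglongrightarrow> L"
  shows "fact d * L \<le> 2 ^ card V - 2 * real (card V)"
proof -
  let ?F = "\<lambda>s. real ((s + d) choose d)"
  let ?n = "real (card V)"
  have bound: "real (card (jmon V (complete_gens 2 V) t)) \<le> ?F (2 * t) + ?F (2 * t + 1) - ?n * ?F (t - 1) - ?n * ?F t"
    if t: "1 \<le> t" for t
  proof -
    let ?A = "\<lambda>s. {a \<in> level V s. \<forall>i\<in>V. 2 * lookup a i \<le> s}"
    have fin: "finite (?A s)" for s using V(1) by simp
    have "jmon V (complete_gens 2 V) t \<subseteq> ?A (2 * t) \<union> ?A (2 * t + 1)"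
      using jmon_complete_graph[OF V(1)] pw_expo[OF complete_gens_props(2)[OF V(1)]]
      by (fastforce simp: level_def jmon_def)
    then have "card (jmon V (complete_gens 2 V) t) \<le> card (?A (2 * t) \<union> ?A (2 * t + 1))"
      by (rule card_mono[rotated]) (intro finite_UnI fin)
    also have "\<dots> \<le> card (?A (2 * t)) + card (?A (2 * t + 1))" by (rule card_Un_le)
    finally have two: "real (card (jmon V (complete_gens 2 V) t)) \<le> real (card (?A (2 * t))) + real (card (?A (2 * t + 1)))"
      by simp
    have ex: "real (card (?A s)) = ?F s - ?n * ?F (s - s div 2 - 1)" if "1 \<le> s" for s
    proof -
      have "real (card (?A s)) + ?n * real (card (level V (s - s div 2 - 1))) = real (card (level V s))"
        using arg_cong[OF card_balanced_level[OF V(1) that], of real] unfolding of_nat_add of_nat_mult .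
      then show ?thesis unfolding card_level[OF V] by linarith
    qed
    \<comment> \<open>The parity of the degree decides the degree of the translated level:
      \<open>t - 1\<close> in the even case and \<open>t\<close> in the odd case, with the same
      asymptotics.\<close>
    have half: "2 * t - 2 * t div 2 - 1 = t - 1" "2 * t + 1 - (2 * t + 1) div 2 - 1 = t" by auto
    have "1 \<le> 2 * t" "1 \<le> 2 * t + 1" using t by auto
    then show ?thesis using two ex[of "2 * t"] ex[of "2 * t + 1"] unfolding half by linarith
  qed
  have c: "(\<lambda>t. real t / real t) \<longlonglongrightarrow> 1"
    by (rule tendsto_eventually) (auto simp: eventually_sequentially intro!: exI[of _ 1])
  have l1: "(\<lambda>t. real (2 * t) / real t) \<longlonglongrightarrow> 2"
    by (rule tendsto_eventually) (auto simp: eventually_sequentially intro!: exI[of _ 1])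
  have l2: "(\<lambda>t. real (2 * t + 1) / real t) \<longlonglongrightarrow> 2"
  proof -
    have "(\<lambda>t. real (2 * t) / real t + inverse (real t)) \<longlonglongrightarrow> 2 + 0" by (intro tendsto_add l1 lim_inverse_n)
    moreover have "real (2 * t) / real t + inverse (real t) = real (2 * t + 1) / real t" for t
      by (simp add: add_divide_distrib inverse_eq_divide)
    ultimately show ?thesis by simp
  qed
  have l3: "(\<lambda>t. real (t - 1) / real t) \<longlonglongrightarrow> 1"
  proof -
    have "(\<lambda>t. real t / real t - inverse (real t)) \<longlonglongrightarrow> 1 - 0" by (intro tendsto_diff c lim_inverse_n)
    moreover have "\<forall>\<^sub>F t in sequentially. real t / real t - inverse (real t) = real (t - 1) / real t"
      unfolding eventually_sequentially by (intro exI[of _ 1]) (auto simp: of_nat_diff field_simps)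
    ultimately have "(\<lambda>t. real (t - 1) / real t) \<longlonglongrightarrow> 1 - 0" by (rule Lim_transform_eventually)
    then show ?thesis by simp
  qed
  have "(\<lambda>t. ?F (2 * t) / real t ^ d + ?F (2 * t + 1) / real t ^ d - ?n * (?F (t - 1) / real t ^ d) - ?n * (?F t / real t ^ d))
     \<longlonglongrightarrow> 2 ^ d / fact d + 2 ^ d / fact d - ?n * (1 ^ d / fact d) - ?n * (1 ^ d / fact d)"
    by (intro tendsto_intros choose_asymptotics l1 l2 l3 c)
  moreover have "\<forall>\<^sub>F t in sequentially. real (card (jmon V (complete_gens 2 V) t)) / real t ^ d
     \<le> ?F (2 * t) / real t ^ d + ?F (2 * t + 1) / real t ^ d - ?n * (?F (t - 1) / real t ^ d) - ?n * (?F t / real t ^ d)"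
    unfolding eventually_sequentially
  proof (intro exI[of _ 1] allI impI)
    fix t :: nat assume t: "1 \<le> t"
    have "real (card (jmon V (complete_gens 2 V) t)) / real t ^ d
      \<le> (?F (2 * t) + ?F (2 * t + 1) - ?n * ?F (t - 1) - ?n * ?F t) / real t ^ d"
      by (intro divide_right_mono bound t) simp
    then show "real (card (jmon V (complete_gens 2 V) t)) / real t ^ d
     \<le> ?F (2 * t) / real t ^ d + ?F (2 * t + 1) / real t ^ d - ?n * (?F (t - 1) / real t ^ d) - ?n * (?F t / real t ^ d)"
      by (simp add: diff_divide_distrib add_divide_distrib)
  qed
  ultimately have "L \<le> 2 ^ d / fact d + 2 ^ d / fact d - ?n * (1 ^ d / fact d) - ?n * (1 ^ d / fact d)"
    by (intro tendsto_le[OF sequentially_bot _ L])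
  also have "\<dots> = (2 ^ card V - 2 * ?n) / fact d" using V(2) by (simp add: field_simps)
  finally show ?thesis by (simp add: pos_le_divide_eq mult.commute)
qed

section \<open>From exponent counts to j-multiplicities\<close>

lemma prod_indet: "finite e \<Longrightarrow> (\<Prod>v\<in>e. indet v) = (single (emon e) 1 :: ('v, 'k::field) mpol)"
  by (induction e rule: finite_induct) (simp_all add: emon_def indet_def mult_single)

context node_localization
begin

lemma edge_ideal_eq:
  assumes "nodes G = V" "edges G \<subseteq> Pow V"
  shows "edge_ideal K G = loc (pw V (emon ` edges G) 1)"
proof -
  have "edge_ideal K G = Idl\<^bsub>R\<^esub> ((\<lambda>e. frac (\<Prod>v\<in>e. indet v) 1) ` edges G)"
    by (simp add: edge_ideal_def assms(1) S_def)
  also have "(\<lambda>e. frac (\<Prod>v\<in>e. indet v) 1) ` edges G = (\<lambda>b. frac (single b 1) 1) ` emon ` edges G"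
    unfolding image_image using assms(2) finite_subset[OF _ finite_V]
    by (intro image_cong refl) (simp add: prod_indet subset_iff)
  also have "Idl\<^bsub>R\<^esub> ((\<lambda>b. frac (single b 1) 1) ` emon ` edges G) = loc (pw V (emon ` edges G) 1)"
    using assms(2) by (intro genideal_loc) (auto intro!: emon_expo)
  finally show ?thesis .
qed

lemma j_multiplicity_edge_ideal:
  assumes d: "card V = Suc d" and G: "nodes G = V" "edges G \<subseteq> Pow V"
    and L: "(\<lambda>t. real (card (jmon V (emon ` edges G) t)) / real t ^ d) \<longlonglongrightarrow> L"
  shows "j_multiplicity R (edge_ideal K G) = ereal (fact d * L)"
proof -
  let ?B = "emon ` edges G"
  have B: "finite ?B" "?B \<subseteq> expo V"
    using G(2) finite_subset[OF G(2)] finite_V by (auto intro!: emon_expo)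
  have dim: "the_enat (krull_dim R) - 1 = d" by (simp add: krull_dim_node_ring d)
  have "(\<lambda>t. ereal (real (card (jmon V ?B t)) / real t ^ d)) \<longlonglongrightarrow> ereal L"
    using L by simp
  \<comment> \<open>At \<open>t = 0\<close> the real and the extended real quotient may differ,
    because division by zero has different values; the limit does not see this.\<close>
  moreover have "\<forall>\<^sub>F t in sequentially. ereal (real (card (jmon V ?B t)) / real t ^ d)
      = ereal_of_enat (enat (card (jmon V ?B t))) / ereal (real t ^ d)"
    unfolding eventually_sequentially by (intro exI[of _ 1]) auto
  ultimately have "(\<lambda>t. ereal_of_enat (enat (card (jmon V ?B t))) / ereal (real t ^ d)) \<longlonglongrightarrow> ereal L"
    by (rule Lim_transform_eventually)
  then have "lim (\<lambda>t. ereal_of_enat (enat (card (jmon V ?B t))) / ereal (real t ^ d)) = ereal L"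
    by (rule limI)
  then show ?thesis
    unfolding j_multiplicity_def Let_def dim edge_ideal_eq[OF G] length_local_cohomology[OF B] by simp
qed

end

text \<open>Both multiplicities are produced as real numbers together with their comparison. The
  limit \<open>M\<close> of the counts is kept so that the graph case can bound it
  explicitly.\<close>

lemma j_multiplicity_uniform:
  assumes G: "uniform_hypergraph m G" and d: "card (nodes G) = Suc d"
  obtains L M where
    "j_multiplicity (node_ring TYPE('k::field) (nodes G)) (edge_ideal TYPE('k) G) = ereal (fact d * L)"
    "j_multiplicity (node_ring TYPE('k) (nodes G)) (edge_ideal TYPE('k) (complete_hypergraph m (nodes G))) = ereal (fact d * M)"
    "L \<le> M"
    "(\<lambda>t. real (card (jmon (nodes G) (complete_gens m (nodes G)) t)) / real t ^ d) \<longlonglongrightarrow> M"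
proof -
  let ?V = "nodes G"
  have V: "finite ?V" "edges G \<subseteq> Pow ?V" "\<forall>e\<in>edges G. card e = m" "1 \<le> m"
    using G by (auto simp: uniform_hypergraph_def hypergraph_def)
  interpret node_localization ?V "TYPE('k)" by unfold_locales (rule V(1))
  have B: "emon ` edges G \<subseteq> complete_gens m ?V" using V by (auto simp: complete_gens_def)
  note C = complete_gens_props[OF V(1), where m = m]
  have Bf: "finite (emon ` edges G)" "emon ` edges G \<subseteq> expo ?V" using B C(1,2) finite_subset by blast+
  obtain L where L: "(\<lambda>t. real (card (jmon ?V (emon ` edges G) t)) / real t ^ d) \<longlonglongrightarrow> L"
    using card_jmon_limit[OF V(1) d Bf, of m] B C(3) by blast
  obtain M where M: "(\<lambda>t. real (card (jmon ?V (complete_gens m ?V) t)) / real t ^ d) \<longlonglongrightarrow> M"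
    using card_jmon_limit[OF V(1) d C(1-3)] by blast
  have CG: "nodes (complete_hypergraph m ?V) = ?V" "edges (complete_hypergraph m ?V) \<subseteq> Pow ?V"
    "emon ` edges (complete_hypergraph m ?V) = complete_gens m ?V"
    by (auto simp: complete_hypergraph_def complete_gens_def)
  show ?thesis
  proof (rule that)
    show "j_multiplicity R (edge_ideal TYPE('k) G) = ereal (fact d * L)"
      by (rule j_multiplicity_edge_ideal[OF d refl V(2) L])
    show "j_multiplicity R (edge_ideal TYPE('k) (complete_hypergraph m ?V)) = ereal (fact d * M)"
      by (rule j_multiplicity_edge_ideal[OF d CG(1,2)]) (simp only: CG(3) M)
    show "L \<le> M" by (rule jmon_limit_le_complete[OF V(1) d V(4) B L M])
  qed (rule M)
qed

theorem corollary9p4: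
  fixes G :: "'v hypergraph"
  shows "(\<forall>m. uniform_hypergraph m G \<longrightarrow>
            j_multiplicity (node_ring TYPE('k::field) (nodes G)) (edge_ideal TYPE('k) G)
              \<le> j_multiplicity (node_ring TYPE('k) (nodes G))
                   (edge_ideal TYPE('k) (complete_hypergraph m (nodes G))))
       \<and> (simple_graph G \<longrightarrow>
            j_multiplicity (node_ring TYPE('k) (nodes G)) (edge_ideal TYPE('k) G)
              \<le> ereal (2 ^ card (nodes G) - 2 * real (card (nodes G))))"
proof -
  have dim: "\<exists>d. card (nodes G) = Suc d" if "uniform_hypergraph m G" for m
    using that by (intro not0_implies_Suc) (auto simp: uniform_hypergraph_def hypergraph_def)
  show ?thesis
  proof (intro conjI allI impI)
    fix m assume G: "uniform_hypergraph m G"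
    then obtain d where d: "card (nodes G) = Suc d" using dim by blast
    show "j_multiplicity (node_ring TYPE('k) (nodes G)) (edge_ideal TYPE('k) G)
      \<le> j_multiplicity (node_ring TYPE('k) (nodes G)) (edge_ideal TYPE('k) (complete_hypergraph m (nodes G)))"
      by (rule j_multiplicity_uniform[OF G d, where 'k = 'k]) simp
  next
    assume "simple_graph G"
    then have G: "uniform_hypergraph 2 G" by (simp add: simple_graph_def)
    then obtain d where d: "card (nodes G) = Suc d" using dim by blast
    have V: "finite (nodes G)" using G by (simp add: uniform_hypergraph_def hypergraph_def)
    obtain L M where LM: "j_multiplicity (node_ring TYPE('k) (nodes G)) (edge_ideal TYPE('k) G) = ereal (fact d * L)" "L \<le> M"
      "(\<lambda>t. real (card (jmon (nodes G) (complete_gens 2 (nodes G)) t)) / real t ^ d) \<longlonglongrightarrow> M"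
      by (rule j_multiplicity_uniform[OF G d, where 'k = 'k])
    have "fact d * L \<le> fact d * M" using LM(2) by simp
    also have "\<dots> \<le> 2 ^ card (nodes G) - 2 * real (card (nodes G))"
      by (rule jmon_complete_graph_limit[OF V d LM(3)])
    finally show "j_multiplicity (node_ring TYPE('k) (nodes G)) (edge_ideal TYPE('k) G)
      \<le> ereal (2 ^ card (nodes G) - 2 * real (card (nodes G)))" by (simp add: LM(1))
  qed
qed

end
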